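(* Let $D$ be a finite simple digraph with $|D|\ge 2$ vertices. Suppose that for every ordered pair of distinct vertices $u,v$ of $D$ such that there is no arc from $u$ to $v$, we have $d^+(u)+d^-(v)\ge |D|-1$. Then $D$ has a directed Hamilton cycle, unless $D\in\mathcal{D}_1$, or $D\in\mathcal{D}_2$, or $D\in\mathcal{D}_3$, or $D=D_4$ (all up to isomorphism), where $\mathcal{D}_1,\mathcal{D}_2,\mathcal{D}_3,D_4$ are the exceptional digraphs defined in the context.
   Context: Digraphs are finite and simple (no loops, no parallel arcs; the two opposite arcs $(u,v)$ and $(v,u)$ may both be present). $|D|$ is the number of vertices, $d^+(u)$ and $d^-(u)$ are the out-degree and in-degree of $u$. A directed Hamilton cycle is a directed cycle through all vertices (a directed cycle of length $2$, formed by two opposite arcs, is allowed when $|D|=2$). $\overleftrightarrow{K}_n$ denotes the complete digraph on $n\geq 1$ vertices (both arcs $(x,y)$ and $(y,x)$ for every pair of distinct vertices $x,y$). $I_n$ denotes the digraph with $n$ vertices and no arcs. "Adding arcs of two directions between $x$ and $y$" means adding both $(x,y)$ and $(y,x)$. $\mathcal{D}_1$: all digraphs obtained, for some integers $m,n\ge 1$, by identifying one vertex of $\overleftrightarrow{K}_{n+1}$ with one vertex of $\overleftrightarrow{K}_{m+1}$. $\mathcal{D}_2$: all digraphs obtained, for some integer $n\ge 1$, from an arbitrary digraph $D_2$ on $n$ vertices and a disjoint copy of $I_{n+1}$ by adding arcs of two directions between every vertex of $I_{n+1}$ and every vertex of $D_2$. $\mathcal{D}_3$: let $D_3$ be the digraph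 on the four vertices $v_0,v_1,x,y$ with arcs $(v_0,y),(y,v_1),(v_1,x),(x,v_0),(x,y),(y,x)$. $\mathcal{D}_3$ is the set of all digraphs obtained, for some integer $n\ge1$, from $D_3$ and a disjoint copy of $\overleftrightarrow{K}_n$ by adding arcs of two directions between $v_i$ ($i=0,1$) and every vertex of $\overleftrightarrow{K}_n$, and possibly adding any of the arcs $(v_0,v_1)$ and $(v_1,v_0)$, or both. $D_4$: the digraph on the seven vertices $h,c_1,c_2,c_3,t_1,t_2,t_3$ (indices modulo $3$) with exactly the following $21$ arcs: $(h,c_i)$ and $(c_i,h)$ for $i=1,2,3$; $(c_i,c_{i+1})$ for $i=1,2,3$; $(t_i,t_j)$ for all $i\neq j$; $(t_i,c_i)$ for $i=1,2,3$; and $(c_i,t_{i+1})$ for $i=1,2,3$. *)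

theory Defs
  imports "Graph_Theory.Graph_Theory"
begin

text \<open>
  Digraphs without loops and parallel arcs are the locale \<^locale>\<open>digraph\<close> of the Graph Theory
  entry; the exceptional digraphs are built as \<^typ>\<open>'a pair_pre_digraph\<close>, whose arcs are
  ordered pairs of vertices.
\<close>

text \<open>
  A cycle passes through exactly the tails of its arcs. In a loopfree digraph a cycle has
  length at least 2, and two opposite arcs do form a cycle of length 2.
\<close>

definition (in pre_digraph) hamilton_cycle :: "'b awalk \<Rightarrow> bool" where
  "hamilton_cycle p \<longleftrightarrow> cycle p \<and> tail G ` set p = verts G"

definition two_way :: "'a set \<Rightarrow> 'a set \<Rightarrow> ('a \<times> 'a) set" where
  "two_way A B = A \<times> B \<union> B \<times> A"

text \<open>
  Identifying a vertex of \<open>K\<close> with a vertex of \<open>L\<close> is expressed by letting \<open>K\<close> and \<open>L\<close>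
  share exactly one vertex.
\<close>

definition family_D1 :: "'a pair_pre_digraph set" where
  "family_D1 = {\<lparr>pverts = pverts K \<union> pverts L, parcs = parcs K \<union> parcs L\<rparr> | K L m n z.
     m \<ge> 1 \<and> n \<ge> 1 \<and>
     complete_digraph (n + 1) (with_proj K) \<and>
     complete_digraph (m + 1) (with_proj L) \<and>
     pverts K \<inter> pverts L = {z}}"

text \<open>The arcless digraph on \<open>n + 1\<close> vertices is given by its vertex set \<open>I\<close>.\<close>

definition family_D2 :: "'a pair_pre_digraph set" where
  "family_D2 = {\<lparr>pverts = pverts H \<union> I, parcs = parcs H \<union> two_way I (pverts H)\<rparr> | H I n.
     n \<ge> 1 \<and>
     pair_digraph H \<and> card (pverts H) = n \<and>
     finite I \<and> card I = n + 1 \<and>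
     I \<inter> pverts H = {}}"

definition digraph_D3 :: "'a \<Rightarrow> 'a \<Rightarrow> 'a \<Rightarrow> 'a \<Rightarrow> 'a pair_pre_digraph" where
  "digraph_D3 v0 v1 x y =
     \<lparr>pverts = {v0, v1, x, y},
      parcs = {(v0, y), (y, v1), (v1, x), (x, v0), (x, y), (y, x)}\<rparr>"

definition family_D3 :: "'a pair_pre_digraph set" where
  "family_D3 =
     {\<lparr>pverts = pverts (digraph_D3 v0 v1 x y) \<union> pverts K,
       parcs = parcs (digraph_D3 v0 v1 x y) \<union> parcs K \<union> two_way {v0, v1} (pverts K) \<union> A\<rparr>
      | v0 v1 x y K A n.
     n \<ge> 1 \<and>
     distinct [v0, v1, x, y] \<and>
     complete_digraph n (with_proj K) \<and>
     pverts (digraph_D3 v0 v1 x y) \<inter> pverts K = {} \<and>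
     A \<subseteq> {(v0, v1), (v1, v0)}}"

text \<open>The index set \<open>{1, 2, 3}\<close> modulo 3 is represented by \<open>{0, 1, 2}\<close>.\<close>

datatype D4_vertex = Hub | C nat | T nat

definition digraph_D4 :: "D4_vertex pair_pre_digraph" where
  "digraph_D4 =
     \<lparr>pverts = {Hub} \<union> C ` {..<3} \<union> T ` {..<3},
      parcs = two_way {Hub} (C ` {..<3})
        \<union> {(C i, C ((i + 1) mod 3)) | i. i < 3}
        \<union> {(T i, T j) | i j. i < 3 \<and> j < 3 \<and> i \<noteq> j}
        \<union> {(T i, C i) | i. i < 3}
        \<union> {(C i, T ((i + 1) mod 3)) | i. i < 3}\<rparr>"

end

theory Submission
  imports Defs
begin

text \<open>Suppose there is no Hamilton cycle and let $C$ be a longest cycle. Degree counting along $C$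
shows that the vertices outside $C$ again form a cycle $Q$. Open $Q$ into a path $P$, and let $S$ be a segment of $C$
between an in-neighbour of the start of $P$ and an out-neighbour of the end of $P$ that contains no such
neighbour itself. Neither can $P$ be inserted into the rest of $C$, as $C$ is longest, nor can $S$ be
inserted into the rest of $C$ closed up through $P$, as there is no Hamilton cycle. The two resulting bounds
turn every degree inequality involved into an equality.

If a segment $S$ with at least two vertices occurs, this rigidity determines how $Q$ and $S$ are joined to
the rest of $C$, and only $\mathcal{D}_1$ and $\mathcal{D}_3$ survive. Otherwise some cycle misses
exactly one vertex $w$, and $w$ has total degree $|D| - 1$, so that for consecutive vertices
$x, y$ of this cycle exactly one of the arcs $xw$ and $wy$ is present. A vertex not adjacent to $w$
may be exchanged with $w$. Choosing $w$ with as many two-way neighbours as possible forces all neighbours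
of $w$ to be two-way neighbours, so neighbours and non-neighbours of $w$ alternate on the cycle. The
non-neighbours are then either pairwise non-adjacent, which gives $\mathcal{D}_2$, or pairwise joined
in both directions, which gives $\mathcal{D}_3$ with $n = 1$ or $D_4$.\<close>

section \<open>Cycles as vertex lists\<close>

text \<open>With the bound \<open>|D|\<close> in place of \<open>|D| - 1\<close> (Woodall's
  condition) the counts along a cycle would contradict each other outright. Here they meet exactly,
  so at the decisive stage counting refutes nothing and all structure must be read off equalities.
  The counting device is always the same. If a path cannot be inserted between consecutive vertices
  x, y of a list of m vertices, then at most one of the arcs from x to its start and from its end to
  y exists. So its ends have at most m + 1 such arcs, or m on a cycle, and equality means exactly
  one arc per consecutive pair. The obstacle is that this concerns only the two ends of one path,
  and that the gap S depends on the path. Tightness first makes Q a clique; then any two of its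
  vertices can serve as ends, and the gaps found for different ends have to be compared. For a
  single missing vertex w there are no ends to vary. Exchanging w with a non-neighbour takes over
  this role: the degree conditions for the nonadjacent pair force equal in-degrees and out-degrees,
  so the new cycle is again tight.\<close>

text \<open>A single vertex counts as a cycle, so that the complement of a longest cycle is always the
vertex set of a cycle.\<close>

definition cyc :: "('a \<Rightarrow> 'a \<Rightarrow> bool) \<Rightarrow> 'a list \<Rightarrow> bool" where
  "cyc E xs \<longleftrightarrow> xs \<noteq> [] \<and> distinct xs \<and> successively E xs \<and> (length xs = 1 \<or> E (last xs) (hd xs))"

lemmas path_simps = successively_append_iff successively_Cons

lemma cyc_append:
  assumes "us \<noteq> []" "vs \<noteq> []"
  shows "cyc E (us @ vs) \<longleftrightarrow> distinct (us @ vs) \<and> successively E us \<and> successively E vs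
    \<and> E (last us) (hd vs) \<and> E (last vs) (hd us)"
proof -
  have "length (us @ vs) \<noteq> 1" using assms by (cases us; cases vs) auto
  then show ?thesis using assms by (auto simp add: cyc_def successively_append_iff)
qed

lemma cyc_rotate: "cyc E (us @ vs) \<Longrightarrow> cyc E (vs @ us)"
  by (cases "us = []"; cases "vs = []") (auto simp: cyc_append)

lemma cyc_rev: "cyc (\<lambda>x y. E y x) (rev xs) \<longleftrightarrow> cyc E xs"
  by (cases "xs = []") (auto simp: cyc_def last_rev hd_rev)

lemma cyc_starting_at:
  assumes "cyc E xs" "x \<in> set xs"
  obtains ys where "cyc E (x # ys)" "set (x # ys) = set xs"
proof -
  obtain us vs where "xs = us @ x # vs" using assms(2) by (meson split_list)
  then show ?thesis using assms(1) cyc_rotate[of E us "x # vs"] that[of "vs @ us"] by auto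
qed

lemma cyc_ending_at:
  assumes "cyc E xs" "x \<in> set xs"
  obtains ys where "cyc E (ys @ [x])" "set (ys @ [x]) = set xs"
proof -
  obtain us vs where "xs = us @ x # vs" using assms(2) by (meson split_list)
  then show ?thesis using assms(1) cyc_rotate[of E "us @ [x]" vs] that[of "vs @ us"] by auto
qed

lemma cyc_path_between:
  assumes "cyc E xs" "x \<in> set xs" "y \<in> set xs"
  obtains ps where "ps \<noteq> []" "distinct ps" "successively E ps" "hd ps = x" "last ps = y" "set ps \<subseteq> set xs"
proof -
  obtain ys where ys: "cyc E (x # ys)" "set (x # ys) = set xs" using cyc_starting_at assms by metis
  then obtain us vs where "x # ys = us @ y # vs" using assms(3) by (metis split_list)
  then have *: "x # ys = (us @ [y]) @ vs" by simp
  have "hd (us @ [y]) = x" using * by (metis append_is_Nil_conv hd_append2 list.sel(1) not_Cons_self2)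
  moreover have "distinct (us @ [y])" "successively E (us @ [y])" "set (us @ [y]) \<subseteq> set xs"
    using ys unfolding * cyc_def by (auto simp: successively_append_iff)
  ultimately show ?thesis using that[of "us @ [y]"] by simp
qed

section \<open>Counting arcs between a list and the ends of a path\<close>

lemma card_filter_append:
  "distinct (us @ vs) \<Longrightarrow> card {x \<in> set (us @ vs). A x} = card {x \<in> set us. A x} + card {x \<in> set vs. A x}"
proof -
  assume d: "distinct (us @ vs)"
  have "{x \<in> set (us @ vs). A x} = {x \<in> set us. A x} \<union> {x \<in> set vs. A x}" by auto
  then show ?thesis using d by (auto intro!: card_Un_disjoint)
qed

lemma card_filter_Cons:
  "distinct (u # vs) \<Longrightarrow> card {x \<in> set (u # vs). A x} = of_bool (A u) + card {x \<in> set vs. A x}"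
proof -
  assume d: "distinct (u # vs)"
  have "{x \<in> set (u # vs). A x} = (if A u then insert u {x \<in> set vs. A x} else {x \<in> set vs. A x})" by auto
  then show ?thesis using d by (auto)
qed

text \<open>With \<open>A x\<close> for an arc from \<open>x\<close> to the start of a path and \<open>B x\<close> for an arc from its end to
\<open>x\<close>, this says that the path cannot be inserted between consecutive vertices of \<open>ts\<close>.\<close>

definition unlinked :: "('a \<Rightarrow> bool) \<Rightarrow> ('a \<Rightarrow> bool) \<Rightarrow> 'a list \<Rightarrow> bool" where
  "unlinked A B ts \<longleftrightarrow> (\<forall>us vs. ts = us @ vs \<longrightarrow> us \<noteq> [] \<longrightarrow> vs \<noteq> [] \<longrightarrow> \<not> (A (last us) \<and> B (hd vs)))"

lemma unlinkedI:
  "(\<And>us vs. ts = us @ vs \<Longrightarrow> us \<noteq> [] \<Longrightarrow> vs \<noteq> [] \<Longrightarrow> A (last us) \<Longrightarrow> B (hd vs) \<Longrightarrow> False) \<Longrightarrow> unlinked A B ts"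
  unfolding unlinked_def by blast

lemma unlinkedD: "unlinked A B (us @ vs) \<Longrightarrow> us \<noteq> [] \<Longrightarrow> vs \<noteq> [] \<Longrightarrow> \<not> (A (last us) \<and> B (hd vs))"
  unfolding unlinked_def by blast

lemma unlinked_append:
  assumes "unlinked A B (us @ vs)"
  shows "unlinked A B us" "unlinked A B vs"
proof -
  show "unlinked A B us"
  proof (rule unlinkedI)
    fix xs ys assume "us = xs @ ys" "xs \<noteq> []" "ys \<noteq> []" "A (last xs)" "B (hd ys)"
    then show False using unlinkedD[of A B xs "ys @ vs"] assms by simp
  qed
  show "unlinked A B vs"
  proof (rule unlinkedI)
    fix xs ys assume "vs = xs @ ys" "xs \<noteq> []" "ys \<noteq> []" "A (last xs)" "B (hd ys)"
    then show False using unlinkedD[of A B "us @ xs" ys] assms by simp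
  qed
qed

text \<open>Each consecutive pair \<open>x\<close>, \<open>y\<close> contributes at most 1 to
  \<open>A x\<close> plus \<open>B y\<close>. Only \<open>A\<close> of the last and \<open>B\<close>
  of the first vertex belong to no pair; keeping them as indicators, instead of bounding them by 1,
  allows the estimate to be added up over pieces of a list.\<close>

lemma unlinked_count:
  assumes "ts \<noteq> []" "distinct ts" "unlinked A B ts"
  shows "card {x \<in> set ts. A x} + card {x \<in> set ts. B x} + 1 \<le> length ts + of_bool (A (last ts)) + of_bool (B (hd ts))"
  using assms
proof (induction ts rule: list_nonempty_induct)
  case (single x)
  have "{y \<in> set [x]. A y} = (if A x then {x} else {})" "{y \<in> set [x]. B y} = (if B x then {x} else {})" by auto
  then show ?case by auto
next
  case (cons x ts)
  have IH: "card {x \<in> set ts. A x} + card {x \<in> set ts. B x} + 1 \<le> length ts + of_bool (A (last ts)) + of_bool (B (hd ts))"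
    using cons.IH cons.prems unlinked_append(2)[of A B "[x]" ts] by simp
  have "\<not> (A x \<and> B (hd ts))" using unlinkedD[of A B "[x]" ts] cons by simp
  then have e: "of_bool (A x) + of_bool (B (hd ts)) \<le> (1::nat)" by auto
  have l: "last (x # ts) = last ts" "hd (x # ts) = x" "length (x # ts) = length ts + 1" using cons.hyps by auto
  show ?case
    unfolding card_filter_Cons[OF cons.prems(1)] l using IH e by linarith
qed

lemma path_count:
  assumes "distinct ts" "unlinked A B ts"
  shows "card {x \<in> set ts. A x} + card {x \<in> set ts. B x} \<le> length ts + 1"
proof (cases "ts = []")
  case False
  have "of_bool (A (last ts)) \<le> (1::nat)" "of_bool (B (hd ts)) \<le> (1::nat)" by auto
  then show ?thesis using unlinked_count[OF False assms] by linarith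
qed auto

text \<open>The estimates for \<open>us\<close> and \<open>vs\<close> add up to one less than the
  assumed total unless the pair across the cut contributes.\<close>

lemma unlinked_count_tight:
  assumes "distinct (us @ vs)" "unlinked A B (us @ vs)" "us \<noteq> []" "vs \<noteq> []"
    and "length (us @ vs) + of_bool (A (last vs)) + of_bool (B (hd us))
      \<le> card {x \<in> set (us @ vs). A x} + card {x \<in> set (us @ vs). B x} + 1"
  shows "A (last us) \<longleftrightarrow> \<not> B (hd vs)"
proof -
  have "card {x \<in> set us. A x} + card {x \<in> set us. B x} + 1 \<le> length us + of_bool (A (last us)) + of_bool (B (hd us))"
    "card {x \<in> set vs. A x} + card {x \<in> set vs. B x} + 1 \<le> length vs + of_bool (A (last vs)) + of_bool (B (hd vs))"
    using unlinked_count[of us A B] unlinked_count[of vs A B] assms(1,3,4) unlinked_append[OF assms(2)] by simp_all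
  moreover have "length (us @ vs) = length us + length vs" by simp
  ultimately have "1 \<le> of_bool (A (last us)) + (of_bool (B (hd vs)) :: nat)"
    using assms(5) unfolding card_filter_append[OF assms(1)] by linarith
  then show ?thesis using unlinkedD[OF assms(2-4)] by (auto simp: of_bool_def split: if_splits)
qed

lemma path_count_tight:
  assumes "distinct ts" "unlinked A B ts"
    and ge: "card {x \<in> set ts. A x} + card {x \<in> set ts. B x} \<ge> length ts + 1"
  shows "ts \<noteq> []" "A (last ts)" "B (hd ts)"
    and "\<And>us vs. ts = us @ vs \<Longrightarrow> us \<noteq> [] \<Longrightarrow> vs \<noteq> [] \<Longrightarrow> A (last us) \<longleftrightarrow> \<not> B (hd vs)"
proof -
  show ts: "ts \<noteq> []"
  proof
    assume "ts = []" then show False using ge by simp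
  qed
  have e: "of_bool (A (last ts)) \<le> (1::nat)" "of_bool (B (hd ts)) \<le> (1::nat)" by auto
  have f: "of_bool (A (last ts)) = (1::nat)" "of_bool (B (hd ts)) = (1::nat)"
    using unlinked_count[OF ts assms(1,2)] ge e by linarith+
  show "A (last ts)" using f(1) by (cases "A (last ts)") auto
  show "B (hd ts)" using f(2) by (cases "B (hd ts)") auto
  show "A (last us) \<longleftrightarrow> \<not> B (hd vs)" if "ts = us @ vs" "us \<noteq> []" "vs \<noteq> []" for us vs
  proof (rule unlinked_count_tight)
    have "last ts = last vs" "hd ts = hd us" using that by auto
    then show "length (us @ vs) + of_bool (A (last vs)) + of_bool (B (hd us))
      \<le> card {x \<in> set (us @ vs). A x} + card {x \<in> set (us @ vs). B x} + 1"
      using f ge by (simp add: that(1)[symmetric] del: set_append)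
  qed (use assms that in auto)
qed

text \<open>On a cycle the last and the first vertex form one more consecutive pair, which lowers
  the bound of \<open>path_count\<close> by one.\<close>

lemma cyclic_count:
  assumes "xs \<noteq> []" "distinct xs" "\<not> (A (last xs) \<and> B (hd xs))" "unlinked A B xs"
  shows "card {x \<in> set xs. A x} + card {x \<in> set xs. B x} \<le> length xs"
    and "\<And>us vs. length xs \<le> card {x \<in> set xs. A x} + card {x \<in> set xs. B x} \<Longrightarrow>
      xs = us @ vs \<Longrightarrow> us \<noteq> [] \<Longrightarrow> vs \<noteq> [] \<Longrightarrow> A (last us) \<longleftrightarrow> \<not> B (hd vs)"
proof -
  have e: "of_bool (A (last xs)) + of_bool (B (hd xs)) \<le> (1::nat)" using assms(3) by auto
  note p = unlinked_count[OF assms(1,2,4)]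
  show "card {x \<in> set xs. A x} + card {x \<in> set xs. B x} \<le> length xs" using p e by linarith
  show "A (last us) \<longleftrightarrow> \<not> B (hd vs)"
    if l: "length xs \<le> card {x \<in> set xs. A x} + card {x \<in> set xs. B x}" and s: "xs = us @ vs" "us \<noteq> []" "vs \<noteq> []" for us vs
  proof (rule unlinked_count_tight)
    have "last xs = last vs" "hd xs = hd us" using s by auto
    then show "length (us @ vs) + of_bool (A (last vs)) + of_bool (B (hd us))
      \<le> card {x \<in> set (us @ vs). A x} + card {x \<in> set (us @ vs). B x} + 1" using e l by (simp add: s(1)[symmetric] del: set_append)
  qed (use assms s in auto)
qed

text \<open>Take the first vertex satisfying \<open>B\<close> and, before it, the last one
  satisfying \<open>A\<close>.\<close>

lemma exists_gap:
  assumes "\<exists>x\<in>set xs. B x"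
  obtains X S Y where "xs = X @ S @ Y" "Y \<noteq> []" "B (hd Y)" "X \<noteq> [] \<longrightarrow> A (last X)"
    "\<forall>x\<in>set S. \<not> A x \<and> \<not> B x"
proof -
  obtain ys x zs where 1: "xs = ys @ x # zs" "B x" "\<forall>y\<in>set ys. \<not> B y"
    using split_list_first_prop[OF assms] by auto
  show ?thesis
  proof (cases "\<exists>y\<in>set ys. A y")
    case True
    then obtain us y vs where "ys = us @ y # vs" "A y" "\<forall>z\<in>set vs. \<not> A z" using split_list_last_prop[OF True] by auto
    then show ?thesis using 1 that[of "us @ [y]" vs "x # zs"] by auto
  next
    case False
    then show ?thesis using 1 that[of "[]" ys "x # zs"] by auto
  qed
qed

text \<open>Two cycles with the same vertices may differ. Rotations keep the cyclic order, so that
  \<open>rot_unique\<close> can compare two decompositions of one cycle entry by entry.\<close>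

definition rot :: "'a list \<Rightarrow> 'a list \<Rightarrow> bool" where
  "rot xs ys \<longleftrightarrow> (\<exists>i. ys = rotate i xs)"

lemma rot_append: "rot xs (us @ vs) \<Longrightarrow> rot xs (vs @ us)"
  unfolding rot_def by (metis rotate_append rotate_rotate)

lemma rot_set: "rot xs ys \<Longrightarrow> set ys = set xs" and rot_length: "rot xs ys \<Longrightarrow> length ys = length xs"
  by (auto simp: rot_def)

lemma rot_cyc: "rot xs ys \<Longrightarrow> cyc E xs \<Longrightarrow> cyc E ys"
  unfolding rot_def using cyc_rotate[of E] by (metis append_take_drop_id rotate_drop_take)

lemma rot_unique:
  assumes "rot xs (x # us)" "rot xs (x # vs)" "distinct xs"
  shows "us = vs"
proof -
  obtain i j where ij: "x # us = rotate i xs" "x # vs = rotate j xs" using assms by (auto simp: rot_def)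
  have xs: "xs \<noteq> []" using ij(1) by auto
  have "xs ! (i mod length xs) = x" "xs ! (j mod length xs) = x"
    using hd_rotate_conv_nth[OF xs, of i] hd_rotate_conv_nth[OF xs, of j] ij by (metis list.sel(1))+
  then have "i mod length xs = j mod length xs"
    using assms(3) xs by (metis length_greater_0_conv mod_less_divisor nth_eq_iff_index_eq)
  then have "rotate i xs = rotate j xs" by (metis rotate_conv_mod)
  then have "x # us = x # vs" using ij by metis
  then show ?thesis by simp
qed

lemma rot_ending_at:
  assumes "x \<in> set xs"
  obtains ys where "rot xs (ys @ [x])"
proof -
  obtain us vs where s: "xs = us @ x # vs" using assms by (meson split_list)
  have "rot xs ((us @ [x]) @ vs)" unfolding rot_def s by (rule exI[of _ 0]) simp
  then have "rot xs ((vs @ us) @ [x])" using rot_append by fastforce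
  then show ?thesis using that by blast
qed

text \<open>The cycle is first rotated to end in a vertex satisfying \<open>A\<close>. If
  \<open>exists_gap\<close> finds no such vertex in front of the gap, this one precedes the gap
  cyclically.\<close>

lemma rot_gap:
  assumes "\<exists>x\<in>set cs. A x" "\<exists>x\<in>set cs. B x"
  obtains ts S where "rot cs (ts @ S)" "ts \<noteq> []" "A (last ts)" "B (hd ts)" "\<forall>x\<in>set S. \<not> A x \<and> \<not> B x"
proof -
  obtain x where x: "x \<in> set cs" "A x" using assms by auto
  obtain ys where ys: "rot cs (ys @ [x])" using rot_ending_at[OF x(1)] by blast
  then obtain X S Y where g: "ys @ [x] = X @ S @ Y" "Y \<noteq> []" "B (hd Y)" "X \<noteq> [] \<longrightarrow> A (last X)"
    "\<forall>x\<in>set S. \<not> A x \<and> \<not> B x"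
    using exists_gap[of "ys @ [x]" B A] assms(2) rot_set by metis
  have c: "rot cs ((Y @ X) @ S)" using ys rot_append[of cs "X @ S" Y] unfolding g(1) by simp
  have "last Y = x" using g(1,2) by (metis append_is_Nil_conv last_appendR last_snoc)
  then have "A (last (Y @ X))" using g(4) x(2) by (cases "X = []") auto
  then show ?thesis using that[of "Y @ X" S] c g by auto
qed

section \<open>Degree counts\<close>

definition nin :: "('a \<Rightarrow> 'a \<Rightarrow> bool) \<Rightarrow> 'a set \<Rightarrow> 'a \<Rightarrow> nat" where
  "nin E X v = card {u \<in> X. E u v}"

definition nout :: "('a \<Rightarrow> 'a \<Rightarrow> bool) \<Rightarrow> 'a set \<Rightarrow> 'a \<Rightarrow> nat" where
  "nout E X v = card {u \<in> X. E v u}"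

lemma nin_converse: "nin (\<lambda>x y. E y x) = nout E" and nout_converse: "nout (\<lambda>x y. E y x) = nin E"
  by (simp_all add: nin_def nout_def fun_eq_iff)

lemma nin_Un:
  assumes "finite X" "finite Y" "X \<inter> Y = {}"
  shows "nin E (X \<union> Y) v = nin E X v + nin E Y v"
proof -
  have "{u \<in> X \<union> Y. E u v} = {u \<in> X. E u v} \<union> {u \<in> Y. E u v}" by auto
  then show ?thesis using assms by (auto simp: nin_def intro!: card_Un_disjoint)
qed

lemma nout_Un:
  "finite X \<Longrightarrow> finite Y \<Longrightarrow> X \<inter> Y = {} \<Longrightarrow> nout E (X \<union> Y) v = nout E X v + nout E Y v"
  using nin_Un[of X Y "\<lambda>x y. E y x"] by (simp add: nin_converse[of E])

lemma nin_append: "distinct (us @ vs) \<Longrightarrow> nin E (set (us @ vs)) v = nin E (set us) v + nin E (set vs) v"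
  and nout_append: "distinct (us @ vs) \<Longrightarrow> nout E (set (us @ vs)) v = nout E (set us) v + nout E (set vs) v"
  by (simp_all add: nin_Un nout_Un)

lemma nin_insert: "finite X \<Longrightarrow> x \<notin> X \<Longrightarrow> nin E (insert x X) v = nin E X v + of_bool (E x v)"
  and nout_insert: "finite X \<Longrightarrow> x \<notin> X \<Longrightarrow> nout E (insert x X) v = nout E X v + of_bool (E v x)"
  using nin_Un[of X "{x}" E v] nout_Un[of X "{x}" E v]
  by (auto simp: nin_def nout_def Collect_conv_if)

lemma nin_eq_0: "(\<And>u. u \<in> X \<Longrightarrow> \<not> E u v) \<Longrightarrow> nin E X v = 0"
  and nout_eq_0: "(\<And>u. u \<in> X \<Longrightarrow> \<not> E v u) \<Longrightarrow> nout E X v = 0"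
  by (auto simp: nin_def nout_def card_eq_0_iff)

lemma nin_pos: "finite X \<Longrightarrow> nin E X v > 0 \<longleftrightarrow> (\<exists>u\<in>X. E u v)"
  and nout_pos: "finite X \<Longrightarrow> nout E X v > 0 \<longleftrightarrow> (\<exists>u\<in>X. E v u)"
  by (auto simp: nin_def nout_def card_gt_0_iff)

lemma nin_le: "finite X \<Longrightarrow> nin E X v \<le> card X"
  and nout_le: "finite X \<Longrightarrow> nout E X v \<le> card X"
  by (auto simp: nin_def nout_def intro!: card_mono)

lemma nin_le_Diff:
  assumes "finite X" "\<And>u. u \<in> Y \<Longrightarrow> \<not> E u v" "Y \<subseteq> X"
  shows "nin E X v + card Y \<le> card X"
    and "nin E X v + card Y = card X \<Longrightarrow> u \<in> X \<Longrightarrow> u \<notin> Y \<Longrightarrow> E u v"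
proof -
  have s: "{u \<in> X. E u v} \<subseteq> X - Y" using assms by auto
  have c: "card (X - Y) = card X - card Y" "card Y \<le> card X" "finite (X - Y)"
    using assms by (auto simp: card_Diff_subset finite_subset card_mono)
  show "nin E X v + card Y \<le> card X" using card_mono[OF c(3) s] c by (simp add: nin_def)
  show "E u v" if "nin E X v + card Y = card X" "u \<in> X" "u \<notin> Y"
  proof -
    have "{u \<in> X. E u v} = X - Y" by (rule card_subset_eq[OF c(3) s]) (use that c in \<open>simp add: nin_def\<close>)
    then show ?thesis using that by auto
  qed
qed

lemma nout_le_Diff:
  assumes "finite X" "\<And>u. u \<in> Y \<Longrightarrow> \<not> E v u" "Y \<subseteq> X"
  shows "nout E X v + card Y \<le> card X"
    and "nout E X v + card Y = card X \<Longrightarrow> u \<in> X \<Longrightarrow> u \<notin> Y \<Longrightarrow> E v u"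
  using nin_le_Diff(1)[of X Y "\<lambda>x y. E y x" v, unfolded nin_converse, OF assms]
    nin_le_Diff(2)[of X Y "\<lambda>x y. E y x" v u, unfolded nin_converse, OF assms] by blast+

lemma clique_degree:
  assumes "finite X" "x \<in> X" "\<not> E x x" "\<And>y z. y \<in> X \<Longrightarrow> z \<in> X \<Longrightarrow> y \<noteq> z \<Longrightarrow> E y z"
  shows "nin E X x + 1 = card X" "nout E X x + 1 = card X"
proof -
  have "{y \<in> X. E y x} = X - {x}" "{y \<in> X. E x y} = X - {x}" using assms(2-4) by auto
  then show "nin E X x + 1 = card X" "nout E X x + 1 = card X"
    unfolding nin_def nout_def using card_Suc_Diff1[OF assms(1,2)] by simp_all
qed

lemma cyc_insert:
  assumes "cyc E (us @ vs)" "us \<noteq> []" "P \<noteq> []" "distinct P" "successively E P"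
    and "set P \<inter> set (us @ vs) = {}" "E (last us) (hd P)" "E (last P) (hd (vs @ us))"
  shows "cyc E (us @ P @ vs)"
proof (cases "vs = []")
  case True
  then have "distinct us" "successively E us" using assms(1) by (simp_all add: cyc_def)
  then show ?thesis using True assms by (auto simp: cyc_append)
next
  case False
  then show ?thesis using assms by (auto simp: cyc_append successively_append_iff)
qed

section \<open>A longest cycle and its complement\<close>

text \<open>The hypotheses are invariant under reversing all arcs; the lemmas named \<open>converse\<dots>\<close> yield the dual
of each statement.\<close>

locale ore =
  fixes V :: "'a set" and E :: "'a \<Rightarrow> 'a \<Rightarrow> bool"
  assumes finite_V: "finite V"
    and arc_V: "E u v \<Longrightarrow> u \<in> V" "E u v \<Longrightarrow> v \<in> V"
    and irrefl: "\<not> E v v"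
    and degrees: "u \<in> V \<Longrightarrow> v \<in> V \<Longrightarrow> u \<noteq> v \<Longrightarrow> \<not> E u v \<Longrightarrow> card V \<le> nout E V u + nin E V v + 1"
    and card_V: "card V \<ge> 2"
    and not_hamiltonian: "set xs = V \<Longrightarrow> \<not> cyc E xs"
begin

abbreviation inn where "inn \<equiv> nin E"
abbreviation out where "out \<equiv> nout E"

lemma converse: "ore V (\<lambda>x y. E y x)"
proof
  show "finite V" "card V \<ge> 2" by (rule finite_V card_V)+
  show "u \<in> V" "v \<in> V" if "E v u" for u v using arc_V that by blast+
  show "\<not> E v v" for v by (rule irrefl)
  show "\<not> cyc (\<lambda>x y. E y x) xs" if "set xs = V" for xs
    using not_hamiltonian[of "rev xs"] that cyc_rev[of E "rev xs"] by simp
  show "card V \<le> nout (\<lambda>x y. E y x) V u + nin (\<lambda>x y. E y x) V v + 1"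
    if "u \<in> V" "v \<in> V" "u \<noteq> v" "\<not> E v u" for u v
    using degrees[of v u] that by (simp add: nin_converse[of E] nout_converse[of E])
qed

end

locale ore_cycle = ore +
  fixes cs :: "'a list"
  assumes cycle: "cyc E cs" and cycle_V: "set cs \<subseteq> V"
    and longest: "cyc E xs \<Longrightarrow> set xs \<subseteq> V \<Longrightarrow> length xs \<le> length cs"
begin

lemma C_facts: "distinct cs" "cs \<noteq> []" "card (set cs) = length cs"
  using cycle by (auto simp: cyc_def distinct_card)

text \<open>The target \<open>hd (vs @ us)\<close> instead of \<open>hd vs\<close> includes
  insertion at the closing arc, where \<open>vs\<close> is empty.\<close>

lemma no_detour:
  assumes "cyc E (us @ vs)" "set (us @ vs) = set cs" "us \<noteq> []"
    and "P \<noteq> []" "distinct P" "successively E P" "set P \<subseteq> V - set cs"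
  shows "\<not> (E (last us) (hd P) \<and> E (last P) (hd (vs @ us)))"
proof
  assume e: "E (last us) (hd P) \<and> E (last P) (hd (vs @ us))"
  have "cyc E (us @ P @ vs)" using cyc_insert[of E us vs P] assms e by auto
  moreover have "set (us @ P @ vs) \<subseteq> V" using assms cycle_V by auto
  ultimately have "length (us @ P @ vs) \<le> length cs" by (rule longest)
  moreover have "length (us @ vs) = length cs"
    using C_facts assms(1,2) by (metis cyc_def distinct_card)
  ultimately have "length P = 0" unfolding length_append by linarith
  then show False using assms(4) by simp
qed

lemma no_detour_vertex:
  assumes "u \<in> V" "u \<notin> set cs"
  shows "inn (set cs) u + out (set cs) u \<le> length cs"
  unfolding nin_def nout_def
proof (rule cyclic_count(1))
  show "\<not> (E (last cs) u \<and> E u (hd cs))"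
    using no_detour[of cs "[]" "[u]"] cycle assms C_facts by auto
  show "unlinked (\<lambda>x. E x u) (E u) cs"
  proof (rule unlinkedI)
    fix us vs assume "cs = us @ vs" "us \<noteq> []" "vs \<noteq> []" "E (last us) u" "E u (hd vs)"
    then show False using no_detour[of us vs "[u]"] cycle assms by auto
  qed
qed (use C_facts in auto)

text \<open>Exchanging \<open>S\<close> for \<open>P\<close> again gives a cycle, so maximality
  bounds \<open>P\<close> by \<open>S\<close>. On the cycle, the in-neighbours of
  \<open>hd P\<close> and the out-neighbours of \<open>last P\<close> all lie on \<open>ts\<close>,
  into which \<open>P\<close> cannot be inserted.\<close>

lemma gap_count:
  assumes P: "P \<noteq> []" "distinct P" "successively E P" "set P \<subseteq> V - set cs"
    and ts: "cyc E (ts @ S)" "set (ts @ S) = set cs" "ts \<noteq> []" "E (last ts) (hd P)" "E (last P) (hd ts)"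
    and S: "\<forall>x\<in>set S. \<not> E x (hd P) \<and> \<not> E (last P) x"
  shows "length P \<le> length S" "unlinked (\<lambda>x. E x (hd P)) (E (last P)) ts"
    "inn (set cs) (hd P) = inn (set ts) (hd P)" "out (set cs) (last P) = out (set ts) (last P)"
    "inn (set ts) (hd P) + out (set ts) (last P) \<le> length ts + 1"
proof -
  have d: "distinct (ts @ S)" "successively E ts" using ts(1) by (auto simp: cyc_def successively_append_iff)
  have l: "length (ts @ S) = length cs" using C_facts ts(1,2) by (metis cyc_def distinct_card)
  have "cyc E (ts @ P)" using d P ts by (auto simp: cyc_append)
  then have "length (ts @ P) \<le> length cs" using P(4) ts(2) cycle_V by (intro longest) auto
  then show "length P \<le> length S" using l by simp
  show u: "unlinked (\<lambda>x. E x (hd P)) (E (last P)) ts"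
  proof (rule unlinkedI)
    fix us vs assume "ts = us @ vs" "us \<noteq> []" "vs \<noteq> []" "E (last us) (hd P)" "E (last P) (hd vs)"
    then show False using no_detour[of us "vs @ S" P] ts P by auto
  qed
  show "inn (set cs) (hd P) = inn (set ts) (hd P)" "out (set cs) (last P) = out (set ts) (last P)"
    using nin_append[OF d(1), of E "hd P"] nout_append[OF d(1), of E "last P"] S
      nin_eq_0[of "set S" E "hd P"] nout_eq_0[of "set S" E "last P"] unfolding ts(2) by auto
  show "inn (set ts) (hd P) + out (set ts) (last P) \<le> length ts + 1"
    using path_count[OF _ u] d unfolding nin_def nout_def by auto
qed

lemma R_facts:
  shows "finite (V - set cs)" "card V = length cs + card (V - set cs)"
    "inn V x = inn (set cs) x + inn (V - set cs) x" "out V x = out (set cs) x + out (V - set cs) x"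
proof -
  show f: "finite (V - set cs)" using finite_V by simp
  show "card V = length cs + card (V - set cs)"
    using C_facts(3) cycle_V finite_V by (metis card_Diff_subset card_mono finite_set le_add_diff_inverse)
  have "set cs \<union> (V - set cs) = V" using cycle_V by auto
  then show "inn V x = inn (set cs) x + inn (V - set cs) x" "out V x = out (set cs) x + out (V - set cs) x"
    using nin_Un[of "set cs" "V - set cs" E x] nout_Un[of "set cs" "V - set cs" E x] f by auto
qed

lemma inn_C_le: "c \<in> set cs \<Longrightarrow> inn (set cs) c + 1 \<le> length cs"
  and out_C_le: "c \<in> set cs \<Longrightarrow> out (set cs) c + 1 \<le> length cs"
  using nin_le_Diff(1)[of "set cs" "{c}" E c] nout_le_Diff(1)[of "set cs" "{c}" E c] irrefl C_facts by auto

lemma converse_cycle: "ore_cycle V (\<lambda>x y. E y x) (rev cs)"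
proof -
  interpret c: ore V "\<lambda>x y. E y x" by (rule converse)
  show ?thesis
  proof unfold_locales
    show "cyc (\<lambda>x y. E y x) (rev cs)" using cycle by (simp add: cyc_rev)
    show "set (rev cs) \<subseteq> V" using cycle_V by simp
    show "length xs \<le> length (rev cs)" if "cyc (\<lambda>x y. E y x) xs" "set xs \<subseteq> V" for xs
      using longest[of "rev xs"] that cyc_rev[of E "rev xs"] by simp
  qed
qed

end

section \<open>The complement of a longest cycle is spanned by a cycle\<close>

locale ore_rest_path = ore_cycle +
  fixes P :: "'a list"
  assumes path: "P \<noteq> []" "distinct P" "successively E P" "set P \<subseteq> V - set cs"
    and longest_path: "P' \<noteq> [] \<Longrightarrow> distinct P' \<Longrightarrow> successively E P' \<Longrightarrow> set P' \<subseteq> V - set cs \<Longrightarrow> length P' \<le> length P"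
begin

abbreviation "R \<equiv> V - set cs"

lemma converse_rest_path: "ore_rest_path V (\<lambda>x y. E y x) (rev cs) (rev P)"
proof -
  interpret c: ore_cycle V "\<lambda>x y. E y x" "rev cs" by (rule converse_cycle)
  show ?thesis
  proof unfold_locales
    show "rev P \<noteq> []" "distinct (rev P)" "successively (\<lambda>x y. E y x) (rev P)" "set (rev P) \<subseteq> V - set (rev cs)"
      using path by simp_all
    show "length P' \<le> length (rev P)"
      if "P' \<noteq> []" "distinct P'" "successively (\<lambda>x y. E y x) P'" "set P' \<subseteq> V - set (rev cs)" for P'
      using longest_path[of "rev P'"] that by simp
  qed
qed

lemma ends_P: "hd P \<in> set P" "last P \<in> set P" "hd P \<in> R" "last P \<in> R"
  using path(1) subsetD[OF path(4)] by auto

lemma card_R: "card R = length P + card (R - set P)"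
  using path R_facts(1) by (metis card_Diff_subset card_mono distinct_card finite_set le_add_diff_inverse)

lemma into_first: "u \<in> R \<Longrightarrow> E u (hd P) \<Longrightarrow> u \<in> set P"
  using longest_path[of "u # P"] path by (auto simp: successively_Cons)

lemma inn_first:
  assumes "\<not> E (last P) (hd P)" "hd P \<noteq> last P"
  shows "inn R (hd P) + 2 \<le> length P"
proof -
  let ?Y = "insert (hd P) (insert (last P) (R - set P))"
  have "inn R (hd P) + card ?Y \<le> card R"
    by (rule nin_le_Diff(1)) (use R_facts(1) into_first assms(1) irrefl ends_P in auto)
  moreover have "card ?Y = card (R - set P) + 2" using assms(2) ends_P R_facts(1) by simp
  ultimately show ?thesis using card_R by linarith
qed

lemma out_last:
  assumes "\<not> E (last P) (hd P)" "hd P \<noteq> last P"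
  shows "out R (last P) + 2 \<le> length P"
  using ore_rest_path.inn_first[OF converse_rest_path] assms by (auto simp: hd_rev last_rev nin_converse[of E])

text \<open>By maximality of \<open>P\<close> the in-neighbours of \<open>hd P\<close> off the cycle
  lie on \<open>P\<close>. The part of \<open>P\<close> up to the last of them closes to a cycle,
  which is no longer than \<open>cs\<close>.\<close>

lemma inn_first_less: "inn R (hd P) + 1 \<le> length cs"
proof (cases "\<exists>y\<in>set P. E y (hd P)")
  case True
  then obtain us y vs where s: "P = us @ y # vs" "E y (hd P)" "\<forall>z\<in>set vs. \<not> E z (hd P)"
    using split_list_last_prop[OF True] by auto
  have ne: "us \<noteq> []" using s irrefl by auto
  then have us: "hd us = hd P" "hd P \<in> set us" using s(1) by (simp, metis hd_append2 hd_in_set)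
  have "successively E (us @ [y])" "distinct (us @ [y])" using path(2,3) unfolding s(1) by (auto simp: path_simps)
  then have "cyc E (us @ [y])" using ne us s(2) by (simp add: cyc_def)
  moreover have "set (us @ [y]) \<subseteq> V" using path(4) unfolding s(1) by auto
  ultimately have "length (us @ [y]) \<le> length cs" by (rule longest)
  moreover have "{u \<in> R. E u (hd P)} \<subseteq> set (us @ [y]) - {hd P}" using into_first s irrefl by auto
  then have "inn R (hd P) \<le> card (set (us @ [y]) - {hd P})" unfolding nin_def by (intro card_mono) auto
  moreover have "card (set (us @ [y])) = length us + 1" using path(2) unfolding s(1) by (simp add: distinct_card)
  then have "card (set (us @ [y]) - {hd P}) = length us" using us(2) by simp
  ultimately show ?thesis by simp
next
  case False
  then have "inn R (hd P) = 0" using into_first by (intro nin_eq_0) blast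
  then show ?thesis using C_facts(2) by (cases cs) auto
qed

lemma out_last_less: "out R (last P) + 1 \<le> length cs"
  using ore_rest_path.inn_first_less[OF converse_rest_path] by (simp add: hd_rev nin_converse[of E])

text \<open>As \<open>hd P\<close> has few in-neighbours, the degree condition sends an arc from
  every vertex of the cycle to some vertex of \<open>P\<close>. Entering \<open>P\<close> from the
  predecessor of \<open>b\<close> and leaving from \<open>last P\<close> to \<open>b\<close> would
  be a detour.\<close>

lemma no_cycle_arc_first:
  assumes n: "\<not> E (last P) (hd P)" "hd P \<noteq> last P" "\<forall>c\<in>set cs. \<not> E c (hd P)" and b: "b \<in> set cs"
  shows "\<not> E (last P) b"
proof
  assume e: "E (last P) b"
  have i0: "inn (set cs) (hd P) = 0" using n(3) by (intro nin_eq_0) blast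
  have to_P: "\<exists>x\<in>set P. E c x" if c: "c \<in> set cs" for c
  proof -
    have "c \<in> V" "c \<noteq> hd P" "\<not> E c (hd P)" using c cycle_V ends_P n(3) by auto
    then have d: "card V \<le> out V c + inn V (hd P) + 1" using degrees ends_P by blast
    have "R = set P \<union> (R - set P)" using path by auto
    then have "out R c = out (set P) c + out (R - set P) c"
      using nout_Un[of "set P" "R - set P" E c] R_facts(1) by auto
    moreover have "out (R - set P) c \<le> card (R - set P)" using R_facts(1) by (intro nout_le) auto
    ultimately have "out (set P) c > 0"
      using d i0 R_facts(2) R_facts(4)[of c] R_facts(3)[of "hd P"] inn_first[OF n(1,2)] out_C_le[OF c] card_R by linarith
    then show ?thesis using nout_pos[of "set P" E c] by auto
  qed
  obtain ys where ys: "cyc E (b # ys)" "set (b # ys) = set cs" using cyc_starting_at[OF cycle b] by blast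
  have "last (b # ys) \<in> set cs" using ys(2) last_in_set[of "b # ys"] by blast
  then obtain x where x: "x \<in> set P" "E (last (b # ys)) x" using to_P by blast
  obtain P1 P2 where P12: "P = P1 @ x # P2" using x(1) by (meson split_list)
  have "distinct (x # P2)" "successively E (x # P2)" "set (x # P2) \<subseteq> V - set cs" "last (x # P2) = last P"
    using path unfolding P12 by (auto simp: successively_append_iff)
  then show False using no_detour[of "b # ys" "[]" "x # P2"] ys x e by auto
qed

lemma no_cycle_arc_last:
  assumes "\<not> E (last P) (hd P)" "hd P \<noteq> last P" "\<forall>c\<in>set cs. \<not> E (last P) c" "b \<in> set cs"
  shows "\<not> E b (hd P)"
  using ore_rest_path.no_cycle_arc_first[OF converse_rest_path, of b] assms by (auto simp: hd_rev last_rev)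

text \<open>Otherwise the degree condition applies to \<open>last P\<close> and \<open>hd P\<close>.
  If both ends have their arcs with the cycle, a gap of at least \<open>length P\<close> vertices is
  lost to them. If neither has, one degree is bounded through \<open>P\<close> and the other through
  \<open>cs\<close>. Both sums are too small, and the mixed cases are excluded by the preceding
  lemmas.\<close>

lemma closed: "cyc E P"
proof (rule ccontr)
  define a b where "a = hd P" and "b = last P"
  assume n: "\<not> cyc E P"
  then have l: "length P \<noteq> 1" and ba: "\<not> E b a" using path by (auto simp: cyc_def a_def b_def)
  have ab: "a \<noteq> b"
  proof
    assume "a = b"
    then have "length P = 1" using path(1,2) by (cases P) (auto simp: a_def b_def split: if_splits)
    then show False using l by simp
  qed
  note nba = ba[unfolded a_def b_def] ab[unfolded a_def b_def]
  note ends = ends_P[folded a_def b_def] and ia = inn_first[OF nba, folded a_def] and ob = out_last[OF nba, folded b_def]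
  have deg: "card V \<le> out V b + inn V a + 1" using degrees ends ba ab by auto
  consider (both) "\<exists>c\<in>set cs. E c a" "\<exists>c\<in>set cs. E b c" | (none) "\<forall>c\<in>set cs. \<not> E c a" "\<forall>c\<in>set cs. \<not> E b c"
    using no_cycle_arc_first[OF nba] no_cycle_arc_last[OF nba] unfolding a_def b_def by blast
  then show False
  proof cases
    case both
    obtain ts S where r: "rot cs (ts @ S)" and t: "ts \<noteq> []" "E (last ts) a" "E b (hd ts)" "\<forall>x\<in>set S. \<not> E x a \<and> \<not> E b x"
      using rot_gap[of cs "\<lambda>x. E x a" "E b", OF both] by blast
    note gc = gap_count[OF path rot_cyc[OF r cycle] rot_set[OF r] t(1), folded a_def b_def, OF t(2-4)]
    show False using gc(1,3,4,5) rot_length[OF r] ia ob deg R_facts(3)[of a] R_facts(4)[of b] R_facts(2) card_R by auto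
  next
    case none
    then have "inn (set cs) a = 0" "out (set cs) b = 0" by (auto intro!: nin_eq_0 nout_eq_0)
    then show False
      using inn_first_less[folded a_def] out_last_less[folded b_def] ia ob deg R_facts(3)[of a] R_facts(4)[of b] R_facts(2) card_R
      by linarith
  qed
qed

text \<open>As \<open>P\<close> closes up, it can be reopened to end at any \<open>x\<close>, and an
  arc leaving it would lengthen it.\<close>

lemma no_exit:
  assumes "x \<in> set P" "u \<in> R" "u \<notin> set P"
  shows "\<not> E x u"
proof
  assume e: "E x u"
  obtain ys where ys: "cyc E (ys @ [x])" "set (ys @ [x]) = set P" using cyc_ending_at[OF closed assms(1)] by blast
  have "length ((ys @ [x]) @ [u]) \<le> length P"
  proof (rule longest_path)
    show "successively E ((ys @ [x]) @ [u])" using ys(1) e by (simp add: cyc_def successively_append_iff)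
    show "distinct ((ys @ [x]) @ [u])" using ys assms(3) by (auto simp: cyc_def)
    show "set ((ys @ [x]) @ [u]) \<subseteq> R" using ys(2) assms(2) path(4) by auto
  qed simp
  moreover have "length (ys @ [x]) = length P" using ys path(2) by (metis cyc_def distinct_card)
  ultimately show False by simp
qed

lemma no_entry: "x \<in> set P \<Longrightarrow> u \<in> R \<Longrightarrow> u \<notin> set P \<Longrightarrow> \<not> E u x"
  using ore_rest_path.no_exit[OF converse_rest_path, of x u] by simp

text \<open>A vertex \<open>u\<close> off \<open>P\<close> is not adjacent to \<open>a\<close>, and
  the degree conditions in both directions are added. Each of the two has total degree at most
  \<open>length cs\<close> on the cycle. In the complement \<open>u\<close> misses \<open>P\<close>
  and \<open>a\<close> misses everything off \<open>P\<close>, which leaves the sum too small by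
  2.\<close>

lemma spanning: "set P = R"
proof (rule ccontr)
  define a where "a = hd P"
  assume "set P \<noteq> R"
  then obtain u where u: "u \<in> R" "u \<notin> set P" using path by auto
  note ends = ends_P[folded a_def]
  have uV: "u \<in> V" "u \<notin> set cs" "a \<in> V" "a \<notin> set cs" "u \<noteq> a" using u ends by auto
  then have deg: "card V \<le> out V u + inn V a + 1" "card V \<le> out V a + inn V u + 1"
    using degrees no_exit[OF ends(1) u] no_entry[OF ends(1) u] by auto
  have c1: "card (insert u (set P)) = length P + 1" using u path by (simp add: distinct_card)
  have c2: "card (insert a (R - set P)) = card (R - set P) + 1" using ends R_facts(1) by simp
  have s: "insert u (set P) \<subseteq> R" "insert a (R - set P) \<subseteq> R" using u path ends by auto
  have nu: "\<not> E x u" "\<not> E u x" if "x \<in> insert u (set P)" for x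
    using that no_exit[of x u] no_entry[of x u] u irrefl by blast+
  have na: "\<not> E x a" "\<not> E a x" if "x \<in> insert a (R - set P)" for x
    using that no_exit[of a x] no_entry[of a x] ends irrefl by blast+
  have "inn R u + card (insert u (set P)) \<le> card R" "out R u + card (insert u (set P)) \<le> card R"
    by (rule nin_le_Diff(1) nout_le_Diff(1); use R_facts(1) s nu in blast)+
  moreover have "inn R a + card (insert a (R - set P)) \<le> card R" "out R a + card (insert a (R - set P)) \<le> card R"
    by (rule nin_le_Diff(1) nout_le_Diff(1); use R_facts(1) s na in blast)+
  ultimately show False
    using deg R_facts(3,4)[of a] R_facts(3,4)[of u] no_detour_vertex[OF uV(1,2)] no_detour_vertex[OF uV(3,4)]
      R_facts(2) card_R c1 c2 by linarith
qed

end

lemma (in ore_cycle) rest_cycle: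
  obtains Q where "cyc E Q" "set Q = V - set cs"
proof -
  define rest_path where "rest_path P \<longleftrightarrow> P \<noteq> [] \<and> distinct P \<and> successively E P \<and> set P \<subseteq> V - set cs" for P
  have "V - set cs \<noteq> {}" using not_hamiltonian[of cs] cycle cycle_V by auto
  then obtain r where "r \<in> V - set cs" by auto
  then have "rest_path [r]" by (auto simp: rest_path_def)
  moreover have "\<forall>P. rest_path P \<longrightarrow> length P < card (V - set cs) + 1"
    using R_facts(1) by (metis rest_path_def card_mono distinct_card less_add_one order_le_less_trans)
  ultimately obtain P where P: "rest_path P" "\<And>P'. rest_path P' \<Longrightarrow> length P' \<le> length P"
    using ex_has_greatest_nat[of rest_path "[r]" length] by blast
  interpret ore_rest_path V E cs P by unfold_locales (use P in \<open>auto simp: rest_path_def\<close>)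
  show ?thesis using that closed spanning by blast
qed

section \<open>Gaps of a longest cycle\<close>

locale ore_split = ore_cycle +
  fixes Q :: "'a list"
  assumes Q_cycle: "cyc E Q" and Q_V: "set Q = V - set cs"
begin

lemma Q_facts: "distinct Q" "Q \<noteq> []" "card (set Q) = length Q"
  using Q_cycle by (auto simp: cyc_def distinct_card)

lemma card_split: "card V = length cs + length Q"
  using R_facts(2) Q_facts(3) by (simp add: Q_V[symmetric])

lemma inn_split: "inn V x = inn (set cs) x + inn (set Q) x" 
  and out_split: "out V x = out (set cs) x + out (set Q) x"
  using R_facts(3,4) by (simp_all add: Q_V[symmetric])

lemma inn_Q_le: "x \<in> set Q \<Longrightarrow> inn (set Q) x + 1 \<le> length Q"
  and out_Q_le: "x \<in> set Q \<Longrightarrow> out (set Q) x + 1 \<le> length Q"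
  using nin_le_Diff(1)[of "set Q" "{x}" E x] nout_le_Diff(1)[of "set Q" "{x}" E x] irrefl Q_facts by auto

lemma converse_split: "ore_split V (\<lambda>x y. E y x) (rev cs) (rev Q)"
proof -
  interpret c: ore_cycle V "\<lambda>x y. E y x" "rev cs" by (rule converse_cycle)
  show ?thesis by unfold_locales (use Q_cycle Q_V in \<open>simp_all add: cyc_rev\<close>)
qed

text \<open>Any two vertices of \<open>Q\<close> are joined by a path inside \<open>Q\<close>, so
  the entry and the exit of a detour can be chosen independently.\<close>

lemma no_bypass:
  assumes "cyc E (us @ vs)" "set (us @ vs) = set cs" "us \<noteq> []" "x \<in> set Q" "y \<in> set Q"
    and "E (last us) x"
  shows "\<not> E y (hd (vs @ us))"
proof -
  obtain ps where "ps \<noteq> []" "distinct ps" "successively E ps" "hd ps = x" "last ps = y" "set ps \<subseteq> set Q"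
    using cyc_path_between[OF Q_cycle assms(4,5)] by blast
  then show ?thesis using no_detour[of us vs ps] assms Q_V by auto
qed

text \<open>Otherwise the degree condition makes every vertex of the cycle send an arc to
  \<open>Q\<close>. By \<open>no_bypass\<close> no arc returns from \<open>Q\<close>, and then the
  degree condition fails for \<open>a\<close> and a vertex of the cycle.\<close>

lemma arc_into:
  assumes a: "a \<in> set Q"
  shows "\<exists>c\<in>set cs. E c a"
proof (rule ccontr)
  assume "\<not> ?thesis"
  then have no: "\<not> E c a" if "c \<in> set cs" for c using that by auto
  have aV: "a \<in> V" "a \<notin> set cs" using a Q_V by auto
  have i: "inn V a + 1 \<le> length Q" using inn_split[of a] nin_eq_0[of "set cs" E a] no inn_Q_le[OF a] by auto
  have to_Q: "\<exists>x\<in>set Q. E c x" if c: "c \<in> set cs" for c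
  proof -
    have "card V \<le> out V c + inn V a + 1" using degrees[of c a] no[OF c] c a cycle_V aV by blast
    then have "out (set Q) c > 0" using i out_split[of c] out_C_le[OF c] card_split by linarith
    then show ?thesis using nout_pos[of "set Q" E c] by auto
  qed
  have from_Q: "\<not> E y c" if c: "c \<in> set cs" and y: "y \<in> set Q" for c y
  proof -
    obtain ys where ys: "cyc E (c # ys)" "set (c # ys) = set cs" using cyc_starting_at[OF cycle c] by blast
    have "last (c # ys) \<in> set cs" using ys(2) last_in_set[of "c # ys"] by blast
    then obtain x where "x \<in> set Q" "E (last (c # ys)) x" using to_Q by blast
    then show ?thesis using no_bypass[of "c # ys" "[]" x y] ys y by auto
  qed
  obtain c where c: "c \<in> set cs" using C_facts(2) by (cases cs) auto
  have "card V \<le> out V a + inn V c + 1" using degrees[of a c] from_Q[OF c a] c a cycle_V aV by blast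
  moreover have "out (set cs) a = 0" "inn (set Q) c = 0"
    using from_Q a c by (auto intro!: nin_eq_0 nout_eq_0)
  ultimately show False
    using out_split[of a] inn_split[of c] inn_C_le[OF c] out_Q_le[OF a] card_split by linarith
qed

lemma arc_from: "a \<in> set Q \<Longrightarrow> \<exists>c\<in>set cs. E a c"
  using ore_split.arc_into[OF converse_split, of a] by simp

text \<open>There is no arc from \<open>last P\<close> to \<open>hd S\<close> and none from
  \<open>last S\<close> to \<open>hd P\<close>, so the two degree sums together are at least
  \<open>2 * (card V - 1)\<close>. From above, \<open>P\<close> and \<open>S\<close> each have at
  most \<open>length ts + 1\<close> arcs with \<open>ts\<close>, and the arcs inside
  \<open>Q\<close> and \<open>S\<close> add at most \<open>length Q - 1\<close> and
  \<open>length S - 1\<close>, twice each. The total is the same number, so every single bound is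
  attained.\<close>

lemma gap_tight:
  assumes P: "cyc E P" "set P = set Q"
    and ts: "cyc E (ts @ S)" "set (ts @ S) = set cs" "ts \<noteq> []" "E (last ts) (hd P)" "E (last P) (hd ts)"
    and S: "\<forall>x\<in>set S. \<not> E x (hd P) \<and> \<not> E (last P) x"
  shows "length Q \<le> length S"
    and "y \<in> set Q \<Longrightarrow> \<not> E y (hd S) \<and> \<not> E (last S) y"
    and "inn (set cs) (hd P) + out (set cs) (last P) = length ts + 1"
    and "\<And>us vs. ts = us @ vs \<Longrightarrow> us \<noteq> [] \<Longrightarrow> vs \<noteq> [] \<Longrightarrow> E (last us) (hd P) \<longleftrightarrow> \<not> E (last P) (hd vs)"
    and "x \<in> set S \<Longrightarrow> x \<noteq> hd S \<Longrightarrow> E x (hd S)"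
    and "x \<in> set S \<Longrightarrow> x \<noteq> last S \<Longrightarrow> E (last S) x"
    and "x \<in> set Q \<Longrightarrow> x \<noteq> hd P \<Longrightarrow> E x (hd P)"
    and "inn V (hd S) + out V (last P) + 1 = card V"
    and "out V (last S) + inn V (hd P) + 1 = card V"
proof -
  have dP: "P \<noteq> []" "distinct P" "successively E P" "set P \<subseteq> V - set cs"
    using P Q_V by (auto simp: cyc_def)
  have lP: "length P = length Q" using P Q_facts(3) dP(2) by (metis distinct_card)
  have dT: "distinct (ts @ S)" "successively E ts" "successively E S" using ts(1) by (auto simp: cyc_def successively_append_iff)
  have lC: "length ts + length S = length cs" using C_facts(3) ts(1,2) by (metis cyc_def distinct_card length_append)
  note gc = gap_count[OF dP ts S]
  show lS: "length Q \<le> length S" using gc(1) lP by simp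
  then have S0: "S \<noteq> []" using Q_facts(2) by auto
  have hl: "hd P \<in> set Q" "last P \<in> set Q" "hd S \<in> set cs" "last S \<in> set cs" "hd S \<in> set S" "last S \<in> set S" using dP(1) P(2) ts(2) S0 by auto
  show f: "\<not> E y (hd S) \<and> \<not> E (last S) y" if y: "y \<in> set Q" for y
  proof
    show "\<not> E y (hd S)" using no_bypass[OF ts(1,2,3) hl(1) y ts(4)] S0 by simp
    show "\<not> E (last S) y"
      using no_bypass[OF cyc_rotate[OF ts(1)] _ S0 y hl(2)] ts S0 by auto
  qed
  have V: "hd S \<in> V" "last S \<in> V" "hd P \<in> V" "last P \<in> V" "hd S \<noteq> last P" "last S \<noteq> hd P"
    using hl cycle_V Q_V by auto
  have d1: "card V \<le> out V (last P) + inn V (hd S) + 1" using degrees[of "last P" "hd S"] V f[OF hl(2)] by auto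
  have d2: "card V \<le> out V (last S) + inn V (hd P) + 1" using degrees[of "last S" "hd P"] V f[OF hl(1)] by auto
  have u: "unlinked (\<lambda>x. E x (hd S)) (E (last S)) ts"
  proof (rule unlinkedI)
    fix us vs assume T': "ts = us @ vs" "us \<noteq> []" "vs \<noteq> []" and e: "E (last us) (hd S)" "E (last S) (hd vs)"
    have "cyc E (us @ S @ vs @ P)" using T' e dT dP ts S0 by (auto simp: cyc_append successively_append_iff)
    moreover have "set (us @ S @ vs @ P) = V" using ts(2) T'(1) P(2) Q_V cycle_V by auto
    ultimately show False using not_hamiltonian by blast
  qed
  have c2: "inn (set ts) (hd S) + out (set ts) (last S) \<le> length ts + 1"
    using path_count[OF _ u] dT(1) unfolding nin_def nout_def by auto
  have cS: "card (set S) = length S" using dT(1) by (simp add: distinct_card)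
  have i1: "inn V (hd S) = inn (set ts) (hd S) + inn (set S) (hd S)"
    using inn_split[of "hd S"] nin_append[OF dT(1), of E "hd S"] nin_eq_0[of "set Q" E "hd S"] f unfolding ts(2) by auto
  have o1: "out V (last S) = out (set ts) (last S) + out (set S) (last S)"
    using out_split[of "last S"] nout_append[OF dT(1), of E "last S"] nout_eq_0[of "set Q" E "last S"] f unfolding ts(2) by auto
  have i2: "inn (set S) (hd S) + card {hd S} \<le> card (set S)" by (rule nin_le_Diff(1)) (use irrefl hl in auto)
  have o2: "out (set S) (last S) + card {last S} \<le> card (set S)" by (rule nout_le_Diff(1)) (use irrefl hl in auto)
  have i3: "inn (set Q) (hd P) + card {hd P} \<le> card (set Q)" by (rule nin_le_Diff(1)) (use irrefl hl in auto)
  have o3: "out (set Q) (last P) + card {last P} \<le> card (set Q)" by (rule nout_le_Diff(1)) (use irrefl hl in auto)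
  note ineqs = d1 d2 c2 i1 o1 i2 o2 i3 o3 gc(3-5) inn_split[of "hd P"] out_split[of "last P"] card_split lC
    cS Q_facts(3)
  have one: "card {z} = 1" for z :: 'a by simp
  show t: "inn (set cs) (hd P) + out (set cs) (last P) = length ts + 1"
    using ineqs unfolding one by linarith
  show "E (last us) (hd P) \<longleftrightarrow> \<not> E (last P) (hd vs)" if "ts = us @ vs" "us \<noteq> []" "vs \<noteq> []" for us vs
    by (rule path_count_tight(4)[OF _ gc(2) _ that]) (use dT t gc(3,4) in \<open>auto simp: nin_def nout_def\<close>)
  show "E x (hd S)" if "x \<in> set S" "x \<noteq> hd S"
    by (rule nin_le_Diff(2)[of "set S" "{hd S}"]) (use ineqs irrefl hl that in \<open>auto\<close>)
  show "E (last S) x" if "x \<in> set S" "x \<noteq> last S"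
    by (rule nout_le_Diff(2)[of "set S" "{last S}"]) (use ineqs irrefl hl that in \<open>auto\<close>)
  show "E x (hd P)" if "x \<in> set Q" "x \<noteq> hd P"
    by (rule nin_le_Diff(2)[of "set Q" "{hd P}"]) (use ineqs irrefl hl that in \<open>auto\<close>)
  show "inn V (hd S) + out V (last P) + 1 = card V" "out V (last S) + inn V (hd P) + 1 = card V"
    using ineqs unfolding one by linarith+
qed

end

lemma complete_successively:
  assumes "distinct P" "\<And>x y. x \<in> set P \<Longrightarrow> y \<in> set P \<Longrightarrow> x \<noteq> y \<Longrightarrow> E x y"
  shows "successively E P"
  using assms by (auto simp: successively_conv_nth nth_eq_iff_index_eq)

lemma complete_path:
  assumes "finite X" "x \<in> X" "y \<in> X" "x \<noteq> y" "\<And>x y. x \<in> X \<Longrightarrow> y \<in> X \<Longrightarrow> x \<noteq> y \<Longrightarrow> E x y"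
  obtains P where "P \<noteq> []" "distinct P" "successively E P" "set P = X" "hd P = x" "last P = y"
proof -
  obtain zs where zs: "set zs = X - {x, y}" "distinct zs" using finite_distinct_list[of "X - {x, y}"] assms(1) by auto
  have "distinct (x # zs @ [y])" "set (x # zs @ [y]) = X" using zs assms(2-4) by auto
  then show ?thesis using that[of "x # zs @ [y]"] complete_successively[of "x # zs @ [y]" E] assms(5) by auto
qed

context ore begin

text \<open>Without a Hamilton cycle, the total degree of \<open>w\<close> is at most the length of \<open>xs\<close>. A base attains
this bound.\<close>

definition base :: "'a list \<Rightarrow> 'a \<Rightarrow> bool" where
  "base xs w \<longleftrightarrow> cyc E xs \<and> w \<in> V \<and> set xs = V - {w} \<and> inn V w + out V w + 1 = card V"

end

text \<open>\<open>T1 @ k # T2 @ S\<close> is the longest cycle, \<open>Q\<close> its complement and \<open>S\<close> a gap.\<close>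

locale ore_kite = ore +
  fixes T1 :: "'a list" and k :: 'a and T2 S Q :: "'a list"
  assumes kite_V: "set (T1 @ k # T2 @ S @ Q) = V" "distinct (T1 @ k # T2 @ S @ Q)"
    and kite_T: "successively E (T1 @ k # T2)"
    and kite_S: "cyc E S" "length S \<ge> 2"
    and kite_Q: "Q \<noteq> []" "\<And>x y. x \<in> set Q \<Longrightarrow> y \<in> set Q \<Longrightarrow> x \<noteq> y \<Longrightarrow> E x y"
    and kite_TS: "E (last (k # T2)) (hd S)" "E (last S) (hd (T1 @ [k]))"
    and into_Q: "\<And>y c. y \<in> set Q \<Longrightarrow> c \<notin> set Q \<Longrightarrow> E c y \<longleftrightarrow> c = k \<or> c \<in> set T2"
    and from_Q: "\<And>y c. y \<in> set Q \<Longrightarrow> c \<notin> set Q \<Longrightarrow> E y c \<longleftrightarrow> c = k \<or> c \<in> set T1"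

context ore_split begin

text \<open>The two neighbourhoods on the cycle are an initial and a final piece of
  \<open>T1 @ k # T2\<close> that overlap in \<open>k\<close> alone. Only the two ends of one path
  \<open>P\<close> are concerned; in a kite the same \<open>k\<close> serves all vertices of
  \<open>Q\<close>.\<close>

definition lens :: "'a list \<Rightarrow> 'a list \<Rightarrow> 'a \<Rightarrow> 'a list \<Rightarrow> 'a list \<Rightarrow> bool" where
  "lens P T1 k T2 S \<longleftrightarrow> cyc E P \<and> set P = set Q \<and> rot cs ((T1 @ k # T2) @ S) \<and> length S \<ge> 2
    \<and> (\<forall>c\<in>set cs. E c (hd P) \<longleftrightarrow> c = k \<or> c \<in> set T2)
    \<and> (\<forall>c\<in>set cs. E (last P) c \<longleftrightarrow> c = k \<or> c \<in> set T1)"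

text \<open>By the tight count, all gaps \<open>S\<close> have the same length. If the in-neighbours of \<open>hd P\<close> were not a
final segment of \<open>ts\<close>, then some single vertex would be a gap, although \<open>S\<close> has at least two vertices.\<close>

lemma lens_of_gap:
  assumes P: "cyc E P" "set P = set Q"
    and ts: "rot cs (ts @ S)" "ts \<noteq> []" "E (last ts) (hd P)" "E (last P) (hd ts)"
    and S: "\<forall>x\<in>set S. \<not> E x (hd P) \<and> \<not> E (last P) x" "length S \<ge> 2"
  obtains T1 k T2 where "lens P T1 k T2 S" "ts = T1 @ k # T2"
proof -
  have c: "cyc E (ts @ S)" "set (ts @ S) = set cs" "length (ts @ S) = length cs"
    using rot_cyc[OF ts(1) cycle] rot_set[OF ts(1)] rot_length[OF ts(1)] by auto
  note g = gap_tight[OF P c(1,2) ts(2-4) S(1)]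
  let ?A = "\<lambda>x. E x (hd P)" and ?B = "E (last P)"
  have ex: "\<exists>x\<in>set ts. ?A x" using ts by auto
  obtain T1 k T2 where s: "ts = T1 @ k # T2" "?A k" "\<forall>x\<in>set T1. \<not> ?A x"
    using split_list_first_prop[OF ex] by auto
  have d: "distinct (ts @ S)" using c by (simp add: cyc_def)
  have A2: "?A x" if "x \<in> set T2" for x
  proof (rule ccontr)
    assume "\<not> ?A x"
    then have ex: "\<exists>x\<in>set T2. \<not> ?A x" using that by auto
    obtain X y Y where s2: "T2 = X @ y # Y" "\<not> ?A y" "\<forall>x\<in>set X. ?A x"
      using split_list_first_prop[OF ex] by auto
    have Y: "Y \<noteq> []" using ts(3) s(1) s2 by auto
    have kX: "?A (last (k # X))" using s(2) s2(3) last_in_set[of X] by auto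
    have "\<not> ?B y" using g(4)[of "T1 @ k # X" "y # Y"] s(1) s2(1) kX by auto
    moreover have BY: "?B (hd Y)" using g(4)[of "T1 @ k # X @ [y]" Y] s(1) s2 Y by auto
    ultimately have S': "\<forall>x\<in>set [y]. \<not> ?A x \<and> \<not> ?B x" using s2 by auto
    have r: "rot cs ((Y @ S @ T1 @ k # X) @ [y])"
      using rot_append[of cs "T1 @ k # X @ [y]" "Y @ S"] ts(1) unfolding s(1) s2(1) by simp
    have e: "E (last (Y @ S @ T1 @ k # X)) (hd P)" "E (last P) (hd (Y @ S @ T1 @ k # X))"
      using kX BY Y by auto
    have "inn (set cs) (hd P) + out (set cs) (last P) = length (Y @ S @ T1 @ k # X) + 1"
      by (rule gap_tight(3)[OF P rot_cyc[OF r cycle] rot_set[OF r] _ e S']) simp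
    moreover have "length (Y @ S @ T1 @ k # X) + 1 = length ts + length S"
      unfolding s(1) s2(1) by simp
    ultimately show False using g(3) S(2) by linarith
  qed
  have B1: "?B x" if x: "x = k \<or> x \<in> set T1" for x
  proof -
    have "x \<in> set (T1 @ [k])" using x by auto
    then obtain us vs where uv: "T1 @ [k] = us @ x # vs" by (meson split_list)
    show ?thesis
    proof (cases "us = []")
      case True
      then show ?thesis using ts(4) uv s(1) by (cases T1) auto
    next
      case False
      have "set us \<subseteq> set T1" using uv by (cases vs rule: rev_cases) auto
      then have "\<not> ?A (last us)" using False s(3) last_in_set by blast
      moreover have "ts = us @ (x # vs @ T2)" using uv s(1) by (metis append_Cons append_assoc append_Nil)
      ultimately show ?thesis using g(4)[of us "x # vs @ T2"] False by auto
    qed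
  qed
  have B2: "\<not> ?B x" if x: "x \<in> set T2" for x
  proof -
    obtain us vs where uv: "T2 = us @ x # vs" using x by (meson split_list)
    have "?A (last (k # us))" using s(2) A2 uv last_in_set[of us] by auto
    then show ?thesis using g(4)[of "T1 @ k # us" "x # vs"] uv s(1) by auto
  qed
  have "E c (hd P) \<longleftrightarrow> c = k \<or> c \<in> set T2" "E (last P) c \<longleftrightarrow> c = k \<or> c \<in> set T1" if "c \<in> set cs" for c
  proof -
    have "c = k \<or> c \<in> set T1 \<or> c \<in> set T2 \<or> c \<in> set S" using that unfolding c(2)[symmetric] s(1) by auto
    moreover have "k \<notin> set S" "set T1 \<inter> set S = {}" "set T2 \<inter> set S = {}" "k \<notin> set T1" "k \<notin> set T2" "set T1 \<inter> set T2 = {}"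
      using d unfolding s(1) by auto
    ultimately show "E c (hd P) \<longleftrightarrow> c = k \<or> c \<in> set T2" "E (last P) c \<longleftrightarrow> c = k \<or> c \<in> set T1"
      using A2 B1 B2 s(2,3) S(1) by blast+
  qed
  then have "lens P T1 k T2 S"
    unfolding lens_def using P ts(1) S(2) unfolding s(1) by blast
  then show ?thesis using that s(1) by blast
qed

text \<open>A gap is at least as long as \<open>Q\<close>. If it had one vertex, then
  \<open>Q = [w]\<close>, and the tight count would give \<open>w\<close> total degree
  \<open>length cs\<close>, which makes \<open>cs\<close> and \<open>w\<close> a base.\<close>

lemma long_gap:
  assumes P: "cyc E P" "set P = set Q" and nb: "\<nexists>xs w. base xs w"
    and ts: "rot cs (ts @ S)" "ts \<noteq> []" "E (last ts) (hd P)" "E (last P) (hd ts)"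
    and S: "\<forall>x\<in>set S. \<not> E x (hd P) \<and> \<not> E (last P) x"
  shows "length S \<ge> 2"
proof (rule ccontr)
  have "P \<noteq> []" using P(1) by (simp add: cyc_def)
  then have hl: "hd P \<in> set Q" "last P \<in> set Q" unfolding P(2)[symmetric] by simp_all
  have c: "cyc E (ts @ S)" "set (ts @ S) = set cs" "length (ts @ S) = length cs"
    using rot_cyc[OF ts(1) cycle] rot_set[OF ts(1)] rot_length[OF ts(1)] by auto
  note g = gap_tight[OF P c(1,2) ts(2-4) S]
  assume n: "\<not> length S \<ge> 2"
  moreover have "length Q \<ge> 1" using Q_facts(2) by (simp add: Suc_le_eq)
  ultimately have l: "length Q = 1" "length S = 1" using g(1) by linarith+
  obtain w where w: "Q = [w]" using l(1) by (auto simp: length_Suc_conv)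
  then have "hd P = w" "last P = w" using hl by auto
  then have "inn (set cs) w + out (set cs) w = length cs" using g(3) c(3) l by simp
  moreover have "inn {w} w = 0" "out {w} w = 0" using irrefl by (auto intro!: nin_eq_0 nout_eq_0)
  ultimately have "inn V w + out V w + 1 = card V"
    using inn_split[of w] out_split[of w] card_split w by simp
  moreover have "set cs = V - {w}" "w \<in> V" using Q_V cycle_V w by auto
  ultimately have "base cs w" using cycle by (simp add: base_def)
  then show False using nb by blast
qed

lemma lens_exists:
  assumes P: "cyc E P" "set P = set Q" and nb: "\<nexists>xs w. base xs w"
  obtains T1 k T2 S where "lens P T1 k T2 S"
proof -
  have "P \<noteq> []" using P(1) by (simp add: cyc_def)
  then have hl: "hd P \<in> set Q" "last P \<in> set Q" unfolding P(2)[symmetric] by simp_all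
  obtain ts S where ts: "rot cs (ts @ S)" "ts \<noteq> []" "E (last ts) (hd P)" "E (last P) (hd ts)"
    "\<forall>x\<in>set S. \<not> E x (hd P) \<and> \<not> E (last P) x"
    using rot_gap[of cs "\<lambda>x. E x (hd P)" "E (last P)", OF arc_into[OF hl(1)] arc_from[OF hl(2)]] by blast
  show ?thesis using lens_of_gap[OF P ts long_gap[OF P nb ts]] that by metis
qed

lemma lens_gap:
  assumes "lens P T1 k T2 S"
  shows "cyc E P" "set P = set Q" "cyc E ((T1 @ k # T2) @ S)" "set ((T1 @ k # T2) @ S) = set cs"
    "T1 @ k # T2 \<noteq> []" "E (last (T1 @ k # T2)) (hd P)" "E (last P) (hd (T1 @ k # T2))"
    "\<forall>x\<in>set S. \<not> E x (hd P) \<and> \<not> E (last P) x"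
proof -
  have r: "rot cs ((T1 @ k # T2) @ S)" using assms by (simp add: lens_def)
  show c: "cyc E P" "set P = set Q" "cyc E ((T1 @ k # T2) @ S)" "set ((T1 @ k # T2) @ S) = set cs" "T1 @ k # T2 \<noteq> []"
    using assms rot_cyc[OF r cycle] rot_set[OF r] by (auto simp: lens_def)
  have l: "last (k # T2) = k \<or> last (k # T2) \<in> set T2" by auto
  have h: "hd (T1 @ [k]) = k \<or> hd (T1 @ [k]) \<in> set T1" by (cases T1) auto
  have "last (k # T2) \<in> set cs" "hd (T1 @ [k]) \<in> set cs" unfolding c(4)[symmetric] using l h by auto
  with l h show "E (last (T1 @ k # T2)) (hd P)" "E (last P) (hd (T1 @ k # T2))"
    using assms unfolding lens_def by (auto simp: hd_append split: if_splits)
  have "distinct ((T1 @ k # T2) @ S)" using c by (simp add: cyc_def)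
  then show "\<forall>x\<in>set S. \<not> E x (hd P) \<and> \<not> E (last P) x"
    using assms c(4) unfolding lens_def by auto
qed

text \<open>Any \<open>y\<close> can be made the first vertex of the path, and tightness joins all
  of \<open>Q\<close> to the first vertex.\<close>

lemma Q_complete:
  assumes "\<nexists>xs w. base xs w" "x \<in> set Q" "y \<in> set Q" "x \<noteq> y"
  shows "E x y"
proof -
  obtain ys where ys: "cyc E (y # ys)" "set (y # ys) = set Q" using cyc_starting_at[OF Q_cycle assms(3)] by blast
  obtain T1 k T2 S where l: "lens (y # ys) T1 k T2 S" by (rule lens_exists[OF ys assms(1)])
  then show ?thesis using gap_tight(7)[OF lens_gap[OF l] assms(2)] assms(4) by simp
qed

lemma Q_arrange:
  assumes "\<nexists>xs w. base xs w" "x \<in> set Q" "y \<in> set Q" "x \<noteq> y"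
  obtains P where "cyc E P" "set P = set Q" "hd P = x" "last P = y"
proof -
  obtain P where P: "P \<noteq> []" "distinct P" "successively E P" "set P = set Q" "hd P = x" "last P = y"
    using complete_path[of "set Q" x y E] Q_complete[OF assms(1)] assms(2-4) by auto
  moreover have "E y x" using Q_complete assms by auto
  ultimately show ?thesis using that[of P] by (simp add: cyc_def)
qed

text \<open>In the first case the vertex before \<open>c\<close> sends an arc to
  \<open>hd P\<close>, in the second the vertex after \<open>c\<close> receives one from
  \<open>last P\<close>. The forbidden arc would complete a detour through \<open>Q\<close>.\<close>

lemma lens_forbidden:
  assumes l: "lens P T1 k T2 S" and y: "y \<in> set Q"
  shows "c = hd S \<or> c \<in> set T2 \<Longrightarrow> \<not> E y c" and "c = last S \<or> c \<in> set T1 \<Longrightarrow> \<not> E c y"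
proof -
  note g = lens_gap[OF l]
  have P0: "hd P \<in> set Q" "last P \<in> set Q" using g(1) unfolding g(2)[symmetric] by (auto simp: cyc_def)
  have S0: "S \<noteq> []" using l by (auto simp: lens_def)
  have in_a: "E c (hd P)" if "c = k \<or> c \<in> set T2" for c using l that g(4) unfolding lens_def by auto
  have out_b: "E (last P) c" if "c = k \<or> c \<in> set T1" for c using l that g(4) unfolding lens_def by auto
  show "\<not> E y c" if c: "c = hd S \<or> c \<in> set T2"
  proof -
    have "c \<in> set (T2 @ [hd S])" using c by auto
    then obtain us vs where uv: "T2 @ [hd S] = us @ c # vs" by (meson split_list)
    have "set us \<subseteq> set T2" using uv by (cases vs rule: rev_cases) auto
    then have "us \<noteq> [] \<Longrightarrow> last us \<in> set T2" using last_in_set by blast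
    then have "E (last (T1 @ k # us)) (hd P)" using in_a[of "last (k # us)"] by (cases "us = []") auto
    moreover have s: "(T1 @ k # T2) @ S = (T1 @ k # us) @ (c # vs @ tl S)"
    proof -
      have "T2 @ S = (T2 @ [hd S]) @ tl S" using S0 by simp
      then show ?thesis unfolding uv by simp
    qed
    ultimately show ?thesis
      using no_bypass[OF g(3)[unfolded s] g(4)[unfolded s] _ P0(1) y] by auto
  qed
  show "\<not> E c y" if c: "c = last S \<or> c \<in> set T1"
  proof
    assume e: "E c y"
    have "c \<in> set (last S # T1)" using c by auto
    then obtain us vs where uv: "last S # T1 = us @ c # vs" by (meson split_list)
    have h: "hd (vs @ [k]) = k \<or> hd (vs @ [k]) \<in> set T1"
      using uv by (cases us; cases vs) auto
    have r: "rot cs ((S @ T1) @ (k # T2))" using l rot_append[of cs "T1 @ k # T2" S] rot_append[of cs "(T1 @ k # T2)" S] by (simp add: lens_def)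
    have s: "(S @ T1) @ (k # T2) = (butlast S @ us @ [c]) @ (vs @ k # T2)"
    proof -
      have "S @ T1 = butlast S @ last S # T1" using S0 by (metis append_butlast_last_id append_Cons append_assoc append_Nil)
      then show ?thesis unfolding uv by simp
    qed
    have "E (last P) (hd (vs @ [k]))" using out_b h by blast
    then have "E (last P) (hd ((vs @ k # T2) @ (butlast S @ us @ [c])))" by (cases vs) auto
    then show False
      using no_bypass[OF rot_cyc[OF r[unfolded s] cycle] rot_set[OF r[unfolded s]] _ y P0(2)] e by auto
  qed
qed

lemma card_in_lens:
  assumes "lens P T1 k T2 S"
  shows "inn (set cs) (hd P) = length T2 + 1" "out (set cs) (last P) = length T1 + 1"
proof -
  note g = lens_gap[OF assms]
  have d: "distinct (T1 @ k # T2)" using g(3) by (auto simp: cyc_def)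
  have "{c \<in> set cs. E c (hd P)} = set (k # T2)" "{c \<in> set cs. E (last P) c} = set (k # T1)"
    using assms g(4) unfolding lens_def by auto
  then show "inn (set cs) (hd P) = length T2 + 1" "out (set cs) (last P) = length T1 + 1"
    using d unfolding nin_def nout_def by (simp_all add: distinct_card)
qed

text \<open>No vertex of \<open>Q\<close> sends an arc to \<open>hd S\<close>, and the degree
  inequality of \<open>last P\<close> and \<open>hd S\<close> is an equality, so
  \<open>last P\<close> has the smallest out-degree in \<open>Q\<close>; dually, \<open>hd P\<close>
  has the smallest in-degree. Since \<open>Q\<close> is a clique, every ordered pair can serve as
  these ends.\<close>

lemma inn_const:
  assumes nb: "\<nexists>xs w. base xs w" and a: "a \<in> set Q" "a' \<in> set Q" "a \<noteq> a'"
  shows "inn (set cs) a = inn (set cs) a'" "out (set cs) a = out (set cs) a'"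
proof -
  have le: "out V y \<le> out V x \<and> inn V x \<le> inn V y" if xy: "x \<in> set Q" "y \<in> set Q" "x \<noteq> y" for x y
  proof -
    obtain P where P: "cyc E P" "set P = set Q" "hd P = x" "last P = y" by (rule Q_arrange[OF nb xy])
    obtain T1 k T2 S where l: "lens P T1 k T2 S" by (rule lens_exists[OF P(1,2) nb])
    note g = gap_tight[OF lens_gap[OF l]]
    have "S \<noteq> []" using l by (auto simp: lens_def)
    then have "hd S \<in> set cs" "last S \<in> set cs" unfolding lens_gap(4)[OF l, symmetric] by simp_all
    then have "hd S \<in> V" "last S \<in> V" "x \<in> V" "y \<in> V" "hd S \<noteq> x" "last S \<noteq> y" using cycle_V xy Q_V by auto
    then have "card V \<le> out V x + inn V (hd S) + 1" "card V \<le> out V (last S) + inn V y + 1"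
      using degrees g(2) xy by auto
    then show ?thesis using g(8,9) P by auto
  qed
  have "inn (set Q) x + 1 = length Q \<and> out (set Q) x + 1 = length Q" if "x \<in> set Q" for x
    using clique_degree[of "set Q" x E] that Q_complete[OF nb] irrefl Q_facts(3) by simp
  from this[OF a(1)] this[OF a(2)]
  show "inn (set cs) a = inn (set cs) a'" "out (set cs) a = out (set cs) a'"
    using le[OF a] le[OF a(2,1)] a(3) inn_split[of a] inn_split[of a'] out_split[of a] out_split[of a'] by auto
qed

text \<open>If \<open>k' = k\<close>, the pieces have equal lengths by \<open>inn_const\<close> and
  so coincide. The other possibility is that \<open>k'\<close> lies in \<open>S\<close>. Then
  \<open>S\<close> contains all of \<open>T1' @ k' # T2'\<close> while \<open>S'\<close> contains
  \<open>T1 @ k # T2\<close>, and the two pieces can be linked into a longer cycle.\<close>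

lemma lens_same:
  assumes nb: "\<nexists>xs w. base xs w" and l: "lens P T1 k T2 S" and l': "lens P' T1' k' T2' S'"
    and P: "hd P' = last P" "last P' = hd P" "hd P \<noteq> last P"
  shows "k' = k" "T1' = T1" "T2' = T2"
proof -
  note g = lens_gap[OF l] and g' = lens_gap[OF l']
  note t = gap_tight[OF g] and t' = gap_tight[OF g']
  have P0: "hd P \<in> set Q" "last P \<in> set Q" using g(1) unfolding g(2)[symmetric] by (auto simp: cyc_def)
  have ln: "length T2' = length T2" "length T1' = length T1"
    using card_in_lens[OF l] card_in_lens[OF l'] inn_const[OF nb P0 P(3)] P by auto
  have S0: "S \<noteq> []" "S' \<noteq> []" using l l' by (auto simp: lens_def)
  have r: "rot cs ((T1 @ k # T2) @ S)" "rot cs ((T1' @ k' # T2') @ S')" using l l' by (auto simp: lens_def)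
  have cs: "set cs = set (T1 @ k # T2 @ S)" using g(4) by simp
  have arcs: "c \<in> set cs \<Longrightarrow> E c (hd P) \<longleftrightarrow> c = k \<or> c \<in> set T2"
     "c \<in> set cs \<Longrightarrow> E (last P) c \<longleftrightarrow> c = k \<or> c \<in> set T1"
     "c \<in> set cs \<Longrightarrow> E c (last P) \<longleftrightarrow> c = k' \<or> c \<in> set T2'"
     "c \<in> set cs \<Longrightarrow> E (hd P) c \<longleftrightarrow> c = k' \<or> c \<in> set T1'" for c
    using l l' P unfolding lens_def by auto
  have k'C: "k' \<in> set cs" "set T1' \<subseteq> set cs" "set T2' \<subseteq> set cs" using g'(4) by auto
  have k'e: "E k' (last P)" "E (hd P) k'" using arcs k'C(1) by auto
  then have "k' \<notin> set T1" "k' \<notin> set T2" "k' \<noteq> hd S" "k' \<noteq> last S" using lens_forbidden[OF l] P0 by blast+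
  then consider "k' = k" | "k' \<in> set S" using k'C(1) cs by auto
  then have k: "k' = k \<and> T2' = T2 \<and> T1' = T1"
  proof cases
    case 1
    have "rot cs (k # T2 @ S @ T1)" "rot cs (k # T2' @ S' @ T1')"
      using rot_append[of cs T1 "k # T2 @ S"] rot_append[of cs T1' "k' # T2' @ S'"] r 1 by auto
    then have eq: "T2 @ S @ T1 = T2' @ S' @ T1'" using rot_unique C_facts(1) by metis
    have "length (T2 @ S) = length (T2' @ S')" using ln arg_cong[OF eq, of length] by simp
    moreover have "(T2 @ S) @ T1 = (T2' @ S') @ T1'" using eq by simp
    ultimately have "T1 = T1'" "T2 @ S = T2' @ S'" using append_eq_append_conv by blast+
    then show ?thesis using 1 ln append_eq_append_conv by metis
  next
    case 2
    then obtain U W where UW: "S = U @ k' # W" by (meson split_list)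
    have "rot cs (k' # W @ T1 @ k # T2 @ U)" "rot cs (k' # T2' @ S' @ T1')"
      using rot_append[of cs "T1 @ k # T2 @ U" "k' # W"] rot_append[of cs T1' "k' # T2' @ S'"] r unfolding UW by auto
    then have eq: "W @ T1 @ k # T2 @ U = T2' @ S' @ T1'" using rot_unique C_facts(1) by metis
    have W: "W \<noteq> []" "last W = last S" using \<open>k' \<noteq> last S\<close> UW by (cases "W = []"; auto)+
    have U: "U \<noteq> []" "hd U = hd S" using \<open>k' \<noteq> hd S\<close> UW by (cases "U = []"; auto)+
    have "last W \<notin> set T2'"
    proof
      assume "last W \<in> set T2'"
      then have "E (last W) (last P)" using arcs(3) k'C by auto
      then show False using lens_forbidden(2)[OF l P0(2), of "last S"] W by auto
    qed
    then obtain us where us: "W = T2' @ us" "us \<noteq> []"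
      using eq W(1) unfolding append_eq_append_conv2 by (metis append_Nil2 last_in_set in_set_conv_decomp append.assoc append_eq_append_conv2 last_appendR UnCI set_append)
    have "hd U \<notin> set T1'"
    proof
      assume "hd U \<in> set T1'"
      then have "E (hd P) (hd U)" using arcs(4) k'C by auto
      then show False using lens_forbidden(1)[OF l P0(1), of "hd S"] U by auto
    qed
    moreover have "(W @ T1 @ k # T2) @ U = (T2' @ S') @ T1'" using eq by simp
    ultimately obtain us' where us': "U = us' @ T1'" "us' \<noteq> []"
      using U(1) unfolding append_eq_append_conv2 by (metis append_Nil hd_append2 hd_in_set UnCI set_append)
    have S': "S' = us @ T1 @ k # T2 @ us'" using eq unfolding us us' by simp
    have S: "S = us' @ T1' @ k' # T2' @ us" using UW us us' by simp
    let ?ts = "T1 @ k # T2" and ?T' = "T1' @ k' # T2'"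
    have d: "distinct (?ts @ S)" "successively E (?ts @ S)" using g(3) by (auto simp: cyc_def)
    have sa: "successively E ?ts" "successively E (?T' @ us)" "successively E us'"
    proof -
      have "successively E (?ts @ us' @ (?T' @ us))" using d(2) unfolding S by simp
      then show "successively E ?ts" "successively E (?T' @ us)" "successively E us'"
        unfolding successively_append_iff by blast+
    qed
    have "set us \<inter> set us' = {}" using d(1) unfolding S by auto
    then have nd: "hd us' \<noteq> last us" by (metis disjoint_iff hd_in_set last_in_set us(2) us'(2))
    have "last S = last us" "hd us' \<in> set S" using us(2) us'(2) unfolding S by simp_all
    then have e1: "E (last us) (hd us')" using t(6)[of "hd us'"] nd by metis
    have hT: "hd ?ts \<in> set ?ts" by (rule hd_in_set) simp
    have "set ?ts \<inter> set us' = {}" using d(1) unfolding S by auto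
    then have nd2: "hd ?ts \<noteq> last us'" by (metis disjoint_iff hT last_in_set us'(2))
    have "last S' = last us'" "set ?ts \<subseteq> set S'" using us'(2) unfolding S' by auto
    then have e2: "E (last us') (hd ?ts)" using t'(6)[of "hd ?ts"] nd2 hT by (metis subsetD)
    have aC: "hd P \<notin> set cs" "hd P \<in> V" using P0 Q_V by auto
    have "hd ?T' = k' \<or> hd ?T' \<in> set T1'" by (cases T1') auto
    then have e3: "E (hd P) (hd ?T')" using arcs(4) k'C by auto
    \<comment> \<open>One link between the two pieces is \<open>hd P\<close>; the other uses the
      arcs that tightness gives inside \<open>S\<close> and inside \<open>S'\<close>. The cycle
      contains \<open>hd P\<close> in addition to all of \<open>cs\<close>.\<close>
    have "cyc E ((?ts @ [hd P]) @ ((?T' @ us) @ us'))" (is "cyc E ?zs")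
    proof (subst cyc_append, goal_cases)
      case 3
      have "distinct ?zs" using d(1) aC(1) unfolding cs S by auto
      moreover have "successively E (?ts @ [hd P])" by (subst successively_append_iff) (use sa g(6) in simp)
      moreover have "successively E ((?T' @ us) @ us')"
        by (subst successively_append_iff) (use sa e1 us(2) in simp)
      moreover have "E (last (?ts @ [hd P])) (hd ((?T' @ us) @ us'))" using e3 by (cases T1') auto
      moreover have "E (last ((?T' @ us) @ us')) (hd (?ts @ [hd P]))" using e2 us'(2) by (cases T1) auto
      ultimately show ?case by blast
    qed auto
    moreover have "set ?zs \<subseteq> V" using aC cycle_V unfolding cs S by auto
    ultimately have "length ?zs \<le> length cs" by (rule longest)
    moreover have "length cs = length (?ts @ S)" using rot_length[OF r(1)] by simp
    ultimately show ?thesis unfolding S by simp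
  qed
  then show "k' = k" "T1' = T1" "T2' = T2" by auto
qed

text \<open>For two vertices of \<open>Q\<close>, take paths through \<open>Q\<close> in both
  directions. By \<open>lens_same\<close> their lenses agree, and together they describe all arcs
  between these two vertices and the cycle. Hence all vertices of \<open>Q\<close> have the same
  neighbours on it.\<close>

lemma kite_of_lens:
  assumes nb: "\<nexists>xs w. base xs w" and l: "lens P T1 k T2 S" and "length Q = 1 \<or> hd P \<noteq> last P"
  shows "ore_kite V E T1 k T2 S Q"
proof -
  note g = lens_gap[OF l]
  note t = gap_tight[OF g]
  have P0: "hd P \<in> set Q" "last P \<in> set Q" using g(1) unfolding g(2)[symmetric] by (auto simp: cyc_def)
  have lS: "length S \<ge> 2" using l by (simp add: lens_def)
  have arcs: "E c y \<longleftrightarrow> c = k \<or> c \<in> set T2" "E y c \<longleftrightarrow> c = k \<or> c \<in> set T1" if y: "y \<in> set Q" and c: "c \<in> set cs" for y c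
  proof -
    have "(E c y \<longleftrightarrow> c = k \<or> c \<in> set T2) \<and> (E y c \<longleftrightarrow> c = k \<or> c \<in> set T1)"
    proof (cases "length Q = 1")
      case True
      then obtain w where "Q = [w]" by (auto simp: length_Suc_conv)
      then have "hd P = y" "last P = y" using P0 y by auto
      then show ?thesis using l c unfolding lens_def by auto
    next
      case False
      have same: "(E c x \<longleftrightarrow> E c z) \<and> (E x c \<longleftrightarrow> E z c)" if xz: "x \<in> set Q" "z \<in> set Q" "x \<noteq> z" for x z
      proof -
        obtain P1 where P1: "cyc E P1" "set P1 = set Q" "hd P1 = x" "last P1 = z" by (rule Q_arrange[OF nb xz])
        obtain P2 where P2: "cyc E P2" "set P2 = set Q" "hd P2 = z" "last P2 = x" using Q_arrange[OF nb xz(2,1)] xz(3) by metis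
        obtain A1 j A2 R where l1: "lens P1 A1 j A2 R" by (rule lens_exists[OF P1(1,2) nb])
        obtain A1' j' A2' R' where l2: "lens P2 A1' j' A2' R'" by (rule lens_exists[OF P2(1,2) nb])
        have "j' = j" "A1' = A1" "A2' = A2" using lens_same[OF nb l1 l2] P1 P2 xz(3) by auto
        then show ?thesis using l1 l2 P1 P2 c unfolding lens_def by auto
      qed
      have "E c (hd P) \<longleftrightarrow> c = k \<or> c \<in> set T2" "E (last P) c \<longleftrightarrow> c = k \<or> c \<in> set T1"
        using l c unfolding lens_def by auto
      then show ?thesis using same[OF P0(1) y] same[OF P0(2) y] by metis
    qed
    then show "E c y \<longleftrightarrow> c = k \<or> c \<in> set T2" "E y c \<longleftrightarrow> c = k \<or> c \<in> set T1" by auto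
  qed
  have d: "distinct ((T1 @ k # T2) @ S)" "successively E ((T1 @ k # T2) @ S)" using g(3) by (auto simp: cyc_def)
  have S0: "S \<noteq> []" "hd S \<noteq> last S" 
    using lS d(1) by (auto, cases S rule: rev_cases, auto simp: hd_append split: if_splits)
  have kC: "k \<in> set cs" "set T1 \<subseteq> set cs" "set T2 \<subseteq> set cs" using g(4) by auto
  show ?thesis
  proof unfold_locales
    show "set (T1 @ k # T2 @ S @ Q) = V" using g(4) Q_V cycle_V by auto
    have "set Q \<inter> set cs = {}" using Q_V by auto
    then show "distinct (T1 @ k # T2 @ S @ Q)" using d Q_facts(1) unfolding g(4)[symmetric] by auto
    show "successively E (T1 @ k # T2)" using d(2) unfolding successively_append_iff by blast
    have "successively E S" using d(2) unfolding successively_append_iff by blast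
    then show "cyc E S" using d(1) S0 t(6)[of "hd S"] unfolding cyc_def by auto
    show "length S \<ge> 2" "Q \<noteq> []" by (rule lS Q_facts)+
    show "E x y" if "x \<in> set Q" "y \<in> set Q" "x \<noteq> y" for x y by (rule Q_complete[OF nb that])
    have "E (last (T1 @ k # T2)) (hd S)" using g(3) S0 cyc_append[of "T1 @ k # T2" S E] by blast
    then show "E (last (k # T2)) (hd S)" by simp
    have "E (last S) (hd (T1 @ k # T2))" using g(3) S0 cyc_append[of "T1 @ k # T2" S E] by blast
    then show "E (last S) (hd (T1 @ [k]))" by (cases T1) auto
    show "E c y \<longleftrightarrow> c = k \<or> c \<in> set T2" if "y \<in> set Q" "c \<notin> set Q" for y c
      using arcs(1)[OF that(1), of c] that Q_V kC arc_V(1)[of c y] by auto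
    show "E y c \<longleftrightarrow> c = k \<or> c \<in> set T1" if "y \<in> set Q" "c \<notin> set Q" for y c
      using arcs(2)[OF that(1), of c] that Q_V kC arc_V(2)[of y c] by auto
  qed
qed

lemma kite_exists:
  assumes nb: "\<nexists>xs w. base xs w"
  shows "\<exists>T1 k T2 S. ore_kite V E T1 k T2 S Q"
proof -
  have "length Q = 1 \<or> hd Q \<noteq> last Q"
    using Q_facts by (cases Q rule: rev_cases) (auto simp: hd_append split: if_splits)
  moreover obtain T1 k T2 S where "lens Q T1 k T2 S" by (rule lens_exists[OF Q_cycle refl nb])
  ultimately show ?thesis using kite_of_lens[OF nb] by blast
qed

end

lemma (in ore) ex_kite_or_base:
  obtains (base) xs w where "base xs w" | (kite) T1 k T2 S Q where "ore_kite V E T1 k T2 S Q"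
proof (cases "\<exists>xs w. base xs w")
  case False
  define cy where "cy xs \<longleftrightarrow> cyc E xs \<and> set xs \<subseteq> V" for xs
  have "V \<noteq> {}" using card_V by auto
  then obtain v where "v \<in> V" by blast
  then have v: "cy [v]" by (auto simp: cy_def cyc_def)
  have "\<forall>xs. cy xs \<longrightarrow> length xs < card V + 1"
    unfolding cy_def cyc_def using finite_V by (metis card_mono distinct_card less_add_one order_le_less_trans)
  from ex_has_greatest_nat[OF v this]
  obtain cs where cs: "cy cs" "\<And>xs. cy xs \<Longrightarrow> length xs \<le> length cs" by blast
  then interpret ore_cycle V E cs by unfold_locales (auto simp: cy_def)
  obtain Q where Q: "cyc E Q" "set Q = V - set cs" by (rule rest_cycle)
  then interpret ore_split V E cs Q by unfold_locales
  show ?thesis using kite_exists False kite by blast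
qed (use that in blast)

context ore begin

text \<open>Without a Hamilton cycle, a cycle missing one vertex is automatically longest, so the
  results about gaps apply to it.\<close>

lemma near_hamiltonian_split:
  assumes "cyc E xs" "set xs = V - {u}" "u \<in> V"
  shows "ore_split V E xs [u]"
proof unfold_locales
  have c: "length xs + 1 = card V" using assms finite_V by (metis Suc_eq_plus1 card_Suc_Diff1 cyc_def distinct_card)
  show "length ys \<le> length xs" if ys: "cyc E ys" "set ys \<subseteq> V" for ys
  proof -
    have "set ys \<subset> V" using not_hamiltonian[of ys] ys by blast
    then have "card (set ys) < card V" using finite_V by (simp add: psubset_card_mono)
    then show ?thesis using ys(1) c by (simp add: cyc_def distinct_card)
  qed
  show "cyc E [u]" by (simp add: cyc_def)
qed (use assms in auto)

end

section \<open>Degrees and arcs of the segment of a kite\<close>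

context ore_kite begin

abbreviation "ts \<equiv> T1 @ k # T2"

lemma converse_kite: "ore_kite V (\<lambda>x y. E y x) (rev T2) k (rev T1) (rev S) (rev Q)"
proof -
  interpret c: ore V "\<lambda>x y. E y x" by (rule converse)
  show ?thesis
  proof unfold_locales
    show "set (rev T2 @ k # rev T1 @ rev S @ rev Q) = V" using kite_V(1) by auto
    show "distinct (rev T2 @ k # rev T1 @ rev S @ rev Q)" using kite_V(2) by auto
    have "successively E (rev (rev T2 @ k # rev T1))" using kite_T by simp
    then show "successively (\<lambda>x y. E y x) (rev T2 @ k # rev T1)" unfolding successively_rev .
    show "cyc (\<lambda>x y. E y x) (rev S)" using kite_S(1) by (simp add: cyc_rev)
    show "length (rev S) \<ge> 2" "rev Q \<noteq> []" using kite_S kite_Q by simp_all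
    have "S \<noteq> []" using kite_S by (simp add: cyc_def)
    moreover have "hd (rev T2 @ [k]) = last (k # T2)" "last (k # rev T1) = hd (T1 @ [k])"
      by (cases T2 rule: rev_cases; simp) (cases T1; simp)
    ultimately show "E (hd (rev S)) (last (k # rev T1))" "E (hd (rev T2 @ [k])) (last (rev S))"
      using kite_TS by (auto simp: hd_rev last_rev)
    show "E y x" if "x \<in> set (rev Q)" "y \<in> set (rev Q)" "x \<noteq> y" for x y using kite_Q(2) that by auto
    show "E y c \<longleftrightarrow> c = k \<or> c \<in> set (rev T1)" if "y \<in> set (rev Q)" "c \<notin> set (rev Q)" for y c
      using from_Q that by simp
    show "E c y \<longleftrightarrow> c = k \<or> c \<in> set (rev T2)" if "y \<in> set (rev Q)" "c \<notin> set (rev Q)" for y c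
      using into_Q that by simp
  qed
qed

lemma kite_facts:
  shows "distinct ts" "distinct S" "distinct Q" "S \<noteq> []" "set ts \<union> set S \<union> set Q = V"
    "set ts \<inter> set S = {}" "set ts \<inter> set Q = {}" "set S \<inter> set Q = {}" "successively E Q"
    "card V = length ts + length S + length Q"
proof -
  show "distinct ts" "distinct S" "distinct Q" "set ts \<inter> set S = {}" "set ts \<inter> set Q = {}" "set S \<inter> set Q = {}"
    using kite_V(2) by auto
  show "S \<noteq> []" using kite_S by (simp add: cyc_def)
  show "set ts \<union> set S \<union> set Q = V" using kite_V(1) by auto
  show "successively E Q" using complete_successively[of Q E] kite_V(2) kite_Q(2) by simp
  show "card V = length ts + length S + length Q"
    using distinct_card[OF kite_V(2)] unfolding kite_V(1) by simp
qed

lemma no_arcs_SQ: "x \<in> set S \<Longrightarrow> y \<in> set Q \<Longrightarrow> \<not> E x y" "x \<in> set S \<Longrightarrow> y \<in> set Q \<Longrightarrow> \<not> E y x"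
  using into_Q[of y x] from_Q[of y x] kite_V(2) by auto

lemma inn_parts: "inn V x = inn (set ts) x + inn (set S) x + inn (set Q) x"
  and out_parts: "out V x = out (set ts) x + out (set S) x + out (set Q) x"
proof -
  have d: "(set ts \<union> set S) \<inter> set Q = {}" "set ts \<inter> set S = {}" using kite_facts(6-8) by auto
  show "inn V x = inn (set ts) x + inn (set S) x + inn (set Q) x"
    "out V x = out (set ts) x + out (set S) x + out (set Q) x"
    using nin_Un[of "set ts \<union> set S" "set Q" E x] nin_Un[of "set ts" "set S" E x]
      nout_Un[of "set ts \<union> set S" "set Q" E x] nout_Un[of "set ts" "set S" E x] d
    unfolding kite_facts(5) by (simp_all del: set_append)
qed

lemma Q_degrees:
  assumes "y \<in> set Q"
  shows "inn V y + 1 = length T2 + 1 + length Q" "out V y + 1 = length T1 + 1 + length Q"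
proof -
  have "E c y \<longleftrightarrow> c = k \<or> c \<in> set T2" "E y c \<longleftrightarrow> c = k \<or> c \<in> set T1" if "c \<in> set ts" for c
    using into_Q[OF assms, of c] from_Q[OF assms, of c] kite_facts(7) that by blast+
  then have t: "{c \<in> set ts. E c y} = set (k # T2)" "{c \<in> set ts. E y c} = set (k # T1)" by auto
  have "distinct (k # T2)" "distinct (k # T1)" using kite_V(2) by auto
  then have 1: "inn (set ts) y = length T2 + 1" "out (set ts) y = length T1 + 1"
    unfolding nin_def nout_def t by (simp_all only: distinct_card list.size One_nat_def)
  have 2: "inn (set Q) y + 1 = length Q" "out (set Q) y + 1 = length Q"
    using clique_degree[of "set Q" y E] assms kite_Q(2) irrefl distinct_card[OF kite_facts(3)] by simp_all
  have "inn (set S) y = 0" "out (set S) y = 0"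
    using no_arcs_SQ assms by (auto intro!: nin_eq_0 nout_eq_0)
  then show "inn V y + 1 = length T2 + 1 + length Q" "out V y + 1 = length T1 + 1 + length Q"
    using inn_parts[of y] out_parts[of y] 1 2 by linarith+
qed

lemma ends_Q: "y \<in> set Q \<Longrightarrow> E (last ts) y" "y \<in> set Q \<Longrightarrow> E y (hd ts)"
proof -
  assume y: "y \<in> set Q"
  have n: "last ts \<notin> set Q" "hd ts \<notin> set Q"
    using kite_facts(7) last_in_set[of ts] hd_in_set[of ts] by blast+
  show "E (last ts) y" using into_Q[OF y n(1)] by (auto split: if_splits)
  have "hd ts = k \<or> hd ts \<in> set T1" by (cases T1) auto
  then show "E y (hd ts)" using from_Q[OF y n(2)] by simp
qed

text \<open>The inserted path may be any spanning path of \<open>S\<close>, while \<open>Q\<close>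
  closes up the rest from \<open>last ts\<close> to \<open>hd ts\<close>.\<close>

lemma S_unlinked:
  assumes X: "X \<noteq> []" "distinct X" "successively E X" "set X = set S"
  shows "unlinked (\<lambda>u. E u (hd X)) (E (last X)) ts"
proof (rule unlinkedI)
  fix us vs assume s: "ts = us @ vs" "us \<noteq> []" "vs \<noteq> []" and e: "E (last us) (hd X)" "E (last X) (hd vs)"
  have "last ts = last vs" "hd ts = hd us" unfolding s(1) using s by auto
  then have q: "E (last vs) (hd Q)" "E (last Q) (hd us)" using ends_Q kite_Q(1) by simp_all
  have "successively E us" "successively E vs" using kite_T unfolding s(1) by (auto simp: successively_append_iff)
  then have "cyc E ((us @ X) @ (vs @ Q))"
    using s X e q kite_facts(1-9) kite_Q(1) unfolding s(1)
    by (subst cyc_append) (auto simp: successively_append_iff)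
  moreover have "set ((us @ X) @ (vs @ Q)) = V" using kite_facts(5) X(4) unfolding s(1) by auto
  ultimately show False using not_hamiltonian by blast
qed

text \<open>A vertex of \<open>Q\<close> has known degrees and is not adjacent to \<open>S\<close>.
  The degree conditions therefore bound the arcs of both ends of \<open>S'\<close> from below
  separately, and \<open>S_unlinked\<close> bounds their sum from above by the same amount.\<close>

lemma S_rotation:
  assumes S': "cyc E S'" "set S' = set S"
  shows "inn (set ts) (hd S') = length T2 + 1" "out (set ts) (last S') = length T1 + 1"
    "x \<in> set S \<Longrightarrow> x \<noteq> hd S' \<Longrightarrow> E x (hd S')"
proof -
  have dS': "S' \<noteq> []" "distinct S'" "successively E S'" using S' by (auto simp: cyc_def)
  have hl: "hd S' \<in> set S" "last S' \<in> set S" using dS' unfolding S'(2)[symmetric] by simp_all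
  obtain q where q: "q \<in> set Q" using kite_Q(1) by (cases Q) auto
  have V: "hd S' \<in> V" "last S' \<in> V" "q \<in> V" "hd S' \<noteq> q" "last S' \<noteq> q"
    using hl q kite_facts(5,8) by auto
  have d: "card V \<le> out V q + inn V (hd S') + 1" "card V \<le> out V (last S') + inn V q + 1"
    using degrees[of q "hd S'"] degrees[of "last S'" q] V no_arcs_SQ hl q by auto
  have z: "inn (set Q) (hd S') = 0" "out (set Q) (last S') = 0"
    using no_arcs_SQ hl by (auto intro!: nin_eq_0 nout_eq_0)
  have cS: "card (set S) = length S" using kite_facts(2) by (simp add: distinct_card)
  have i: "inn (set S) (hd S') + card {hd S'} \<le> card (set S)" by (rule nin_le_Diff(1)) (use irrefl hl in auto)
  have o: "out (set S) (last S') + card {last S'} \<le> card (set S)" by (rule nout_le_Diff(1)) (use irrefl hl in auto)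
  have "inn (set ts) (hd S') + out (set ts) (last S') \<le> length ts + 1"
    using path_count[OF kite_facts(1) S_unlinked[OF dS' S'(2)]] by (simp add: nin_def nout_def)
  note ineqs = this i o z cS d Q_degrees[OF q] inn_parts[of "hd S'"] out_parts[of "last S'"] kite_facts(10)
  have l: "length ts = length T1 + length T2 + 1" by simp
  have one: "card {z} = 1" for z :: 'a by simp
  show "inn (set ts) (hd S') = length T2 + 1" "out (set ts) (last S') = length T1 + 1"
    using ineqs unfolding l one by linarith+
  have "inn (set S) (hd S') + card {hd S'} = card (set S)" using ineqs unfolding l one by linarith
  then show "E x (hd S')" if "x \<in> set S" "x \<noteq> hd S'"
    using nin_le_Diff(2)[of "set S" "{hd S'}" E "hd S'" x] irrefl hl that by auto
qed

lemma S_complete: "x \<in> set S \<Longrightarrow> y \<in> set S \<Longrightarrow> x \<noteq> y \<Longrightarrow> E x y"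
  and S_inn: "y \<in> set S \<Longrightarrow> inn (set ts) y = length T2 + 1"
  using S_rotation(1,3) cyc_starting_at[OF kite_S(1), of y] by (metis list.sel(1))+

lemma S_clique: "x \<in> set S \<Longrightarrow> inn (set S) x + 1 = length S \<and> out (set S) x + 1 = length S"
  using clique_degree[of "set S" x E] S_complete irrefl distinct_card[OF kite_facts(2)] by simp

lemma S_out: "x \<in> set S \<Longrightarrow> out (set ts) x = length T1 + 1"
  using S_rotation(2) cyc_ending_at[OF kite_S(1), of x] by (metis last_snoc)

lemma other_S: "\<exists>y\<in>set S. y \<noteq> x"
proof -
  have "\<not> set S \<subseteq> {x}"
  proof
    assume "set S \<subseteq> {x}"
    then have "card (set S) \<le> 1" using card_mono[of "{x}" "set S"] by simp
    then show False using kite_S(2) distinct_card[OF kite_facts(2)] by simp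
  qed
  then show ?thesis by blast
qed

lemma S_path:
  assumes "x \<in> set S" "y \<in> set S" "x \<noteq> y"
  obtains X where "X \<noteq> []" "distinct X" "successively E X" "set X = set S" "hd X = x" "last X = y"
  using complete_path[of "set S" x y E] S_complete assms by blast

lemma S_tight:
  assumes xy: "x \<in> set S" "y \<in> set S" "x \<noteq> y"
  shows "E (last ts) x" "E y (hd ts)" "ts = us @ vs \<Longrightarrow> us \<noteq> [] \<Longrightarrow> vs \<noteq> [] \<Longrightarrow> E (last us) x \<longleftrightarrow> \<not> E y (hd vs)"
proof -
  obtain X where X: "X \<noteq> []" "distinct X" "successively E X" "set X = set S" "hd X = x" "last X = y"
    by (rule S_path[OF xy])
  have u: "unlinked (\<lambda>u. E u x) (E y) ts" using S_unlinked[OF X(1-4)] X(5,6) by simp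
  have c: "length ts + 1 \<le> card {u \<in> set ts. E u x} + card {u \<in> set ts. E y u}"
    using S_inn[OF xy(1)] S_out[OF xy(2)] by (simp add: nin_def nout_def)
  show "E (last ts) x" "E y (hd ts)" using path_count_tight(2,3)[OF kite_facts(1) u c] by auto
  show "E (last us) x \<longleftrightarrow> \<not> E y (hd vs)" if "ts = us @ vs" "us \<noteq> []" "vs \<noteq> []"
    using path_count_tight(4)[OF kite_facts(1) u c that] by simp
qed

lemma ends_S: "x \<in> set S \<Longrightarrow> E (last ts) x" "x \<in> set S \<Longrightarrow> E x (hd ts)"
  using S_tight(1,2) other_S by metis+

text \<open>If \<open>y\<close> misses \<open>e\<close>, put \<open>e\<close> in front of a spanning
  path of \<open>S\<close> that ends in \<open>y\<close>. This path cannot be inserted into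
  \<open>ts\<close> without \<open>e\<close>, which \<open>Q\<close> still closes up. The count
  leaves \<open>e\<close> too few in-neighbours for the degree condition with a vertex of
  \<open>Q\<close>, none of which sends an arc to \<open>e\<close>.\<close>

lemma S_into_last:
  assumes "T2 \<noteq> []" "y \<in> set S"
  shows "E y (last T2)"
proof (rule ccontr)
  define e where "e = last T2"
  define T' where "T' = T1 @ k # butlast T2"
  assume "\<not> E y (last T2)"
  then have ye: "\<not> E y e" by (simp add: e_def)
  have ts: "ts = T' @ [e]" "T' \<noteq> []" "e \<in> set T2" "last ts = e" using assms(1) by (auto simp: T'_def e_def)
  obtain x where x: "x \<in> set S" "x \<noteq> y" using other_S[of y] by blast
  obtain X where X: "X \<noteq> []" "distinct X" "successively E X" "set X = set S" "hd X = x" "last X = y"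
    by (rule S_path[OF x(1) assms(2) x(2)])
  have ex: "E e x" using ends_S(1)[OF x(1)] ts(4) by simp
  have sT: "set T2 \<subseteq> set ts" by auto
  have eTQ: "e \<in> set ts" "e \<notin> set Q" "e \<notin> set S" "e \<noteq> k" "e \<notin> set T1" using ts(3) kite_V(2) by auto
  have dT': "distinct T'" "successively E T'" "e \<notin> set T'" "set T' \<subseteq> set ts"
    using kite_facts(1) kite_T unfolding ts(1) by (auto simp: successively_append_iff)
  have lT': "last T' = k \<or> last T' \<in> set T2" using in_set_butlastD[of _ T2] by (auto simp: T'_def)
  have hT': "hd T' = hd ts" using ts(1,2) by simp
  have u: "unlinked (\<lambda>u. E u e) (E y) T'"
  proof (rule unlinkedI)
    fix us vs assume s: "T' = us @ vs" "us \<noteq> []" "vs \<noteq> []" and a: "E (last us) e" "E y (hd vs)"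
    have "last T' = last vs" "hd T' = hd us" unfolding s(1) using s by auto
    moreover have "hd Q \<in> set Q" "last Q \<in> set Q" using kite_Q(1) by auto
    moreover have "last T' \<notin> set Q" using dT'(4) kite_facts(7) last_in_set[OF ts(2)] by blast
    ultimately have q: "E (last vs) (hd Q)" "E (last Q) (hd us)"
      using into_Q[of "hd Q" "last T'"] lT' ends_Q(2)[of "last Q"] hT' by auto
    have d: "distinct (us @ vs)" "successively E us" "successively E vs" "e \<notin> set (us @ vs)" "set (us @ vs) \<subseteq> set ts"
      using dT' unfolding s(1) by (auto simp: successively_append_iff)
    have "distinct ((us @ e # X) @ (vs @ Q))"
      using d(1,4,5) X(2,4) eTQ kite_facts(3,6-8) by auto
    then have "cyc E ((us @ e # X) @ (vs @ Q))" (is "cyc E ?zs")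
      using s X a q d ex kite_facts(9) kite_Q(1)
      by (subst cyc_append) (auto simp: path_simps)
    moreover have "set ?zs = V" using kite_facts(5) X(4) unfolding ts(1) s(1) by auto
    ultimately show False using not_hamiltonian by blast
  qed
  have "inn (set T') e + out (set T') y \<le> length T' + 1"
    using path_count[OF dT'(1) u] by (simp add: nin_def nout_def)
  moreover have "length T' + 1 = length T1 + length T2 + 1" using assms(1) by (simp add: T'_def)
  moreover have "out (set T') y = length T1 + 1"
    using S_out[OF assms(2)] nout_append[of T' "[e]" E y] kite_facts(1) nout_eq_0[of "{e}" E y] ye unfolding ts(1) by simp
  moreover have "inn (set T') e = inn (set ts) e"
    using nin_append[of T' "[e]" E e] kite_facts(1) nin_eq_0[of "{e}" E e] irrefl unfolding ts(1) by simp
  moreover have "inn (set Q) e = 0" using from_Q eTQ by (intro nin_eq_0) auto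
  moreover have "inn (set S) e + card {y} \<le> card (set S)" by (rule nin_le_Diff(1)) (use ye assms(2) in auto)
  then have "inn (set S) e + 1 \<le> length S" using kite_facts(2) by (simp add: distinct_card)
  moreover obtain q where q: "q \<in> set Q" using kite_Q(1) by (cases Q) auto
  have "q \<in> V" "e \<in> V" "q \<noteq> e" "\<not> E q e" using q eTQ kite_facts(5) from_Q[OF q] by auto
  then have "card V \<le> out V q + inn V e + 1" using degrees by blast
  moreover note Q_degrees(2)[OF q] inn_parts[of e] kite_facts(10)
  moreover have "length ts = length T1 + length T2 + 1" by simp
  ultimately show False by linarith
qed

lemma last_from_S: "T1 \<noteq> [] \<Longrightarrow> x \<in> set S \<Longrightarrow> E (hd T1) x"
  using ore_kite.S_into_last[OF converse_kite, of x] by (simp add: last_rev)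

lemma T2_imp_T1: "T2 \<noteq> [] \<Longrightarrow> T1 \<noteq> []"
proof
  assume n: "T2 \<noteq> []" "T1 = []"
  obtain y where y: "y \<in> set S" using kite_facts(4) by (cases S) auto
  \<comment> \<open>With \<open>T1\<close> empty, \<open>k\<close> is the first vertex of
    \<open>ts\<close>, so \<open>y\<close> would have two out-neighbours on \<open>ts\<close>
    instead of \<open>length T1 + 1 = 1\<close>.\<close>
  have "{k, last T2} \<subseteq> {u \<in> set ts. E y u}" using n S_into_last[OF n(1) y] ends_S(2)[OF y] by auto
  then have "card {k, last T2} \<le> out (set ts) y" unfolding nout_def by (intro card_mono) auto
  moreover have "k \<noteq> last T2" using n kite_V(2) last_in_set[OF n(1)] by auto
  ultimately show False using S_out[OF y] n(2) by simp
qed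

lemma T1_imp_T2: "T1 \<noteq> [] \<Longrightarrow> T2 \<noteq> []"
  using ore_kite.T2_imp_T1[OF converse_kite] by simp

end

section \<open>Kites\<close>

text \<open>The shapes describe the exceptional digraphs by an arc relation on the given vertex set,
  which keeps isomorphisms and arc types out of the combinatorial part.\<close>

definition shape_D1 :: "'a set \<Rightarrow> ('a \<Rightarrow> 'a \<Rightarrow> bool) \<Rightarrow> bool" where
  "shape_D1 V E \<longleftrightarrow> (\<exists>A B z. A \<union> B = V \<and> A \<inter> B = {z} \<and> card A \<ge> 2 \<and> card B \<ge> 2
    \<and> (\<forall>u v. E u v \<longleftrightarrow> u \<noteq> v \<and> (u \<in> A \<and> v \<in> A \<or> u \<in> B \<and> v \<in> B)))"

definition shape_D2 :: "'a set \<Rightarrow> ('a \<Rightarrow> 'a \<Rightarrow> bool) \<Rightarrow> bool" where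
  "shape_D2 V E \<longleftrightarrow> (\<exists>I N. I \<union> N = V \<and> I \<inter> N = {} \<and> N \<noteq> {} \<and> card I = card N + 1
    \<and> (\<forall>u\<in>I. \<forall>v. (E u v \<longleftrightarrow> v \<in> N) \<and> (E v u \<longleftrightarrow> v \<in> N)))"

definition shape_D3 :: "'a set \<Rightarrow> ('a \<Rightarrow> 'a \<Rightarrow> bool) \<Rightarrow> bool" where
  "shape_D3 V E \<longleftrightarrow> (\<exists>v0 v1 x y K. distinct [v0, v1, x, y] \<and> {v0, v1, x, y} \<inter> K = {} \<and> K \<noteq> {}
    \<and> V = {v0, v1, x, y} \<union> K
    \<and> (\<forall>u v. (u, v) \<notin> {(v0, v1), (v1, v0)} \<longrightarrow> (E u v \<longleftrightarrow>
        (u, v) \<in> {(v0, y), (y, v1), (v1, x), (x, v0), (x, y), (y, x)} \<or>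
        u \<in> K \<and> v \<in> K \<and> u \<noteq> v \<or> u \<in> {v0, v1} \<and> v \<in> K \<or> u \<in> K \<and> v \<in> {v0, v1})))"

context ore_kite begin

lemma T_neighbours_S:
  assumes "x \<in> set S" "finite X" "X \<subseteq> set ts"
  shows "(\<And>c. c \<in> X \<Longrightarrow> E c x) \<Longrightarrow> card X = length T2 + 1 \<Longrightarrow> c \<in> set ts \<Longrightarrow> E c x \<longleftrightarrow> c \<in> X"
    and "(\<And>c. c \<in> X \<Longrightarrow> E x c) \<Longrightarrow> card X = length T1 + 1 \<Longrightarrow> c \<in> set ts \<Longrightarrow> E x c \<longleftrightarrow> c \<in> X"
proof -
  assume h: "\<And>c. c \<in> X \<Longrightarrow> E c x" "card X = length T2 + 1" "c \<in> set ts"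
  have "X = {u \<in> set ts. E u x}"
    by (rule card_subset_eq) (use h assms S_inn[OF assms(1)] in \<open>auto simp: nin_def\<close>)
  then show "E c x \<longleftrightarrow> c \<in> X" using h(3) by blast
next
  assume h: "\<And>c. c \<in> X \<Longrightarrow> E x c" "card X = length T1 + 1" "c \<in> set ts"
  have "X = {u \<in> set ts. E x u}"
    by (rule card_subset_eq) (use h assms S_out[OF assms(1)] in \<open>auto simp: nout_def\<close>)
  then show "E x c \<longleftrightarrow> c \<in> X" using h(3) by blast
qed

text \<open>Here \<open>T1\<close> is empty too, and \<open>S\<close> and \<open>Q\<close> are
  cliques attached to \<open>k\<close> alone.\<close>

lemma trivial_kite_shape:
  assumes "T2 = []"
  shows "shape_D1 V E"
proof -
  have ts: "T1 = []" "T2 = []" using T1_imp_T2 assms by blast+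
  have k: "k \<notin> set S" "k \<notin> set Q" using kite_V(2) by auto
  have Sk: "E k x" "E x k" if "x \<in> set S" for x using ends_S[OF that] ts by auto
  have Qk: "E k y" "E y k" if "y \<in> set Q" for y using ends_Q[OF that] ts by auto
  have V: "V = insert k (set S \<union> set Q)" using kite_facts(5) ts by auto
  have "E u v \<longleftrightarrow> u \<noteq> v \<and> (u \<in> insert k (set S) \<and> v \<in> insert k (set S) \<or> u \<in> insert k (set Q) \<and> v \<in> insert k (set Q))" for u v
  proof (cases "u \<in> V \<and> v \<in> V")
    case True
    then have v: "v = k \<or> v \<in> set S \<or> v \<in> set Q" using V by blast
    from True consider "u = k" | "u \<in> set S" | "u \<in> set Q" using V by blast
    then show ?thesis
    proof cases
      case 1 then show ?thesis using v Sk(1)[of v] Qk(1)[of v] irrefl[of u] by auto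
    next
      case 2
      then have "u \<notin> set Q" "u \<noteq> k" using kite_facts(8) k by auto
      then show ?thesis
        using 2 v k Sk(2)[OF 2] S_complete[OF 2, of v] no_arcs_SQ(1)[OF 2, of v] irrefl[of u] kite_facts(8) by auto
    next
      case 3
      then have "u \<notin> set S" "u \<noteq> k" using kite_facts(8) k by auto
      then show ?thesis
        using 3 v k Qk(2)[OF 3] kite_Q(2)[OF 3, of v] no_arcs_SQ(2)[of v u] irrefl[of u] kite_facts(8) by auto
    qed
  next
    case False
    then show ?thesis using arc_V V by blast
  qed
  moreover have "insert k (set S) \<union> insert k (set Q) = V" "insert k (set S) \<inter> insert k (set Q) = {k}"
    using V kite_facts(8) by auto
  moreover have "card (insert k (set S)) \<ge> 2" using kite_S(2) distinct_card[OF kite_facts(2)] k by simp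
  moreover have "card (set Q) > 0" using kite_Q(1) by (simp add: card_gt_0_iff)
  then have "card (insert k (set Q)) \<ge> 2" using k by simp
  ultimately show ?thesis unfolding shape_D1_def by blast
qed

text \<open>The middle \<open>M\<close> still begins with an out-neighbour and ends with an
  in-neighbour of \<open>Q\<close>, so that \<open>Q\<close> can close up \<open>M\<close> while
  \<open>S\<close> links \<open>f\<close> to \<open>e\<close>.\<close>

lemma kite_middle:
  assumes "T2 \<noteq> []"
  obtains f M e where "ts = f # M @ [e]" "f \<in> set T1" "e \<in> set T2" "M \<noteq> []"
    "successively E M" "E f (hd M)" "E (last M) e"
    "last M = k \<or> last M \<in> set T2" "hd M = k \<or> hd M \<in> set T1"
    "f = hd T1" "e = last T2"
proof -
  have 1: "T1 \<noteq> []" using T2_imp_T1 assms by blast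
  define M where "M = tl T1 @ k # butlast T2"
  have ts: "ts = hd T1 # M @ [last T2]" using 1 assms by (simp add: M_def)
  have M: "M \<noteq> []" by (simp add: M_def)
  have s: "successively E M" "E (hd T1) (hd M)" "E (last M) (last T2)"
    using kite_T M unfolding ts by (auto simp: path_simps)
  have "last M = k \<or> last M \<in> set T2"
    using in_set_butlastD[of "last (butlast T2)" T2] by (auto simp: M_def)
  moreover have "hd M = k \<or> hd M \<in> set T1"
    using list.set_sel(2)[of T1 "hd (tl T1)"] 1 by (cases "tl T1") (auto simp: M_def)
  ultimately show ?thesis using that[OF ts _ _ M s] 1 assms by auto
qed

lemma kite_Q_single:
  assumes "T2 \<noteq> []"
  shows "length Q = 1"
proof (rule ccontr)
  assume n: "length Q \<noteq> 1"
  obtain f M e where M: "ts = f # M @ [e]" "f \<in> set T1" "e \<in> set T2" "M \<noteq> []"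
    "successively E M" "E f (hd M)" "E (last M) e"
    "last M = k \<or> last M \<in> set T2" "hd M = k \<or> hd M \<in> set T1" "f = hd T1" "e = last T2"
    by (rule kite_middle[OF assms])
  obtain a Q' where Q: "Q = a # Q'" "Q' \<noteq> []" using n kite_Q(1) by (cases Q) auto
  have nQ: "c \<notin> set Q" if "c \<in> set ts" for c using that kite_facts(7) by blast
  have ts: "hd M \<in> set ts" "last M \<in> set ts" "f \<in> set ts" "e \<in> set ts" using M(1,4) by auto
  have q: "a \<in> set Q" "hd Q' \<in> set Q" "last Q' \<in> set Q" using Q by auto
  have e: "E a (hd M)" "E (last M) (hd Q')" "E (last Q') f" "E e a"
    using from_Q[OF q(1) nQ[OF ts(1)]] into_Q[OF q(2) nQ[OF ts(2)]] from_Q[OF q(3) nQ[OF ts(3)]] into_Q[OF q(1) nQ[OF ts(4)]]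
      M by auto
  have "T1 \<noteq> []" using M(2) by auto
  then have S: "E f (hd S)" "E (last S) e" 
    using last_from_S[of "hd S"] S_into_last[OF assms, of "last S"] M(10,11) kite_facts(4) by auto
  have d: "distinct (f # M @ [e])" using kite_facts(1) unfolding M(1) .
  have "set ts = insert f (insert e (set M))" unfolding M(1) by auto
  then have "f \<notin> set S" "e \<notin> set S" "f \<notin> set Q" "e \<notin> set Q" "set M \<inter> set S = {}" "set M \<inter> set Q = {}"
    using kite_facts(6,7) by auto
  then have "distinct ((a # M @ Q') @ (f # S @ [e]))"
    using d kite_facts(2,3,8) unfolding Q(1) by auto
  moreover have "successively E Q'" "successively E S" using kite_facts(9) kite_S(1) Q by (auto simp: cyc_def successively_Cons)
  \<comment> \<open>With two vertices, \<open>Q\<close> can be used twice: \<open>a\<close> leads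
    from \<open>e\<close> into \<open>M\<close> and the others from \<open>M\<close> back to
    \<open>f\<close>.\<close>
  ultimately have "cyc E ((a # M @ Q') @ (f # S @ [e]))" (is "cyc E ?zs")
    using e S M(4,5) Q(2) kite_facts(4)
    by (subst cyc_append) (auto simp: path_simps)
  moreover have "set ?zs = set ts \<union> set S \<union> set Q" unfolding M(1) Q(1) by auto
  ultimately show False using not_hamiltonian kite_facts(5) by metis
qed

text \<open>The roles are \<open>v0 = f\<close>, \<open>v1 = e\<close>, \<open>x = w\<close>,
  \<open>y = k\<close> and \<open>K = set S\<close>. An arc from \<open>k\<close> to
  \<open>f\<close> or from \<open>e\<close> to \<open>k\<close> would close a Hamilton
  cycle.\<close>

lemma small_kite_shape:
  assumes ts: "T1 = [f]" "T2 = [e]" and Q: "Q = [w]"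
  shows "shape_D3 V E"
proof -
  have V: "V = {f, e, w, k} \<union> set S" using kite_facts(5) ts Q by auto
  have d: "distinct [f, e, w, k]" "{f, e, w, k} \<inter> set S = {}" using kite_V(2) ts Q by auto
  have w: "c \<noteq> w \<Longrightarrow> E c w \<longleftrightarrow> c = k \<or> c = e" "c \<noteq> w \<Longrightarrow> E w c \<longleftrightarrow> c = k \<or> c = f" for c
    using into_Q[of w c] from_Q[of w c] ts Q by auto
  have fke: "E f k" "E k e" using kite_T ts by auto
  have S: "E e x" "E x f" "E f x" "E x e" if "x \<in> set S" for x
    using ends_S[OF that] last_from_S[OF _ that] S_into_last[OF _ that] ts by auto
  have kS: "\<not> E k x" "\<not> E x k" if x: "x \<in> set S" for x
  proof -
    have "E k x \<longleftrightarrow> k \<in> {e, f}" by (rule T_neighbours_S(1)[OF x]) (use S[OF x] ts d in auto)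
    moreover have "E x k \<longleftrightarrow> k \<in> {e, f}" by (rule T_neighbours_S(2)[OF x]) (use S[OF x] ts d in auto)
    ultimately show "\<not> E k x" "\<not> E x k" using d by auto
  qed
  have s: "successively E S" "distinct S" "S \<noteq> []" using kite_S by (auto simp: cyc_def)
  have hl: "hd S \<in> set S" "last S \<in> set S" using s(3) by auto
  have kf: "\<not> E k f"
  proof
    assume "E k f"
    then have "cyc E ([k, f] @ S @ [e, w])"
      using S hl s d w[of e] w(2)[of k] by (subst cyc_append) (auto simp: successively_append_iff)
    then show False using not_hamiltonian[of "[k, f] @ S @ [e, w]"] V by auto
  qed
  have ek: "\<not> E e k"
  proof
    assume "E e k"
    then have "cyc E ([e, k, w, f] @ S)"
      using S hl s d w(1)[of k] w(2)[of f] by (subst cyc_append) auto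
    then show False using not_hamiltonian[of "[e, k, w, f] @ S"] V by auto
  qed
  have "E u v \<longleftrightarrow>
        (u, v) \<in> {(f, k), (k, e), (e, w), (w, f), (w, k), (k, w)} \<or>
        u \<in> set S \<and> v \<in> set S \<and> u \<noteq> v \<or> u \<in> {f, e} \<and> v \<in> set S \<or> u \<in> set S \<and> v \<in> {f, e}"
    if uv: "(u, v) \<notin> {(f, e), (e, f)}" for u v
  proof (cases "u \<in> V \<and> v \<in> V")
    case False
    then show ?thesis using arc_V V by blast
  next
    case True
    then consider "u \<in> set S" | "u = f" | "u = e" | "u = w" | "u = k" using V by blast
    then show ?thesis
    proof cases
      case 1
      then have "u \<noteq> f" "u \<noteq> e" "u \<noteq> w" "u \<noteq> k" using d by auto
      then show ?thesis using 1 True V S(2,4)[OF 1] kS[OF 1] w(1)[of u] S_complete irrefl by blast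
    next
      case 2
      then have "v \<noteq> e" using uv by auto
      then show ?thesis using 2 True V S(3) d w(1)[of f] fke irrefl by auto
    next
      case 3
      then have "v \<noteq> f" using uv by auto
      then show ?thesis using 3 True V S(1) d w(1)[of e] ek irrefl by auto
    next
      case 4
      then show ?thesis using True V w(2)[of v] d irrefl by auto
    next
      case 5
      then show ?thesis using True V w(1)[of k] d irrefl kS kf fke by auto
    qed
  qed
  then show ?thesis unfolding shape_D3_def using V d s(3)
    by (intro exI[of _ f] exI[of _ e] exI[of _ w] exI[of _ k] exI[of _ "set S"]) auto
qed

text \<open>Two vertices \<open>x\<close>, \<open>y\<close> of \<open>S\<close> single out a vertex \<open>u\<close> of \<open>T1 @ k # T2\<close> such that some cycle
misses only \<open>u\<close>. This cycle yields a second kite with the vertices of \<open>S\<close> as its segment, and comparing the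
two kites gives a contradiction or a Hamilton cycle.\<close>

lemma large_kite:
  assumes nb: "\<nexists>xs w. base xs w" and T2: "T2 \<noteq> []" and l: "length ts \<ge> 4"
  shows False
proof -
  obtain w where Q: "Q = [w]" using kite_Q_single[OF T2] by (auto simp: length_Suc_conv)
  obtain f M e where M: "ts = f # M @ [e]" "f \<in> set T1" "e \<in> set T2" "M \<noteq> []"
    "successively E M" "E f (hd M)" "E (last M) e"
    "last M = k \<or> last M \<in> set T2" "hd M = k \<or> hd M \<in> set T1" "f = hd T1" "e = last T2"
    by (rule kite_middle[OF T2])
  have T1: "T1 \<noteq> []" using T2_imp_T1 T2 by blast
  have nT: "w \<notin> set ts" "w \<notin> set S" "set ts \<inter> set S = {}" using kite_facts(6-8) Q by auto
  have wV: "E c w \<longleftrightarrow> c = k \<or> c \<in> set T2" "E w c \<longleftrightarrow> c = k \<or> c \<in> set T1" if "c \<noteq> w" for c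
    using into_Q[of w c] from_Q[of w c] Q that by auto
  have fS: "E f x" and Se: "E x e" if "x \<in> set S" for x
    using last_from_S[OF T1 that] S_into_last[OF T2 that] M(10,11) by auto
  have wf: "E w f" "E e w" using wV M nT(1) by auto
  obtain x where x: "x \<in> set S" using kite_facts(4) by (cases S) auto
  obtain y where y: "y \<in> set S" "y \<noteq> x" using other_S by blast
  have "\<exists>v\<in>set (M @ [e]). E y v" using Se y by auto
  \<comment> \<open>\<open>v\<close> is the first out-neighbour of \<open>y\<close> after
    \<open>f\<close>, and \<open>u\<close> will be the vertex before \<open>v\<close>. Tightness at
    the cuts around \<open>u\<close> gives an arc to \<open>x\<close> from the vertex before
    \<open>u\<close> and none from \<open>u\<close>, so \<open>S\<close>, run through from
    \<open>x\<close> to \<open>y\<close>, bypasses \<open>u\<close>.\<close>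
  then obtain W v Z where W: "M @ [e] = W @ v # Z" "E y v" "\<forall>z\<in>set W. \<not> E y z"
    using split_list_first_prop[of "M @ [e]" "E y"] by auto
  have tight: "E (last us) x \<longleftrightarrow> \<not> E y (hd vs)" if "ts = us @ vs" "us \<noteq> []" "vs \<noteq> []" for us vs
    by (rule S_tight(3)[OF x y(1) y(2)[symmetric] that])
  have "\<not> E y (hd M)" using tight[of "[f]" "M @ [e]"] M(1,4) fS[OF x] by simp
  then have "W \<noteq> []" using W(1,2) M(4) by (metis append_Nil hd_append2 list.sel(1))
  then obtain W' u where Wu: "W = W' @ [u]" by (metis rev_exhaust)
  have ts: "ts = (f # W') @ u # v # Z" using M(1) W(1) Wu by simp
  have yu: "\<not> E y u" using W(3) Wu by simp
  have ux: "\<not> E u x" using tight[of "(f # W') @ [u]" "v # Z"] ts W(2) by simp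
  have u'x: "E (last (f # W')) x" using tight[of "f # W'" "u # v # Z"] ts yu by simp
  have eZ: "last (v # Z) = e" using W(1) by (metis last_appendR last_snoc list.distinct(1))
  obtain X where X: "X \<noteq> []" "distinct X" "successively E X" "set X = set S" "hd X = x" "last X = y"
    by (rule S_path[OF x y(1) y(2)[symmetric]])
  \<comment> \<open>The vertex \<open>w\<close> links \<open>e\<close> to \<open>f\<close>, which
    gives a cycle missing only \<open>u\<close>: the vertices \<open>u\<close> and \<open>w\<close>
    exchange roles.\<close>
  let ?Y = "(v # Z) @ [w] @ (f # W')"
  have dT: "distinct ((f # W') @ u # v # Z)" "successively E ((f # W') @ u # v # Z)"
    using kite_facts(1) kite_T unfolding ts by blast+
  have sub: "successively E (v # Z)" "successively E (f # W')" "E (last (f # W')) u" "E u v"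
  proof -
    have "successively E (f # W') \<and> successively E (u # v # Z) \<and> E (last (f # W')) (hd (u # v # Z))"
      using dT(2) unfolding successively_append_iff by blast
    then show "successively E (v # Z)" "successively E (f # W')" "E (last (f # W')) u" "E u v" by simp_all
  qed
  have disj: "set ((f # W') @ u # v # Z) \<inter> set S = {}" "w \<notin> set ((f # W') @ u # v # Z)"
    using nT unfolding ts by blast+
  have dY: "distinct ?Y" using dT(1) disj by auto
  have "successively E ([w] @ (f # W'))" using sub(2) wf(1) by simp
  moreover have "E (last (v # Z)) w" using wf(2) eZ by simp
  ultimately have sY: "successively E ?Y" unfolding successively_append_iff[of E "v # Z"] using sub(1) by simp
  have cY: "cyc E (?Y @ X)"
    using dY sY X disj nT(2) u'x W(2) by (subst cyc_append) auto
  have u: "u \<in> V" "u \<notin> set (?Y @ X)" using arc_V(1)[OF sub(4)] dT(1) disj X(4) by auto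
  have setY: "set (?Y @ X) = V - {u}"
  proof -
    have "V = set ((f # W') @ u # v # Z) \<union> set S \<union> {w}" using kite_facts(5) Q unfolding ts by simp
    then show ?thesis using u(2) X(4) by auto
  qed
  interpret z: ore_split V E "?Y @ X" "[u]" by (rule near_hamiltonian_split[OF cY setY u(1)])
  have ex: "\<exists>c\<in>set (X @ [v]). E u c" using sub(4) by auto
  obtain X1 S' X2 where g: "X @ [v] = X1 @ S' @ X2" "X2 \<noteq> []" "E u (hd X2)" "X1 \<noteq> [] \<longrightarrow> E (last X1) u"
    "\<forall>c\<in>set S'. \<not> E c u \<and> \<not> E u c"
    using exists_gap[of "X @ [v]" "E u" "\<lambda>c. E c u", OF ex] by blast
  obtain X2' where X2: "X2 = X2' @ [v]" using g(1,2) by (metis append_assoc append_butlast_last_id last_appendR last_snoc)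
  have XX: "X = X1 @ S' @ X2'" using g(1) unfolding X2 by simp
  have rt: "rot (?Y @ X) ((X2' @ ?Y @ X1) @ S')"
  proof -
    have "rot (?Y @ X) ((?Y @ X1 @ S') @ X2')" unfolding rot_def XX by (rule exI[of _ 0]) simp
    then show ?thesis using rot_append[of "?Y @ X" "?Y @ X1 @ S'" X2'] by simp
  qed
  have e1: "E (last (X2' @ ?Y @ X1)) (hd [u])"
    using g(4) sub(3) by (cases "X1 = []") auto
  have e2: "E (last [u]) (hd (X2' @ ?Y @ X1))" using g(3) unfolding X2 by (cases X2') auto
  have P: "cyc E [u]" "set [u] = set [u]" by (simp_all add: cyc_def)
  have gS: "\<forall>c\<in>set S'. \<not> E c (hd [u]) \<and> \<not> E (last [u]) c" using g(5) by simp
  have "length S' \<ge> 2" by (rule z.long_gap[OF P nb rt _ e1 e2 gS]) simp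
  then obtain T1' k' T2' where lens: "z.lens [u] T1' k' T2' S'" "X2' @ ?Y @ X1 = T1' @ k' # T2'"
    using z.lens_of_gap[OF P rt _ e1 e2 gS] by (metis append_is_Nil_conv list.distinct(1))
  interpret z: ore_kite V E T1' k' T2' S' "[u]"
    by (rule z.kite_of_lens[OF nb lens(1)]) simp
  have lX: "length X = length S" using X(2,4) kite_facts(2) by (metis distinct_card)
  obtain s where s: "s \<in> set S'" using z.kite_facts(4) by (cases S') auto
  then have sS: "s \<in> set S" using XX X(4) by auto
  have clq: "inn (set S) s + 1 = length S" "out (set S) s + 1 = length S"
    "inn (set S') s + 1 = length S'" "out (set S') s + 1 = length S'"
    using S_clique[OF sS] z.S_clique[OF s] by blast+
  have z0: "inn (set Q) s = 0" "out (set Q) s = 0" "inn (set [u]) s = 0" "out (set [u]) s = 0"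
    using no_arcs_SQ[OF sS] z.no_arcs_SQ[OF s] by (auto intro!: nin_eq_0 nout_eq_0)
  have lens_eq: "length ts = length T1 + length T2 + 1" "length (T1' @ k' # T2') = length T1' + length T2' + 1"
    "length Q = 1" "length [u] = 1" using Q by simp_all
  \<comment> \<open>A vertex common to both segments has the same degrees in either kite, which
    forces equal lengths; so the new segment is all of \<open>S\<close>.\<close>
  have eqs: "length S' = length S" "length T1' = length T1" "length T2' = length T2"
    using clq z0 S_inn[OF sS] S_out[OF sS] z.S_inn[OF s] z.S_out[OF s] inn_parts[of s] out_parts[of s]
      z.inn_parts[of s] z.out_parts[of s] kite_facts(10) z.kite_facts(10) lens_eq by linarith+
  then have "length X1 + length X2' = 0" using lX unfolding XX by simp
  then have X12: "X1 = []" "X2' = []" by auto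
  have S'X: "set S' = set S" using XX X12 X(4) by simp
  have T': "T1' @ k' # T2' = ?Y" using lens(2) X12 by simp
  \<comment> \<open>The new segment sends arcs to the end of \<open>T2'\<close>, which is the vertex
    before \<open>u\<close>. As \<open>v\<close> is the first out-neighbour of \<open>y\<close>
    after \<open>f\<close>, this vertex can only be \<open>f\<close>.\<close>
  have "E y (last (f # W'))"
    using z.S_into_last[of y] T2 eqs(3) S'X y T' by (metis last.simps last_appendR length_0_conv list.distinct(1) append_is_Nil_conv)
  then have W': "W' = []" using W(3) Wu by (cases "W' = []") auto
  have Me: "M @ [e] = u # v # Z" using W(1) Wu W' by simp
  have "length M \<ge> 2" using l unfolding M(1) by simp
  then have Z: "Z \<noteq> []" using Me by (cases Z; cases M) auto
  have hM: "hd M = u" using Me M(4) by (cases M) auto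
  have Y: "T1' @ k' # T2' = butlast (v # Z) @ [e, w, f]"
    using T' W' eZ by (metis append_butlast_last_id append_Cons append_Nil append_assoc list.distinct(1))
  have "T2' \<noteq> []" using T2 eqs(3) by auto
  show False
  proof (cases "length T2 = 1")
    case True
    then obtain a where a: "T2' = [a]" using eqs(3) by (metis length_0_conv length_Suc_conv One_nat_def)
    have "T1' @ [k', a] = (butlast (v # Z) @ [e]) @ [w, f]" using Y a by simp
    \<comment> \<open>Hence \<open>u\<close> sends an arc to \<open>w\<close>, which leaves only
      \<open>u = k\<close>. But \<open>k\<close> comes directly before \<open>e\<close>, whereas
      \<open>v\<close> lies between \<open>u\<close> and \<open>e\<close>.\<close>
    then have "k' = w" by simp
    then have "E u w" using z.from_Q[of u w] T' dT(1) disj(2) u by auto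
    moreover have "u \<noteq> w" using disj by auto
    ultimately have uk: "u = k \<or> u \<in> set T2" using wV by blast
    obtain b where "T2 = [b]" using True by (metis length_0_conv length_Suc_conv One_nat_def)
    then have T2e: "T2 = [e]" using M(3) by auto
    then have "u = k" using uk dT(1) eZ Z by auto
    have "T1 @ [k, e] = f # (u # butlast (v # Z)) @ [e]"
      using M(1) Me T2e eZ by (metis append_butlast_last_id append_Cons append_Nil list.distinct(1))
    then have "T1 @ [k] = f # u # butlast (v # Z)" by simp
    then have "k = last (u # butlast (v # Z))" by (metis last.simps last_snoc list.distinct(1))
    moreover have "butlast (v # Z) \<noteq> []" using Z by simp
    ultimately have "k \<in> set (butlast (v # Z))" by (metis last.simps last_in_set)
    then show False using \<open>u = k\<close> dT(1) in_set_butlastD[of k "v # Z"] by auto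
  next
    case False
    then have "length T2' \<ge> 2" using eqs(3) T2 by (cases T2; cases "tl T2") auto
    then obtain R a b where R: "T2' = R @ [a, b]"
    proof -
      obtain L b where 1: "T2' = L @ [b]" using \<open>T2' \<noteq> []\<close> by (metis rev_exhaust)
      then have "L \<noteq> []" using \<open>length T2' \<ge> 2\<close> by auto
      then obtain R a where "L = R @ [a]" by (metis rev_exhaust)
      then show ?thesis using that[of R a b] 1 by simp
    qed
    have "(T1' @ k' # R) @ [a, b] = (butlast (v # Z) @ [e]) @ [w, f]" using Y R by simp
    then have "T1' @ k' # R = butlast (v # Z) @ [e]" by simp
    then have "last (k' # R) = e" by (metis last_appendR last_snoc list.distinct(1))
    then have "e = k' \<or> e \<in> set T2'" using R by (auto split: if_splits)
    moreover have "e \<in> set (v # Z)" using eZ last_in_set[of "v # Z"] by simp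
    then have "e \<noteq> u" using dT(1) by auto
    \<comment> \<open>The new list ends in \<open>e\<close>, \<open>w\<close>, \<open>f\<close>. As
      \<open>T2'\<close> has at least two vertices, \<open>e\<close> is \<open>k'\<close> or belongs
      to \<open>T2'\<close> and so sends an arc to \<open>u\<close>, the first vertex of
      \<open>M\<close>. This closes a cycle through \<open>f\<close>, \<open>S\<close>,
      \<open>e\<close>, \<open>M\<close> and \<open>w\<close>.\<close>
    ultimately have eu: "E e u" using z.into_Q[of u e] by auto
    have "last M \<in> set ts" using M(4) unfolding M(1) by simp
    then have "last M \<noteq> w" using nT(1) by blast
    then have lM: "E (last M) w" using wV(1)[of "last M"] M(8) by blast
    have "distinct (f # M @ [e])" using kite_facts(1) unfolding M(1) .
    moreover have "set (f # M @ [e]) \<inter> set S = {}" "w \<notin> set (f # M @ [e])" using nT unfolding M(1) by blast+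
    ultimately have "distinct ((f # S) @ (e # M @ [w]))" using nT(2) kite_facts(2) by auto
    moreover have "E f (hd S)" "E (last S) e" "successively E S" using fS Se kite_facts(4) kite_S(1) by (auto simp: cyc_def)
    ultimately have "cyc E ((f # S) @ (e # M @ [w]))" (is "cyc E ?zs")
      using M(4,5) hM eu lM wf(1) kite_facts(4)
      by (subst cyc_append) (auto simp: path_simps)
    moreover have "set ?zs = set ts \<union> set S \<union> set Q" unfolding M(1) Q by auto
    ultimately show False using not_hamiltonian kite_facts(5) by metis
  qed
qed

theorem kite_shape:
  assumes "\<nexists>xs w. base xs w"
  shows "shape_D1 V E \<or> shape_D3 V E"
proof (cases "T2 = []")
  case False
  then have "length ts < 4" using large_kite[OF assms] by force
  moreover have "T1 \<noteq> []" using T2_imp_T1 False by blast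
  ultimately have "length T1 = 1" "length T2 = 1" using False by (cases T1; cases T2; auto)+
  then show ?thesis using small_kite_shape kite_Q_single[OF False] by (auto simp: length_Suc_conv)
qed (simp add: trivial_kite_shape)

end

context ore begin

section \<open>Holes of a base\<close>

definition hole :: "'a \<Rightarrow> 'a \<Rightarrow> bool" where
  "hole w h \<longleftrightarrow> h \<in> V \<and> h \<noteq> w \<and> \<not> E h w \<and> \<not> E w h"

lemma hole_sym: "hole w h \<Longrightarrow> w \<in> V \<Longrightarrow> hole h w"
  by (auto simp: hole_def)

lemma degree_pos: "w \<in> V \<Longrightarrow> out V w > 0"
proof (rule ccontr)
  assume w: "w \<in> V" "\<not> out V w > 0"
  then have o: "out V w = 0" by simp
  have n: "\<not> E w v" for v using w(2) nout_pos[OF finite_V, of E w] arc_V(2)[of w v] by metis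
  have "card (V - {w}) > 0" using card_V w(1) finite_V by simp
  then obtain v where v: "v \<in> V" "v \<noteq> w" by (metis Diff_iff all_not_in_conv card.empty insertCI less_irrefl)
  have "inn V v + card {v, w} \<le> card V" by (rule nin_le_Diff(1)[OF finite_V]) (use v w n irrefl in auto)
  then show False using degrees[of w v] v w n o by auto
qed

lemma degree_pos': "w \<in> V \<Longrightarrow> inn V w > 0"
  using ore.degree_pos[OF converse, of w] by (simp add: nout_converse[of E])

lemma base_facts:
  assumes "base xs w"
  shows "distinct xs" "w \<in> V" "w \<notin> set xs" "set xs = V - {w}" "length xs + 1 = card V" "length xs \<ge> 2"
    "successively E xs" "E (last xs) (hd xs)" "inn V w + out V w = length xs"
proof -
  have c: "cyc E xs" and w: "w \<in> V" "set xs = V - {w}" and d: "inn V w + out V w + 1 = card V"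
    using assms by (auto simp: base_def)
  show "distinct xs" "w \<in> V" "w \<notin> set xs" "set xs = V - {w}" "successively E xs" using c w by (auto simp: cyc_def)
  then show l: "length xs + 1 = card V" using finite_V by (metis Suc_eq_plus1 card_Suc_Diff1 distinct_card)
  then show "inn V w + out V w = length xs" using d by simp
  then show l2: "length xs \<ge> 2" using degree_pos[OF w(1)] degree_pos'[OF w(1)] by linarith
  then show "E (last xs) (hd xs)" using c by (simp add: cyc_def)
qed

lemma base_rotate: "base (us @ vs) w \<Longrightarrow> base (vs @ us) w"
  unfolding base_def using cyc_rotate[of E us vs] by auto

lemma base_split:
  assumes b: "base (us @ vs) w" and ne: "us \<noteq> []" "vs \<noteq> []"
  shows "E w (hd vs) \<longleftrightarrow> \<not> E (last us) w"
proof -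
  let ?xs = "us @ vs"
  note f = base_facts[OF b]
  have V: "set ?xs \<union> {w} = V" using f by auto
  have i: "inn V w = inn (set ?xs) w" "out V w = out (set ?xs) w"
    using nin_Un[of "set ?xs" "{w}" E w] nout_Un[of "set ?xs" "{w}" E w] f(3) nin_eq_0[of "{w}" E w] nout_eq_0[of "{w}" E w] irrefl
    unfolding V by auto
  have w: "w \<notin> set ?xs" "set (?xs @ [w]) = V" "?xs \<noteq> []" using f V ne by auto
  have ends: "\<not> (E (last ?xs) w \<and> E w (hd ?xs))"
  proof
    assume "E (last ?xs) w \<and> E w (hd ?xs)"
    then have "cyc E (?xs @ [w])" using f(1,7) w(1,3) by (subst cyc_append) auto
    then show False using not_hamiltonian w(2) by blast
  qed
  have u: "unlinked (\<lambda>x. E x w) (E w) ?xs"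
  proof (rule unlinkedI)
    fix ps qs assume s: "?xs = ps @ qs" "ps \<noteq> []" "qs \<noteq> []" "E (last ps) w" "E w (hd qs)"
    have "cyc E (ps @ [w] @ qs)"
      by (rule cyc_insert) (use s b w(1) in \<open>auto simp: base_def\<close>)
    moreover have "set (ps @ [w] @ qs) = V" using w(2) unfolding s(1) by auto
    ultimately show False using not_hamiltonian by blast
  qed
  have c: "length ?xs \<le> card {x \<in> set ?xs. E x w} + card {x \<in> set ?xs. E w x}"
    using f(9) i by (simp add: nin_def nout_def)
  show ?thesis using cyclic_count(2)[OF w(3) f(1) ends u c refl ne] by blast
qed

lemma base_around_hole:
  assumes "base (h # P) w" "hole w h"
  shows "P \<noteq> []" "E w (hd P)" "E (last P) w"
proof -
  show P: "P \<noteq> []" using base_facts(6)[OF assms(1)] by auto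
  have n: "\<not> E h w" "\<not> E w h" using assms(2) by (auto simp: hole_def)
  show "E w (hd P)" using base_split[of "[h]" P w] assms(1) P n by simp
  show "E (last P) w" using base_split[of P "[h]" w] base_rotate[of "[h]" P w] assms(1) P n by simp
qed

text \<open>As \<open>h\<close> and \<open>w\<close> are not adjacent, the degree conditions in both
  directions and the total degree \<open>card V - 1\<close> of \<open>w\<close> give
  \<open>h\<close> at least the in-degree and out-degree of \<open>w\<close>. The cyclic count for
  \<open>h\<close> on the new cycle forbids more.\<close>

lemma base_swap:
  assumes b: "base (h # P) w" and h: "hole w h"
  shows "base (w # P) h" "inn V h = inn V w" "out V h = out V w"
proof -
  note f = base_facts[OF b] and a = base_around_hole[OF b h]
  have n: "\<not> E h w" "\<not> E w h" "h \<in> V" "h \<noteq> w" using h by (auto simp: hole_def)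
  have "successively E P" "distinct P" "w \<notin> set P" "h \<notin> set P" using f a(1) by (auto simp: successively_Cons)
  then have c: "cyc E (w # P)" using a by (auto simp: cyc_def successively_Cons)
  have s: "set (w # P) = V - {h}" using f(4) n \<open>h \<notin> set P\<close> f(2) by auto
  interpret z: ore_split V E "w # P" "[h]" by (rule near_hamiltonian_split[OF c s n(3)])
  have "h \<notin> set (w # P)" using s by blast
  from z.no_detour_vertex[OF n(3) this]
  have "inn V h + out V h \<le> length (w # P)"
    using z.inn_split[of h] z.out_split[of h] nin_eq_0[of "set [h]" E h] nout_eq_0[of "set [h]" E h] irrefl by simp
  then have le: "inn V h + out V h \<le> inn V w + out V w" using f(9) by simp
  moreover have "card V \<le> out V w + inn V h + 1" "card V \<le> out V h + inn V w + 1"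
    using degrees[of w h] degrees[of h w] n f(2) by auto
  ultimately show e: "inn V h = inn V w" "out V h = out V w" using f(5,9) by linarith+
  show "base (w # P) h" unfolding base_def using c s n(3) e b by (simp add: base_def)
qed

text \<open>Directly after an in-neighbour of \<open>w\<close> there is no out-neighbour of
  \<open>w\<close>, so the vertex that breaks a run of in-neighbours is a hole.\<close>

lemma base_first_hole:
  assumes b: "base (us @ c # L @ vs) w" and c: "E c w" and ex: "\<exists>x\<in>set L. \<not> E x w"
  obtains X z Y where "L = X @ z # Y" "\<forall>x\<in>set X. E x w" "hole w z"
proof -
  obtain X z Y where s: "L = X @ z # Y" "\<not> E z w" "\<forall>x\<in>set X. E x w"
    using split_list_first_prop[OF ex] by auto
  have "E (last (us @ c # X)) w" using c s(3) last_in_set[of X] by auto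
  then have "\<not> E w z" using base_split[of "us @ c # X" "z # Y @ vs" w] b s(1) by simp
  moreover have "z \<in> V" "z \<noteq> w" using base_facts(3,4)[OF b] s(1) by auto
  ultimately have "hole w z" using s(2) by (simp add: hole_def)
  then show ?thesis using that s by blast
qed

definition twoway :: "'a \<Rightarrow> 'a set" where
  "twoway w = {v \<in> V. E v w \<and> E w v}"

text \<open>Inclusion-exclusion, since in-degree and out-degree add up to the number of vertices
  other than \<open>w\<close>. A base with most two-way neighbours thus also has most holes.\<close>

lemma card_holes:
  assumes "base xs w"
  shows "card {h. hole w h} = card (twoway w)"
proof -
  note f = base_facts[OF assms]
  let ?I = "{v \<in> V. E v w}" and ?O = "{v \<in> V. E w v}"
  have fin: "finite ?I" "finite ?O" using finite_V by auto
  have "card (?I \<union> ?O) + card (?I \<inter> ?O) = length xs"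
    using card_Un_Int[OF fin] f(9) by (simp add: nin_def nout_def)
  moreover have "?I \<inter> ?O = twoway w" by (auto simp: twoway_def)
  moreover have "V - {w} = (?I \<union> ?O) \<union> {h. hole w h}" using irrefl by (auto simp: hole_def)
  moreover have "finite {h. hole w h}" by (rule finite_subset[OF _ finite_V]) (auto simp: hole_def)
  moreover have "(?I \<union> ?O) \<inter> {h. hole w h} = {}" by (auto simp: hole_def)
  ultimately have "card (V - {w}) = card (?I \<union> ?O) + card {h. hole w h}"
    "card (?I \<union> ?O) + card (twoway w) = length xs"
    using card_Un_disjoint[of "?I \<union> ?O" "{h. hole w h}"] fin by simp_all
  moreover have "card (V - {w}) = length xs" using f(1,4) by (metis distinct_card)
  ultimately show ?thesis by simp
qed

text \<open>Without the arc from \<open>h\<close> to \<open>e\<close>, the path \<open>e\<close>,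
  \<open>h\<close> cannot be inserted into \<open>ts\<close>, which \<open>w\<close> closes up
  because \<open>d\<close> sends an arc to \<open>w\<close>. The count then contradicts the degree
  condition for \<open>w\<close> and \<open>e\<close>. The second claim is alternation around
  \<open>h\<close> after the exchange with \<open>w\<close>.\<close>

lemma pendant_arc:
  assumes b: "base (h # P @ [d, e]) w" and h: "hole w h" and de: "E d w" "E e w"
  shows "E h e" "\<not> E d h"
proof -
  note f = base_facts[OF b] and sw = base_swap[OF b h]
  have n: "\<not> E h w" "\<not> E w h" using h by (auto simp: hole_def)
  define ts where "ts = P @ [d]"
  have b': "base ((h # ts) @ [e]) w" using b by (simp add: ts_def)
  have ts: "ts \<noteq> []" "last ts = d" by (simp_all add: ts_def)
  have we: "\<not> E w e" using base_split[OF b'] de ts by simp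
  have wT: "E w (hd ts)" using base_split[of "[h]" "ts @ [e]" w] b' n ts by simp
  have dT: "distinct ts" "h \<notin> set ts" "e \<notin> set ts" "w \<notin> set ts" "h \<noteq> e" "w \<noteq> h" "w \<noteq> e" "successively E ts" 
    using base_facts(1,3,7)[OF b'] by (auto simp: path_simps)
  have eh: "E e h" using base_facts(8)[OF b'] by simp
  have V: "V = insert h (insert e (insert w (set ts)))" using base_facts(2,4)[OF b'] by auto
  show he: "E h e"
  proof (rule ccontr)
    assume he: "\<not> E h e"
    have u: "unlinked (\<lambda>u. E u e) (E h) ts"
    proof (rule unlinkedI)
      fix us vs assume s: "ts = us @ vs" "us \<noteq> []" "vs \<noteq> []" "E (last us) e" "E h (hd vs)"
      have "last vs = d" "hd us = hd ts" using ts s(1-3) by auto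
      then have "cyc E ((us @ [e, h]) @ (vs @ [w]))" (is "cyc E ?zs")
        using s(2-5) dT de wT eh unfolding s(1)
        by (subst cyc_append) (auto simp: successively_append_iff)
      moreover have "set ?zs = V" unfolding V s(1) by auto
      ultimately show False using not_hamiltonian by blast
    qed
    have "inn (set ts) e + out (set ts) h \<le> length ts + 1"
      using path_count[OF dT(1) u] by (simp add: nin_def nout_def)
    moreover have "inn V e = inn (set ts) e" "out V h = out (set ts) h"
      unfolding V using dT he we n irrefl by (simp_all add: nin_insert nout_insert)
    moreover have "card V \<le> out V w + inn V e + 1" using degrees[of w e] we V dT by auto
    moreover have "length ts + 2 = length (h # P @ [d, e])" by (simp add: ts_def)
    ultimately show False using sw f(5,9) by linarith
  qed
  have "base ((w # ts) @ [e]) h" using sw(1) by (simp add: ts_def)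
  then show "\<not> E d h" using base_split[of "w # ts" "[e]" h] he ts by simp
qed

lemma in_butlast_split:
  assumes "c \<in> set (butlast P)"
  obtains us vs where "P = us @ vs" "us \<noteq> []" "vs \<noteq> []" "last us = c" "last vs = last P"
proof -
  have "P \<noteq> []" using assms by auto
  obtain us vs where "butlast P = us @ c # vs" using assms by (meson split_list)
  then have "P = (us @ [c]) @ (vs @ [last P])" using append_butlast_last_id[OF \<open>P \<noteq> []\<close>] by simp
  then show ?thesis using that[of "us @ [c]" "vs @ [last P]"] by simp
qed

text \<open>The equivalences are alternation around \<open>h\<close> and \<open>h'\<close> after the
  exchanges with \<open>w\<close>. If one of the last two claims failed, alternation would supply a
  further arc behind \<open>c\<close> that closes a Hamilton cycle.\<close>

lemma two_holes:
  assumes b: "base (h # P1 @ h' # P2) w" and h: "hole w h" "hole w h'"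
  shows "base (w # P1 @ h' # P2) h" "base (h # P1 @ w # P2) h'"
    "P1 \<noteq> []" "P2 \<noteq> []"
    "E w (hd P1)" "E w (hd P2)" "E (last P1) w" "E (last P2) w"
    "E h (hd P1)" "E h' (hd P2)" "E (last P1) h'" "E (last P2) h"
    "E (last P1) h \<longleftrightarrow> \<not> E h h'" "E h (hd P2) \<longleftrightarrow> \<not> E h' h"
    "E h' (hd P1) \<longleftrightarrow> \<not> E h h'" "E (last P2) h' \<longleftrightarrow> \<not> E h' h"
    "c \<in> set (butlast P1) \<Longrightarrow> E c h' \<Longrightarrow> E c h"
    "\<not> E h' h \<Longrightarrow> c \<in> set (butlast P1) \<Longrightarrow> E c h \<Longrightarrow> E c h'"
proof -
  have n: "\<not> E h w" "\<not> E w h" "\<not> E h' w" "\<not> E w h'" using h by (auto simp: hole_def)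
  have b2: "base (h' # P2 @ h # P1) w" using base_rotate[of "h # P1" "h' # P2" w] b by simp
  show bh: "base (w # P1 @ h' # P2) h" by (rule base_swap(1)[OF b h(1)])
  have "base (w # P2 @ h # P1) h'" by (rule base_swap(1)[OF b2 h(2)])
  then show bh': "base (h # P1 @ w # P2) h'" using base_rotate[of "w # P2" "h # P1" h'] by simp
  show P1: "P1 \<noteq> []"
  proof
    assume "P1 = []" then show False using base_split[of "[h]" "h' # P2" w] b n by simp
  qed
  show P2: "P2 \<noteq> []"
  proof
    assume "P2 = []" then show False using base_split[of "[h']" "h # P1" w] b2 n by simp
  qed
  show wP: "E w (hd P1)" "E w (hd P2)" "E (last P1) w" "E (last P2) w"
    using base_around_hole[OF b h(1)] base_around_hole[OF b2 h(2)] P1 P2 by simp_all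
  note f = base_facts(7,8)[OF b]
  have f': "successively E P1" "successively E P2"
    using f(1) P1 P2 by (auto simp: path_simps)
  show hP: "E h (hd P1)" "E h' (hd P2)" "E (last P1) h'" "E (last P2) h"
    using f P1 P2 by (auto simp: path_simps)
  show i1: "E (last P1) h \<longleftrightarrow> \<not> E h h'" using base_split[of "w # P1" "h' # P2" h] bh P1 by auto
  show i2: "E h (hd P2) \<longleftrightarrow> \<not> E h' h" using base_split[of "w # P1 @ [h']" "P2" h] bh P2 by auto
  show i3: "E h' (hd P1) \<longleftrightarrow> \<not> E h h'" using base_split[of "[h]" "P1 @ w # P2" h'] bh' P1 by auto
  show i4: "E (last P2) h' \<longleftrightarrow> \<not> E h' h"
    using base_split[of "P1 @ w # P2" "[h]" h'] base_rotate[of "[h]" "P1 @ w # P2" h'] bh' P2 by auto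
  have d: "distinct (h # P1 @ h' # P2)" "w \<notin> set (h # P1 @ h' # P2)" "set (h # P1 @ h' # P2) = V - {w}" "w \<in> V"
    using base_facts[OF b] by auto
  show "E c h" if c: "c \<in> set (butlast P1)" "E c h'"
  proof (rule ccontr)
    assume nc: "\<not> E c h"
    obtain us vs where s: "P1 = us @ vs" "us \<noteq> []" "vs \<noteq> []" "last us = c" "last vs = last P1"
      by (rule in_butlast_split[OF c(1)])
    have "E h (hd vs)" using base_split[of "w # us" "vs @ h' # P2" h] bh nc s by auto
    moreover have "successively E us" "successively E vs" "hd us = hd P1" using f'(1) s by (auto simp: successively_append_iff)
    ultimately have "cyc E ((us @ h' # P2) @ (h # vs @ [w]))" (is "cyc E ?zs")
      using s(2-5) c(2) d(1,2) hP wP P2 f'(2) unfolding s(1)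
      by (subst cyc_append) (auto simp: path_simps)
    moreover have "set ?zs = V" using d(3,4) unfolding s(1) by auto
    ultimately show False using not_hamiltonian by blast
  qed
  show "E c h'" if n: "\<not> E h' h" and c: "c \<in> set (butlast P1)" "E c h"
  proof (rule ccontr)
    assume nc: "\<not> E c h'"
    obtain us vs where s: "P1 = us @ vs" "us \<noteq> []" "vs \<noteq> []" "last us = c" "last vs = last P1"
      by (rule in_butlast_split[OF c(1)])
    have "E h' (hd vs)" using base_split[of "h # us" "vs @ w # P2" h'] bh' nc s by auto
    moreover have "successively E us" "successively E vs" "hd us = hd P1" using f'(1) s by (auto simp: successively_append_iff)
    ultimately have "cyc E ((us @ h # P2) @ (h' # vs @ [w]))" (is "cyc E ?zs")
      using s(2-5) c(2) d(1,2) i2 i4 n wP P2 f'(2) unfolding s(1)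
      by (subst cyc_append) (auto simp: path_simps)
    moreover have "set ?zs = V" using d(3,4) unfolding s(1) by auto
    ultimately show False using not_hamiltonian by blast
  qed
qed

lemma inn_butlast:
  assumes "base (h # P1 @ h' # P2) w" "hole w h" "hole w h'" "hole w x"
  shows "inn V x = inn (set (butlast P1)) x + inn (set (butlast P2)) x + of_bool (E (last P1) x)
    + of_bool (E (last P2) x) + of_bool (E h x) + of_bool (E h' x)"
proof -
  note f = base_facts[OF assms(1)] and t = two_holes[OF assms(1-3)]
  obtain R1 a1 where 1: "P1 = R1 @ [a1]" using t(3) by (metis rev_exhaust)
  obtain R2 a2 where 2: "P2 = R2 @ [a2]" using t(4) by (metis rev_exhaust)
  have V: "V = insert w (insert h (insert a1 (insert h' (insert a2 (set R1 \<union> set R2)))))"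
    using f(2,4) 1 2 by auto
  have d: "distinct (h # R1 @ a1 # h' # R2 @ [a2])" "w \<notin> set (h # R1 @ a1 # h' # R2 @ [a2])" using f(1,3) 1 2 by auto
  have "\<not> E w x" using assms(4) by (simp add: hole_def)
  then show ?thesis unfolding V using d 1 2 by (simp add: nin_insert nin_Un)
qed

text \<open>All holes have the in-degree of \<open>w\<close>. If only the arc from \<open>h\<close>
  to \<open>h'\<close> existed, the last claim of \<open>two_holes\<close> would give
  \<open>h'\<close> at least as many in-neighbours among the inner vertices, and
  \<open>last P1\<close>, \<open>last P2\<close> and \<open>h\<close> would contribute strictly more
  to \<open>h'\<close>.\<close>

lemma holes_sym:
  assumes b: "base (h # P1 @ h' # P2) w" and h: "hole w h" "hole w h'"
  shows "E h h' \<longleftrightarrow> E h' h"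
    and "inn (set (butlast P1)) h + inn (set (butlast P2)) h = inn (set (butlast P1)) h' + inn (set (butlast P2)) h'"
proof -
  have b2: "base (h' # P2 @ h # P1) w" using base_rotate[of "h # P1" "h' # P2" w] b by simp
  have sw: "inn V h = inn V h'" using base_swap(2)[OF b h(1)] base_swap(2)[OF b2 h(2)] by simp
  note t = two_holes[OF b h] and t2 = two_holes[OF b2 h(2,1)]
  note i = inn_butlast[OF b h h(1)] inn_butlast[OF b h h(2)]
  have mono: "nin E (set X) x \<le> nin E (set X) y" if "\<And>c. c \<in> set X \<Longrightarrow> E c x \<Longrightarrow> E c y" for X x y
    unfolding nin_def by (rule card_mono) (use that in auto)
  have 1: "E h' h \<or> \<not> E h h'"
  proof (rule ccontr)
    assume n: "\<not> ?thesis"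
    then have "inn (set (butlast P1)) h \<le> inn (set (butlast P1)) h'" by (intro mono t(18)) auto
    moreover have "inn (set (butlast P2)) h \<le> inn (set (butlast P2)) h'" by (intro mono t2(17)) auto
    ultimately show False using n sw i t(11-16) irrefl by (simp add: of_bool_def split: if_splits)
  qed
  have 2: "E h h' \<or> \<not> E h' h"
  proof (rule ccontr)
    assume n: "\<not> ?thesis"
    then have "inn (set (butlast P2)) h' \<le> inn (set (butlast P2)) h" by (intro mono t2(18)) auto
    moreover have "inn (set (butlast P1)) h' \<le> inn (set (butlast P1)) h" by (intro mono t(17)) auto
    ultimately show False using n sw i t(11-16) irrefl by (simp add: of_bool_def split: if_splits)
  qed
  show e: "E h h' \<longleftrightarrow> E h' h" using 1 2 by blast
  show "inn (set (butlast P1)) h + inn (set (butlast P2)) h = inn (set (butlast P1)) h' + inn (set (butlast P2)) h'"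
    using e sw i t(11-16) irrefl by (cases "E h h'") simp_all
qed

text \<open>Otherwise alternation gives an arc from \<open>x\<close> to the vertex behind
  \<open>c\<close>. A Hamilton cycle then goes from \<open>c\<close> over \<open>w\<close> and
  \<open>P2\<close> to \<open>x\<close>, on to the vertices behind \<open>c\<close>, and to
  \<open>y\<close>, which has an arc to \<open>hd P1\<close> because \<open>x\<close> and
  \<open>y\<close> are not adjacent.\<close>

lemma independent_holes:
  assumes b: "base (x # P1 @ y # P2) w" and h: "hole w x" "hole w y" and n: "\<not> E x y" "\<not> E y x"
    and c: "c \<in> set (butlast P1)" "E c w"
  shows "E c x"
proof (rule ccontr)
  assume nc: "\<not> E c x"
  note t = two_holes[OF b h]
  obtain us vs where s: "P1 = us @ vs" "us \<noteq> []" "vs \<noteq> []" "last us = c" "last vs = last P1"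
    by (rule in_butlast_split[OF c(1)])
  have "E x (hd vs)" using base_split[of "w # us" "vs @ y # P2" x] t(1) nc s by auto
  moreover have "successively E P1" "successively E P2"
    using base_facts(7)[OF b] t(3,4) by (auto simp: path_simps)
  then have "successively E us" "successively E vs" "hd us = hd P1" "successively E P2" using s by (auto simp: successively_append_iff)
  moreover have d: "distinct (x # P1 @ y # P2)" "w \<notin> set (x # P1 @ y # P2)" "set (x # P1 @ y # P2) = V - {w}" "w \<in> V"
    using base_facts[OF b] by auto
  ultimately have "cyc E ((us @ w # P2) @ (x # vs @ [y]))" (is "cyc E ?zs")
    using s(2-5) c(2) t(4-16) n unfolding s(1)
    by (subst cyc_append) (auto simp: path_simps)
  moreover have "set ?zs = V" using d(3,4) unfolding s(1) by auto
  ultimately show False using not_hamiltonian by blast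
qed

end

definition D4_arcs :: "'a \<Rightarrow> 'a \<Rightarrow> 'a \<Rightarrow> 'a \<Rightarrow> 'a \<Rightarrow> 'a \<Rightarrow> 'a \<Rightarrow> ('a \<times> 'a) set" where
  "D4_arcs h c0 c1 c2 t0 t1 t2 = {(h, c0), (h, c1), (h, c2), (c0, h), (c1, h), (c2, h), (c0, c1), (c1, c2), (c2, c0),
    (t0, t1), (t0, t2), (t1, t0), (t1, t2), (t2, t0), (t2, t1), (t0, c0), (t1, c1), (t2, c2), (c0, t1), (c1, t2), (c2, t0)}"

definition shape_D4 :: "'a set \<Rightarrow> ('a \<Rightarrow> 'a \<Rightarrow> bool) \<Rightarrow> bool" where
  "shape_D4 V E \<longleftrightarrow> (\<exists>h c0 c1 c2 t0 t1 t2. distinct [h, c0, c1, c2, t0, t1, t2] \<and> V = {h, c0, c1, c2, t0, t1, t2}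
    \<and> (\<forall>u v. E u v \<longleftrightarrow> (u, v) \<in> D4_arcs h c0 c1 c2 t0 t1 t2))"

section \<open>Excluding two consecutive in-neighbours before a hole\<close>

context ore begin

text \<open>If \<open>h\<close>, \<open>h'\<close> and \<open>w\<close> were pairwise nonadjacent,
  three exchanges would swap \<open>h\<close> and \<open>h'\<close> on the cycle. Then
  \<open>d\<close> lies behind \<open>h\<close> and before \<open>h'\<close>, and
  \<open>independent_holes\<close> gives the arc from \<open>d\<close> to \<open>h\<close> that
  \<open>pendant_arc\<close> forbids.\<close>

lemma adjacent_holes:
  assumes b: "base (h # P1 @ h' # P2 @ [d, e]) w" and h: "hole w h" "hole w h'" and de: "E d w" "E e w"
  shows "E h h'" "E h' h"
proof -
  have b': "base (h # (P1 @ h' # P2) @ [d, e]) w" using b by simp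
  have sym: "E h h' \<longleftrightarrow> E h' h" by (rule holes_sym(1)[OF b h])
  have "E h h'"
  proof (rule ccontr)
    assume n: "\<not> E h h'"
    have hh': "hole h' h" "hole h h'" "hole h' w" "hole h w"
      using h n sym base_facts(1,2)[OF b] by (auto simp: hole_def)
    define R where "R = P2 @ [d, e]"
    have "base (w # P1 @ h' # R) h" using base_swap(1)[OF b h(1)] by (simp add: R_def)
    then have "base (h' # R @ w # P1) h" using base_rotate[of "w # P1" "h' # R" h] by simp
    then have "base (h # R @ w # P1) h'" by (rule base_swap(1)[OF _ hh'(2)])
    then have "base (w # P1 @ h # R) h'" using base_rotate[of "h # R" "w # P1" h'] by simp
    then have "base (h' # P1 @ h # R) w" by (rule base_swap(1)[OF _ hh'(3)])
    then have r: "base (h # R @ h' # P1) w" using base_rotate[of "h' # P1" "h # R" w] by simp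
    have "d \<in> set (butlast R)" by (simp add: R_def butlast_append)
    then have "E d h" using independent_holes[OF r h _ _ _ de(1)] n sym by blast
    then show False using pendant_arc(2)[OF b' h(1) de] by blast
  qed
  then show "E h h'" "E h' h" using sym by blast+
qed

text \<open>Both \<open>w\<close> and \<open>z\<close> are holes of \<open>h\<close>, so arcs
  between them are symmetric. Without them \<open>z\<close> would be a hole of \<open>w\<close>,
  hence adjacent to \<open>h\<close> by \<open>adjacent_holes\<close>.\<close>

lemma hole_of_hole:
  assumes b: "base (h # P @ [d, e]) w" and h: "hole w h" and de: "E d w" "E e w"
    and z: "hole h z" "z \<noteq> w"
  shows "E z w" "E w z"
proof -
  have bh: "base (w # P @ [d, e]) h" by (rule base_swap(1)[OF b h])
  have "z \<in> set (P @ [d, e])" using base_facts(4)[OF bh] z by (auto simp: hole_def)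
  then obtain L1 L2 where L: "P @ [d, e] = L1 @ z # L2" by (meson split_list)
  have bz: "base (w # L1 @ z # L2) h" using bh unfolding L by simp
  have hw: "hole h w" using hole_sym[OF h] base_facts(2)[OF b] by blast
  have sym: "E w z \<longleftrightarrow> E z w" by (rule holes_sym(1)[OF bz hw z(1)])
  have "E z w"
  proof (rule ccontr)
    assume n: "\<not> E z w"
    then have wz: "hole w z" using z sym by (simp add: hole_def)
    have "z \<noteq> d" "z \<noteq> e" using n de by auto
    then have "z \<in> set P" using \<open>z \<in> set (P @ [d, e])\<close> by simp
    then obtain M1 M2 where "P = M1 @ z # M2" by (meson split_list)
    then have "E h z" using adjacent_holes[of h M1 z M2 d e w] b h wz de by simp
    then show False using z by (simp add: hole_def)
  qed
  then show "E z w" "E w z" using sym by blast+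
qed

text \<open>On the cycle missing \<open>h\<close>, the vertices \<open>w\<close> and
  \<open>z\<close> are two holes. The condition on \<open>Y\<close> and the equal sums in
  \<open>holes_sym\<close> give them the same in-neighbours in \<open>butlast (P1 @ h' # X)\<close>.
  So \<open>last P1\<close> has an arc to \<open>z\<close> and \<open>h'\<close> has none, which
  supplies the arcs around \<open>z\<close> in a Hamilton cycle.\<close>

lemma three_hole_cycle:
  assumes b: "base (h # P1 @ h' # X @ z # Y) w" and h: "hole w h" "hole w h'" and adj: "E h h'" "E h' h"
    and z: "hole h z" "E z w" "E w z" and X: "X \<noteq> []" "E (last X) h" and Y: "\<And>c. c \<in> set Y \<Longrightarrow> E c w"
  shows False
proof -
  note t = two_holes[OF b h]
  let ?L = "P1 @ h' # X"
  have hw: "hole h w" using hole_sym[OF h(1)] base_facts(2)[OF b] by blast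
  have bh: "base (w # ?L @ z # Y) h" using t(1) by simp
  note s = two_holes[OF bh hw z(1)] and e = holes_sym(2)[OF bh hw z(1)]
  have fin: "finite {c \<in> set A. E c x}" for A x by simp
  have "inn (set (butlast Y)) w \<le> inn (set (butlast Y)) z"
  proof -
    have by': "base (z # Y @ w # ?L) h" using base_rotate[of "w # ?L" "z # Y" h] bh by simp
    show ?thesis unfolding nin_def
      by (rule card_mono) (use two_holes(17)[OF by' z(1) hw] in auto)
  qed
  then have le: "inn (set (butlast ?L)) z \<ge> inn (set (butlast ?L)) w \<or> inn (set (butlast Y)) z > inn (set (butlast Y)) w"
    using e by linarith
  have "inn (set (butlast Y)) z \<le> inn (set (butlast Y)) w"
    unfolding nin_def by (rule card_mono) (use Y in_set_butlastD[of _ Y] in auto)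
  then have ge: "inn (set (butlast ?L)) z \<ge> inn (set (butlast ?L)) w" using le by linarith
  have sub: "{c \<in> set (butlast ?L). E c z} \<subseteq> {c \<in> set (butlast ?L). E c w}" using s(17) by auto
  have "{c \<in> set (butlast ?L). E c z} = {c \<in> set (butlast ?L). E c w}"
    by (rule card_seteq[OF fin sub]) (use ge in \<open>simp add: nin_def\<close>)
  then have same: "E c z \<longleftrightarrow> E c w" if "c \<in> set (butlast ?L)" for c using that by blast
  have bl: "butlast ?L = P1 @ h' # butlast X" using X(1) by (simp add: butlast_append)
  have "last P1 \<in> set P1" using t(3) by simp
  then have a1: "E (last P1) z" using same[of "last P1"] t(7) bl by simp
  have "\<not> E h' z" using same[of h'] bl h(2) by (simp add: hole_def)
  moreover have "base ((w # P1 @ [h']) @ (X @ h # Y)) z" using s(2) by simp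
  ultimately have a2: "E z (hd X)" using base_split[of "w # P1 @ [h']" "X @ h # Y" z] X(1) by simp
  have b2: "base (h' # (X @ z # Y) @ h # P1) w" using base_rotate[of "h # P1" "h' # X @ z # Y" w] b by simp
  have "last X \<in> set (butlast (X @ z # Y))" using X(1) by (simp add: butlast_append)
  then have a3: "E (last X) h'" using two_holes(17)[OF b2 h(2,1)] X(2) by blast
  have a4: "E h (hd Y)" "Y \<noteq> []" "E (last Y) w" "E w (hd P1)" using s(4,6) z t(5) Y by auto
  have f: "successively E P1" "successively E X" "successively E Y"
    using base_facts(7)[OF b] t(3) X a4(2) by (auto simp: path_simps)
  have d: "distinct (h # P1 @ h' # X @ z # Y)" "w \<notin> set (h # P1 @ h' # X @ z # Y)" "set (h # P1 @ h' # X @ z # Y) = V - {w}" "w \<in> V"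
    using base_facts[OF b] by auto
  have "cyc E ((h # Y @ [w]) @ (P1 @ z # X @ [h']))" (is "cyc E ?zs")
    using a1 a2 a3 a4 f d(1,2) adj t(3) X(1)
    by (subst cyc_append) (auto simp: path_simps)
  moreover have "set ?zs = V" using d(3,4) by auto
  ultimately show False using not_hamiltonian by blast
qed

lemma finite_holes: "finite {h. hole w h}"
  by (rule finite_subset[OF _ finite_V]) (auto simp: hole_def)

text \<open>If \<open>w\<close> has two consecutive in-neighbours \<open>d\<close>, \<open>e\<close> in front of the hole \<open>h\<close>, then exchanging \<open>w\<close>
with \<open>h\<close> produces new holes. By maximality \<open>w\<close> has at least as many holes as \<open>h\<close>, which leads to the
configuration of \<open>three_hole_cycle\<close>.\<close>

lemma no_run:
  assumes b: "base (h # P @ [d, e]) w" and h: "hole w h" and de: "E d w" "E e w"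
    and max: "\<And>ys v. base ys v \<Longrightarrow> card (twoway v) \<le> card (twoway w)"
  shows False
proof -
  have hw: "hole h w" using hole_sym[OF h] base_facts(2)[OF b] by blast
  have bh: "base (w # P @ [d, e]) h" by (rule base_swap(1)[OF b h])
  have le: "card {z. hole h z} \<le> card {z. hole w z}"
    using max[OF bh] card_holes[OF b] card_holes[OF bh] by simp
  have dist: "distinct (h # P @ [d, e])" "w \<notin> set (h # P @ [d, e])" "set (h # P @ [d, e]) = V - {w}"
    using base_facts[OF b] by auto
  have eh: "E h e" and dh: "\<not> E d h" using pendant_arc[OF b h de] by blast+
  have deg: "inn V h = inn V w" by (rule base_swap(2)[OF b h])
  \<comment> \<open>Otherwise, by maximality, \<open>w\<close> is the only hole of \<open>h\<close>.
    But \<open>h\<close> has an in-neighbour besides \<open>e\<close>, and the run of in-neighbours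
    starting there breaks at \<open>d\<close> at the latest, at another hole of
    \<open>h\<close>.\<close>
  have other: "\<exists>h'. hole w h' \<and> h' \<noteq> h"
  proof (rule ccontr)
    assume "\<not> ?thesis"
    then have "{z. hole w z} = {h}" using h by blast
    then have 1: "card {z. hole h z} \<le> 1" using le by simp
    have "card {d, e} \<le> inn V w" unfolding nin_def
      by (rule card_mono) (use finite_V arc_V de in auto)
    then have "inn V h \<ge> 2" using deg dist by simp
    have "\<not> {c \<in> V. E c h} \<subseteq> {e}"
    proof
      assume "{c \<in> V. E c h} \<subseteq> {e}"
      then have "inn V h \<le> card {e}" unfolding nin_def by (intro card_mono) auto
      then show False using \<open>inn V h \<ge> 2\<close> by simp
    qed
    then obtain c where c: "c \<in> V" "E c h" "c \<noteq> e" by blast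
    have "c \<noteq> w" "c \<noteq> h" "c \<noteq> d" using c h irrefl dh by (auto simp: hole_def)
    then have "c \<in> set P" using c dist(3) by auto
    then obtain A B where AB: "P = A @ c # B" by (meson split_list)
    have b1: "base ((w # A) @ c # (B @ [d]) @ [e]) h" using bh unfolding AB by simp
    have "\<exists>x\<in>set (B @ [d]). \<not> E x h" using dh by simp
    then obtain X z Y where z: "B @ [d] = X @ z # Y" "\<forall>x\<in>set X. E x h" "hole h z"
      by (rule base_first_hole[OF b1 c(2)])
    have "z \<in> set (B @ [d])" unfolding z(1) by simp
    then have "z \<noteq> w" using dist(2) unfolding AB by auto
    then have "card {w, z} \<le> card {z. hole h z}" using hw z(3) finite_holes by (intro card_mono) auto
    then show False using 1 \<open>z \<noteq> w\<close> by simp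
  qed
  have inP: "x \<in> set P" if "hole w x" "x \<noteq> h" for x
    using that dist(3) de by (auto simp: hole_def)
  have ex: "\<exists>x\<in>set P. hole w x" using other inP by blast
  obtain P1 h' P2 where P: "P = P1 @ h' # P2" "hole w h'" "\<forall>x\<in>set P2. \<not> hole w x"
    using split_list_last_prop[OF ex] by auto
  have adj: "E h x" "E x h" if x: "hole w x" "x \<noteq> h" for x
  proof -
    obtain A B where "P = A @ x # B" using inP[OF x] by (meson split_list)
    then show "E h x" "E x h" using adjacent_holes[of h A x B d e w] b h x(1) de by simp_all
  qed
  have h'h: "h' \<noteq> h" using dist(1) P(1) by auto
  have b1: "base ((w # P1) @ h' # (P2 @ [d]) @ [e]) h" using bh unfolding P by simp
  have exd: "\<exists>x\<in>set (P2 @ [d]). \<not> E x h" using dh by simp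
  obtain X z Y0 where z: "P2 @ [d] = X @ z # Y0" "\<forall>x\<in>set X. E x h" "hole h z"
    by (rule base_first_hole[OF b1 adj(2)[OF P(2) h'h] exd])
  define Y where "Y = Y0 @ [e]"
  have PP: "P @ [d, e] = P1 @ h' # X @ z # Y"
  proof -
    have "P @ [d, e] = P1 @ h' # (P2 @ [d]) @ [e]" unfolding P by simp
    then show ?thesis unfolding z(1) Y_def by simp
  qed
  have bz: "base (h # P1 @ h' # X @ z # Y) w" using b unfolding PP by simp
  have zw: "z \<noteq> w" using dist(2) unfolding PP by auto
  note zz = hole_of_hole[OF b h de z(3) zw]
  have Yw: "E c w" if c: "c \<in> set Y" for c
  proof (rule ccontr)
    assume n: "\<not> E c w"
    then have "c \<in> set Y0" using c de by (auto simp: Y_def)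
    moreover have "base ((h # P1 @ h' # X) @ z # Y0 @ [e]) w" using bz by (simp add: Y_def)
    ultimately obtain X' z' Y' where z': "Y0 = X' @ z' # Y'" "hole w z'"
      using base_first_hole[OF _ zz(1), of "h # P1 @ h' # X" Y0 "[e]"] n by metis
    then have "z' \<in> set (P2 @ [d])" unfolding z(1) by simp
    then show False using z'(2) P(3) de by (auto simp: hole_def)
  qed
  have P1: "P1 \<noteq> []" using two_holes(3)[OF bz h P(2)] .
  show False
  proof (cases "X = []")
    case False
    then show False using three_hole_cycle[OF bz h P(2) adj[OF P(2) h'h] z(3) zz False _ Yw] z(2) by simp
  next
    \<comment> \<open>\<open>three_hole_cycle\<close> needs a nonempty segment before
      \<open>z\<close>. A third hole of \<open>w\<close>, which lies in \<open>P1\<close>, can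
      replace \<open>h'\<close>, and \<open>h'\<close> then ends such a segment.\<close>
    case X: True
    show False
    proof (cases "\<exists>x. hole w x \<and> x \<noteq> h \<and> x \<noteq> h'")
      case True
      then obtain x where x: "hole w x" "x \<noteq> h" "x \<noteq> h'" by blast
      then have "x \<in> set P1" using inP[OF x(1,2)] P by auto
      then obtain A B where AB: "P1 = A @ x # B" by (meson split_list)
      have bx: "base (h # A @ x # (B @ [h']) @ z # Y) w" using bz X unfolding AB by simp
      show False
        by (rule three_hole_cycle[OF bx h x(1) adj[OF x(1,2)] z(3) zz _ _ Yw]) (use adj(2)[OF P(2) h'h] in simp_all)
    next
      case False
      \<comment> \<open>With two holes of \<open>w\<close>, maximality allows \<open>h\<close> no
        holes besides \<open>w\<close> and \<open>z\<close>. But \<open>h\<close> has in-degree at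
        least 3, and an in-neighbour other than \<open>e\<close> and \<open>h'\<close> starts a run
        that breaks at a third hole.\<close>
      then have "{x. hole w x} \<subseteq> {h, h'}" by auto
      then have "card {x. hole w x} \<le> card {h, h'}" by (intro card_mono) auto
      then have two: "card {x. hole h x} \<le> 2" using le h'h by simp
      have lP: "\<not> E (last P1) h" "E (last P1) w" using two_holes(7,13)[OF bz h P(2)] adj(1)[OF P(2) h'h] by auto
      have lP1: "last P1 \<in> set P1" "last P1 \<noteq> d" "last P1 \<noteq> e" using P1 dist(1) last_in_set[OF P1] unfolding P by auto
      have "card {d, e, last P1} \<le> inn V w" unfolding nin_def
        by (rule card_mono) (use finite_V arc_V de lP in auto)
      moreover have "card {d, e, last P1} = 3" using lP1 dist(1) by simp
      ultimately have "inn V h \<ge> 3" using deg by simp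
      have "\<not> {c \<in> V. E c h} \<subseteq> {e, h'}"
      proof
        assume "{c \<in> V. E c h} \<subseteq> {e, h'}"
        then have "inn V h \<le> card {e, h'}" unfolding nin_def by (intro card_mono) auto
        also have "card {e, h'} \<le> 2" by (simp add: card_insert_if)
        finally show False using \<open>inn V h \<ge> 3\<close> by simp
      qed
      then obtain c where c: "c \<in> V" "E c h" "c \<noteq> e" "c \<noteq> h'" by blast
      have cn: "c \<noteq> w" "c \<noteq> h" "c \<noteq> d" "c \<noteq> z" using c h irrefl dh z(3) by (auto simp: hole_def)
      have "set (h # P1 @ h' # X @ z # Y) = V - {w}" by (rule base_facts(4)[OF bz])
      then have "c \<in> set P1 \<or> c \<in> set Y0" using c cn X by (auto simp: Y_def)
      then have "\<exists>z2. hole h z2 \<and> z2 \<noteq> w \<and> z2 \<noteq> z"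
      proof
        assume "c \<in> set P1"
        then obtain A B where AB: "P1 = A @ c # B" by (meson split_list)
        have "B \<noteq> []" using lP(1) c(2) AB by auto
        then have l: "\<exists>x\<in>set B. \<not> E x h" using lP(1) AB by auto
        have "base ((w # A) @ c # B @ (h' # P2 @ [d, e])) h" using bh unfolding P AB by simp
        then obtain X' z2 Y' where z2: "B = X' @ z2 # Y'" "\<forall>x\<in>set X'. E x h" "hole h z2"
          by (rule base_first_hole[OF _ c(2) l])
        have "distinct (h # P1 @ h' # X @ z # Y)" "w \<notin> set (h # P1 @ h' # X @ z # Y)" using base_facts(1,3)[OF bz] by auto
        then have "z2 \<noteq> w" "z2 \<noteq> z" unfolding AB z2(1) by auto
        then show ?thesis using z2 by blast
      next
        assume "c \<in> set Y0"
        then obtain A B where AB: "Y0 = A @ c # B" by (meson split_list)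
        have "last (P2 @ [d]) = last Y0" unfolding z(1) AB by simp
        then have "last Y0 = d" by simp
        then have "B \<noteq> []" "last B = d" using AB cn(3) by (auto split: if_splits)
        then have l: "\<exists>x\<in>set B. \<not> E x h" using dh by (metis last_in_set)
        have "base ((w # P1 @ h' # X @ z # A) @ c # B @ [e]) h" using bh unfolding PP Y_def AB by simp
        then obtain X' z2 Y' where z2: "B = X' @ z2 # Y'" "\<forall>x\<in>set X'. E x h" "hole h z2"
          by (rule base_first_hole[OF _ c(2) l])
        have "distinct (h # P1 @ h' # X @ z # Y)" "w \<notin> set (h # P1 @ h' # X @ z # Y)" using base_facts(1,3)[OF bz] by auto
        then have "z2 \<noteq> w" "z2 \<noteq> z" unfolding Y_def AB z2(1) by auto
        then show ?thesis using z2 by blast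
      qed
      then obtain z2 where z2: "hole h z2" "z2 \<noteq> w" "z2 \<noteq> z" by blast
      have "card {w, z, z2} \<le> card {x. hole h x}" using hw z(3) z2(1) finite_holes by (intro card_mono) auto
      moreover have "card {w, z, z2} = 3" using z2 zw by auto
      ultimately show False using two by simp
    qed
  qed
qed

text \<open>If \<open>w\<close> sends no arc to \<open>v\<close>, alternation makes the vertex
  before \<open>v\<close> an in-neighbour too. The run of in-neighbours through \<open>v\<close>
  ends at a hole, so two consecutive in-neighbours precede a hole, against
  \<open>no_run\<close>.\<close>

lemma max_base_in_sub_out:
  assumes b: "base xs w" and max: "\<And>ys v. base ys v \<Longrightarrow> card (twoway v) \<le> card (twoway w)" and v: "E v w"
  shows "E w v"
proof (rule ccontr)
  assume n: "\<not> E w v"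
  have "v \<in> set xs" using base_facts(4)[OF b] v arc_V(1) irrefl by auto
  then obtain us vs where s: "xs = us @ v # vs" by (meson split_list)
  then have bv: "base (v # vs @ us) w" using base_rotate[of us "v # vs"] b by simp
  obtain ys where ys: "base (v # ys) w" using bv by blast
  note f = base_facts[OF ys]
  have ne: "ys \<noteq> []" using f(6) by auto
  have ul: "E (last ys) w" using base_split[of ys "[v]" w] base_rotate[of "[v]" ys w] ys ne n by simp
  \<comment> \<open>If all vertices were in-neighbours, they would use up the total degree and leave
    \<open>w\<close> with out-degree 0.\<close>
  have ex: "\<exists>x\<in>set ys. \<not> E x w"
  proof (rule ccontr)
    assume "\<not> ?thesis"
    then have "set (v # ys) \<subseteq> {x \<in> V. E x w}" using v arc_V(1) by auto
    then have "card (set (v # ys)) \<le> inn V w" unfolding nin_def using finite_V by (intro card_mono) auto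
    then show False using f(1,9) degree_pos[OF f(2)] distinct_card[OF f(1)] by linarith
  qed
  have "base ([] @ v # ys @ []) w" using ys by simp
  then obtain X h Y where h: "ys = X @ h # Y" "\<forall>x\<in>set X. E x w" "hole w h"
    by (rule base_first_hole[OF _ v ex])
  have "Y \<noteq> []" using ul h(1,3) by (auto simp: hole_def)
  then have Y: "Y = butlast Y @ [last Y]" "last Y = last ys" using h(1) by simp_all
  have bb: "base (h # Y @ v # X) w" using base_rotate[of "v # X" "h # Y" w] ys h(1) by simp
  obtain R d e where R: "Y @ v # X = R @ [d, e]" "E d w" "E e w"
  proof (cases "X = []")
    case True
    then show ?thesis using that[of "butlast Y" "last ys" v] Y ul v
      by (metis append_Cons append_assoc append_Nil)
  next
    case False
    have X: "X = butlast X @ [last X]" "E (last X) w" using False h(2) by simp_all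
    obtain R d where R: "v # butlast X = R @ [d]" by (metis list.distinct(1) rev_exhaust)
    then have "d \<in> set (v # butlast X)" by simp
    then have "E d w" using v h(2) in_set_butlastD[of d X] by auto
    moreover have "Y @ v # X = (Y @ R) @ [d, last X]"
      using R X(1) by (metis append_Cons append_assoc append_Nil)
    ultimately show ?thesis using that[of "Y @ R" d "last X"] X(2) by simp
  qed
  have "base (h # R @ [d, e]) w" using bb unfolding R(1) .
  then show False by (rule no_run[OF _ h(3) R(2,3)]) (rule max)
qed

lemma base_converse: "ore.base V (\<lambda>x y. E y x) (rev xs) w \<longleftrightarrow> base xs w"
  using ore.base_def[OF converse, of "rev xs" w] unfolding base_def
  by (simp add: cyc_rev nin_converse[of E] nout_converse[of E] add.commute)

lemma twoway_converse: "ore.twoway V (\<lambda>x y. E y x) w = twoway w"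
  using ore.twoway_def[OF converse, of w] unfolding twoway_def by auto

lemma max_base_symmetric:
  assumes b: "base xs w" and max: "\<And>ys v. base ys v \<Longrightarrow> card (twoway v) \<le> card (twoway w)"
  shows "E v w \<longleftrightarrow> E w v"
proof
  show "E v w \<Longrightarrow> E w v" by (rule max_base_in_sub_out[OF b max])
  have b': "ore.base V (\<lambda>x y. E y x) (rev xs) w" using b base_converse by simp
  have max': "card (ore.twoway V (\<lambda>x y. E y x) v) \<le> card (ore.twoway V (\<lambda>x y. E y x) w)"
    if "ore.base V (\<lambda>x y. E y x) ys v" for ys v
    unfolding twoway_converse using max[of "rev ys" v] base_converse[of "rev ys" v] that by simp
  show "E v w" if "E w v" by (rule ore.max_base_in_sub_out[OF converse b' _ that]) (rule max')
qed

end

lemma shape_D3I: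
  assumes "distinct [v0, v1, x, y]" "{v0, v1, x, y} \<inter> K = {}" "K \<noteq> {}" "V = {v0, v1, x, y} \<union> K"
    and "\<And>u v. (u, v) \<notin> {(v0, v1), (v1, v0)} \<Longrightarrow> E u v \<longleftrightarrow>
        (u, v) \<in> {(v0, y), (y, v1), (v1, x), (x, v0), (x, y), (y, x)} \<or>
        u \<in> K \<and> v \<in> K \<and> u \<noteq> v \<or> u \<in> {v0, v1} \<and> v \<in> K \<or> u \<in> K \<and> v \<in> {v0, v1}"
  shows "shape_D3 V E"
  unfolding shape_D3_def
  by (rule exI[of _ v0], rule exI[of _ v1], rule exI[of _ x], rule exI[of _ y], rule exI[of _ K])
    (intro conjI allI impI; fact assms)

lemma shape_D4I:
  assumes "distinct [h, c0, c1, c2, t0, t1, t2]" "V = {h, c0, c1, c2, t0, t1, t2}"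
    and "\<And>u v. E u v \<longleftrightarrow> (u, v) \<in> D4_arcs h c0 c1 c2 t0 t1 t2"
  shows "shape_D4 V E"
  unfolding shape_D4_def
  by (rule exI[of _ h], rule exI[of _ c0], rule exI[of _ c1], rule exI[of _ c2], rule exI[of _ t0], rule exI[of _ t1], rule exI[of _ t2])
    (intro conjI allI; fact assms)

section \<open>Alternating bases\<close>

locale ore_alternating = ore +
  fixes xs :: "'a list" and w :: 'a
  assumes base_w: "base xs w" and symmetric_w: "E v w \<longleftrightarrow> E w v"
begin

text \<open>Half the length of the cycle is the in-degree and the out-degree of \<open>w\<close> as
  well as its number of neighbours and of holes (\<open>degrees_w\<close>).\<close>

abbreviation "g \<equiv> length xs div 2"

lemma hole_iff: "hole w v \<longleftrightarrow> v \<in> V \<and> v \<noteq> w \<and> \<not> E w v"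
  using symmetric_w by (auto simp: hole_def)

lemma V_cases:
  assumes "v \<in> V"
  obtains "v = w" | "hole w v" | "E w v"
  using assms hole_iff by blast

lemma hole_w: "hole w h \<Longrightarrow> \<not> E w h \<and> \<not> E h w \<and> h \<noteq> w \<and> h \<in> V"
  by (simp add: hole_def)

lemma alternate: "base (us @ vs) w \<Longrightarrow> us \<noteq> [] \<Longrightarrow> vs \<noteq> [] \<Longrightarrow> E w (hd vs) \<longleftrightarrow> \<not> E w (last us)"
  using base_split[of us vs w] symmetric_w by blast

lemma base_starting_at:
  assumes "v \<in> V" "v \<noteq> w"
  obtains ys where "base (v # ys) w"
proof -
  have "v \<in> set xs" using base_facts(4)[OF base_w] assms by simp
  then obtain us vs where "xs = us @ v # vs" by (meson split_list)
  then show ?thesis using that base_rotate[of us "v # vs" w] base_w by simp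
qed

lemma mem_base: "base ys w \<Longrightarrow> v \<in> set ys \<longleftrightarrow> v \<in> V \<and> v \<noteq> w"
  using base_facts(4)[of ys w] by simp

lemma base_through_holes:
  assumes "hole w a" "hole w b" "a \<noteq> b"
  obtains P1 P2 where "base (a # P1 @ b # P2) w"
proof -
  have "a \<in> V" "a \<noteq> w" using hole_w[OF assms(1)] by auto
  then obtain ys where ys: "base (a # ys) w" by (rule base_starting_at)
  have "b \<in> set (a # ys)" unfolding base_facts(4)[OF ys] using hole_w[OF assms(2)] by simp
  then have "b \<in> set ys" using assms(3) by simp
  then obtain P1 P2 where "ys = P1 @ b # P2" by (meson split_list)
  then show ?thesis using that ys by blast
qed

lemma degrees_w: "inn V w = g" "out V w = g" "card {v \<in> V. E w v} = g" "card {h. hole w h} = g" "length xs = 2 * g"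
proof -
  have i: "inn V w = card {v \<in> V. E w v}" "out V w = card {v \<in> V. E w v}"
    using symmetric_w by (simp_all add: nin_def nout_def)
  then have l: "length xs = 2 * card {v \<in> V. E w v}" using base_facts(9)[OF base_w] by simp
  then show "inn V w = g" "out V w = g" "card {v \<in> V. E w v} = g" "length xs = 2 * g" using i by simp_all
  have "twoway w = {v \<in> V. E w v}" using symmetric_w by (auto simp: twoway_def)
  then show "card {h. hole w h} = g" using card_holes[OF base_w] l by simp
qed

lemma hole_sym_arc:
  assumes "hole w a" "hole w b"
  shows "E a b \<longleftrightarrow> E b a"
proof (cases "a = b")
  case False
  obtain P1 P2 where "base (a # P1 @ b # P2) w" by (rule base_through_holes[OF assms False])
  then show ?thesis using holes_sym(1) assms by blast
qed simp

text \<open>If one of the arcs is missing, \<open>two_holes\<close> supplies an arc between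
  \<open>x\<close> and an end of \<open>P2\<close>; with the arc from \<open>h'\<close> to
  \<open>h\<close>, a Hamilton cycle closes through \<open>w\<close>.\<close>

lemma adjacency_spreads:
  assumes b: "base (h # P1 @ h' # P2) w" and h: "hole w h" "hole w h'" "E h' h"
    and x: "hole w x" "x \<in> set P1"
  shows "E h' x" "E x h"
proof -
  obtain U W where s: "P1 = U @ x # W" using x(2) by (meson split_list)
  have b1: "base (h # U @ x # (W @ h' # P2)) w" using b unfolding s by simp
  have b2: "base (x # W @ h' # (P2 @ h # U)) w" using base_rotate[of "h # U" "x # W @ h' # P2" w] b1 by simp
  have b3: "base (x # (W @ h' # P2) @ h # U) w" using b2 by simp
  note t1 = two_holes[OF b1 h(1) x(1)] and t2 = two_holes[OF b2 x(1) h(2)] and t3 = two_holes[OF b3 x(1) h(1)]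
    and t = two_holes[OF b h(1,2)]
  have f: "successively E U" "successively E W" "successively E P2"
    using base_facts(7)[OF b1] t1(3) t2(3) t(4) by (auto simp: path_simps)
  have d: "distinct (h # U @ x # W @ h' # P2)" "w \<notin> set (h # U @ x # W @ h' # P2)"
    "set (h # U @ x # W @ h' # P2) = V - {w}" "w \<in> V"
    using base_facts[OF b1] by auto
  show "E h' x"
  proof (rule ccontr)
    assume "\<not> E h' x"
    then have "E x (hd P2)" using t2(14) t(4) by simp
    then have "cyc E ((h # U @ x # P2) @ (w # W @ [h']))" (is "cyc E ?zs")
      using f d(1,2) t1(3,5,7,9,11) t2(3,5,7,9,11) t(4-12) h(3)
      by (subst cyc_append) (auto simp: path_simps)
    moreover have "set ?zs = V" using d(3,4) by auto
    ultimately show False using not_hamiltonian by blast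
  qed
  show "E x h"
  proof (rule ccontr)
    assume "\<not> E x h"
    then have "E (last P2) x" using t3(13) t(4) by simp
    then have "cyc E ((h # U @ w # P2) @ (x # W @ [h']))" (is "cyc E ?zs")
      using f d(1,2) t1(3,5,7,9,11) t2(3,5,7,9,11) t(4-12) h(3)
      by (subst cyc_append) (auto simp: path_simps)
    moreover have "set ?zs = V" using d(3,4) by auto
    ultimately show False using not_hamiltonian by blast
  qed
qed

text \<open>\<open>adjacency_spreads\<close> is applied to the side of the cycle, between
  \<open>a\<close> and \<open>b\<close> or between \<open>b\<close> and \<open>a\<close>, on which
  \<open>x\<close> lies.\<close>

lemma adjacent_to_all:
  assumes h: "hole w a" "hole w b" "a \<noteq> b" "E a b" and x: "hole w x" "x \<noteq> a"
  shows "E x a"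
proof (cases "x = b")
  case True
  then show ?thesis using hole_sym_arc[OF h(1,2)] h(4) by simp
next
  case False
  obtain P1 P2 where b: "base (a # P1 @ b # P2) w" by (rule base_through_holes[OF h(1-3)])
  then have b': "base (b # P2 @ a # P1) w" using base_rotate[of "a # P1" "b # P2" w] by simp
  have "x \<in> set (a # P1 @ b # P2)" using mem_base[OF b] hole_w[OF x(1)] by blast
  then have "x \<in> set P1 \<or> x \<in> set P2" using x(2) False by auto
  then show ?thesis
    using adjacency_spreads[OF b h(1,2) _ x(1)] adjacency_spreads[OF b' h(2,1) h(4) x(1)] hole_sym_arc h x(1) by blast
qed

lemma holes_dichotomy:
  "(\<forall>x y. hole w x \<longrightarrow> hole w y \<longrightarrow> x \<noteq> y \<longrightarrow> E x y) \<or> (\<forall>x y. hole w x \<longrightarrow> hole w y \<longrightarrow> \<not> E x y)"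
proof -
  have "E x y" if ab: "hole w a" "hole w b" "E a b" and xy: "hole w x" "hole w y" "x \<noteq> y" for a b x y
  proof -
    have "a \<noteq> b" using ab(3) irrefl by auto
    then have 1: "E c a" if "hole w c" "c \<noteq> a" for c using adjacent_to_all[OF ab(1,2) _ ab(3) that] by blast
    show ?thesis
    proof (cases "y = a")
      case True
      then show ?thesis using 1 xy by blast
    next
      case False
      then show ?thesis using adjacent_to_all[OF xy(2) ab(1) False 1[OF xy(2) False] xy(1,3)] by blast
    qed
  qed
  then show ?thesis by blast
qed

text \<open>On the cycle every neighbour \<open>c\<close> of \<open>w\<close> lies between two
  holes. For any other hole, \<open>two_holes\<close> turns the missing arcs to these two into arcs
  with \<open>c\<close>. So \<open>w\<close> and the holes form the independent part, one larger
  than the set of neighbours.\<close>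

lemma independent_shape:
  assumes ind: "\<And>x y. hole w x \<Longrightarrow> hole w y \<Longrightarrow> \<not> E x y"
  shows "shape_D2 V E"
proof -
  have arcs: "E c h \<and> E h c" if h: "hole w h" and c: "E w c" for h c
  proof -
    have cV: "c \<in> V" "c \<noteq> w" using c arc_V irrefl by auto
    obtain ys where ys: "base (c # ys) w" by (rule base_starting_at[OF cV])
    have l: "length ys \<ge> 1" using base_facts(6)[OF ys] by simp
    then have ne: "ys \<noteq> []" by auto
    have b2: "base (ys @ [c]) w" using base_rotate[of "[c]" ys w] ys by simp
    note f = base_facts[OF ys]
    have "hd ys \<in> set (c # ys)" "last ys \<in> set (c # ys)" using ne by simp_all
    then have V: "hd ys \<in> V" "last ys \<in> V" "hd ys \<noteq> w" "last ys \<noteq> w" using mem_base[OF ys] by blast+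
    have hl: "hole w (hd ys)" "hole w (last ys)"
      using alternate[of "[c]" ys] ys alternate[OF b2] ne c V by (auto simp: hole_iff)
    have "E c h"
    proof (cases "h = hd ys")
      case True
      then show ?thesis using f(7) ne by (simp add: successively_Cons)
    next
      case False
      have "h \<in> set (c # ys)" "h \<noteq> c" using mem_base[OF ys] hole_w[OF h] c by auto
      then have "h \<in> set (tl ys)" using False ne by (cases ys) auto
      then obtain A B where AB: "tl ys = A @ h # B" by (meson split_list)
      have eq: "ys @ [c] = hd ys # A @ h # (B @ [c])" using AB ne by (metis append_Cons append_assoc list.collapse)
      have "base (hd ys # A @ h # (B @ [c])) w" using b2 unfolding eq .
      from two_holes(16)[OF this hl(1) h] show ?thesis using ind[OF h hl(1)] by simp
    qed
    moreover have "E h c"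
    proof (cases "h = last ys")
      case True
      then show ?thesis using f(8) ne by simp
    next
      case False
      have "h \<in> set (c # ys)" "h \<noteq> c" using mem_base[OF ys] hole_w[OF h] c by auto
      then have "h \<in> set (butlast ys)" using False ne by (cases ys rule: rev_cases) auto
      then obtain A B where AB: "butlast ys = A @ h # B" by (meson split_list)
      have eq: "c # ys = (c # A @ h # B) @ [last ys]" using AB ne by (metis append_Cons append_butlast_last_id)
      have "base ((c # A @ h # B) @ [last ys]) w" using ys unfolding eq .
      from base_rotate[OF this] have "base (last ys # (c # A) @ h # B) w" by simp
      from two_holes(15)[OF this hl(2) h] show ?thesis using ind[OF hl(2) h] by simp
    qed
    ultimately show ?thesis by blast
  qed
  define N where "N = {v \<in> V. E w v}"
  define I where "I = insert w {h. hole w h}"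
  have wV: "w \<in> V" using base_facts(2)[OF base_w] .
  have "I \<union> N = V" "I \<inter> N = {}" using wV irrefl by (auto simp: I_def N_def hole_iff)
  moreover have "card N > 0" using degrees_w(3,5) base_facts(6)[OF base_w] by (simp add: N_def)
  then have "N \<noteq> {}" by auto
  moreover have "card I = card N + 1"
    using degrees_w(3,4) finite_holes[of w] by (simp add: I_def N_def hole_def)
  moreover have "(E u v \<longleftrightarrow> v \<in> N) \<and> (E v u \<longleftrightarrow> v \<in> N)" if u: "u \<in> I" for u v
  proof (cases "u = w")
    case True
    then show ?thesis using symmetric_w arc_V(2) by (auto simp: N_def)
  next
    case False
    then have hu: "hole w u" using u by (simp add: I_def)
    show ?thesis
    proof (cases "v \<in> V")
      case True
      then show ?thesis
      proof (cases rule: V_cases)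
        case 1
        then show ?thesis using hole_w[OF hu] irrefl[of w] by (simp add: N_def)
      next
        case 2
        then show ?thesis using ind[OF hu 2] ind[OF 2 hu] hole_w[OF 2] by (simp add: N_def)
      next
        case 3
        then show ?thesis using arcs[OF hu 3] True by (simp add: N_def)
      qed
    next
      case False
      then show ?thesis using arc_V by (auto simp: N_def)
    qed
  qed
  ultimately show ?thesis unfolding shape_D2_def by blast
qed

definition complete_holes :: bool where
  "complete_holes \<longleftrightarrow> (\<forall>x y. hole w x \<longrightarrow> hole w y \<longrightarrow> x \<noteq> y \<longrightarrow> E x y)"

lemma complete_holesD: "complete_holes \<Longrightarrow> hole w x \<Longrightarrow> hole w y \<Longrightarrow> x \<noteq> y \<Longrightarrow> E x y"
  unfolding complete_holes_def by blast

text \<open>Since the holes are adjacent, \<open>two_holes\<close> excludes arcs between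
  \<open>e\<close> and holes that are not on the cycle itself. If \<open>e\<close> had an arc to a
  neighbour \<open>c\<close> of \<open>w\<close> further on, a Hamilton cycle could jump along it
  and pick up the skipped vertices through \<open>w\<close>, returning to \<open>h\<close> by
  \<open>h'\<close>.\<close>

lemma complete_step:
  assumes c: complete_holes
    and b: "base (h # e # h' # P) w" and h: "hole w h"
  shows "E w e" "hole w h'" "P \<noteq> []" "E w (hd P)"
    "hole w x \<Longrightarrow> E e x \<longleftrightarrow> x = h'" "hole w x \<Longrightarrow> E x e \<longleftrightarrow> x = h"
    "E w c \<Longrightarrow> E e c \<Longrightarrow> c = hd P"
proof -
  note f = base_facts[OF b] and com = complete_holesD[OF c]
  show e: "E w e" using alternate[of "[h]" "e # h' # P"] b hole_w[OF h] by simp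
  have "\<not> E w h'" using alternate[of "[h, e]" "h' # P"] b e by simp
  moreover have "h' \<in> V" "h' \<noteq> w" using mem_base[OF b, of h'] by simp_all
  ultimately show h': "hole w h'" by (simp add: hole_iff)
  have bb: "base (h # [e] @ h' # P) w" using b by simp
  note t = two_holes[OF bb h h']
  show P: "P \<noteq> []" "E w (hd P)" using t(4,6) by auto
  have hh': "h \<noteq> h'" "e \<noteq> h" "e \<noteq> h'" using f(1) by auto
  have eh: "E h e" "E e h'" using f(7) by simp_all
  show "E e x \<longleftrightarrow> x = h'" if x: "hole w x"
  proof (cases "x = h'")
    case False
    have r: "base (h' # P @ [h, e]) w" using base_rotate[of "[h, e]" "h' # P" w] b by simp
    have "x \<in> set (h # e # h' # P)" "x \<noteq> e" using mem_base[OF b] hole_w[OF x] e by blast+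
    then have "x \<in> set (P @ [h])" using False by auto
    then obtain A B where AB: "P @ [h] = A @ x # B" by (meson split_list)
    have eq: "h' # P @ [h, e] = h' # A @ x # (B @ [e])" using AB by (metis append_Cons append_assoc append_Nil)
    have "base (h' # A @ x # (B @ [e])) w" using r unfolding eq .
    then show ?thesis using two_holes(16)[of h' A x "B @ [e]" w, OF _ h' x] com[OF x h' False] False by simp
  qed (use eh in simp)
  show "E x e \<longleftrightarrow> x = h" if x: "hole w x"
  proof (cases "x = h")
    case False
    have "x \<in> set (h # e # h' # P)" "x \<noteq> e" using mem_base[OF b] hole_w[OF x] e by blast+
    then have "x \<in> set (h' # P)" using False by auto
    then obtain A B where AB: "h' # P = A @ x # B" by (meson split_list)
    have "base (h # (e # A) @ x # B) w" using b AB by simp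
    then show ?thesis using two_holes(15)[of h "e # A" x B w, OF _ h x] com[OF h x] False by simp
  qed (use eh in simp)
  show "c = hd P" if c: "E w c" "E e c"
  proof (rule ccontr)
    assume n: "c \<noteq> hd P"
    have cV: "c \<in> V" "c \<noteq> w" "c \<noteq> e" using c arc_V irrefl by auto
    have "\<not> hole w c" using c by (simp add: hole_iff)
    moreover have "c \<in> set (h # e # h' # P)" using mem_base[OF b] cV by blast
    ultimately have "c \<in> set P" using cV(3) h h' by auto
    then obtain U W where UW: "P = U @ c # W" by (meson split_list)
    have U: "U \<noteq> []" using n UW by auto
    define x where "x = last U"
    have U': "U = butlast U @ [x]" using U by (simp add: x_def)
    have "\<not> E w x" using alternate[of "h # e # h' # U" "c # W"] b c(1) U unfolding UW x_def by simp
    moreover have "x \<in> set (h # e # h' # P)" using U unfolding x_def UW by simp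
    then have "x \<in> V" "x \<noteq> w" using mem_base[OF b] by blast+
    ultimately have x: "hole w x" by (simp add: hole_iff)
    have U0: "butlast U \<noteq> []"
    proof
      assume "butlast U = []"
      then have "hd P = x" using U' UW by (metis append_Cons append_Nil list.sel(1))
      then show False using P(2) hole_w[OF x] by simp
    qed
    have hP: "hd P = hd (butlast U)" using U0 U' UW by (metis append_assoc hd_append2)
    have lP: "last P = last (c # W)" using UW by simp
    have sP: "successively E (butlast U @ [x])" "successively E (c # W)" "distinct (h # e # h' # (butlast U @ [x]) @ c # W)"
      "w \<notin> set (h # e # h' # (butlast U @ [x]) @ c # W)" "set (h # e # h' # (butlast U @ [x]) @ c # W) = V - {w}"
      using f(1,3,4,7) U'[symmetric] UW by (auto simp: path_simps)
    have xh: "E x h'" "E h' h" using com x h h' hh' sP(3) by auto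
    have wP: "E (last P) w" "E w (hd P)" using t(6,8) by auto
    have "successively E (w # butlast U @ [x])" using sP(1) U0 wP(2) hP by (simp add: successively_Cons)
    moreover have "successively E (h # e # c # W)" using sP(2) c eh by simp
    moreover have "successively E ((h # e # c # W) @ (w # butlast U @ [x]))"
      using calculation wP(1) lP by (subst successively_append_iff) simp
    then have "successively E (((h # e # c # W) @ (w # butlast U @ [x])) @ [h'])"
      using xh by (subst successively_append_iff) simp
    ultimately have "cyc E (((h # e # c # W) @ (w # butlast U @ [x])) @ [h'])" (is "cyc E ?zs")
      using xh(2) sP(3,4) unfolding cyc_def by auto
    moreover have "set ?zs = V" using sP(5) f(2) by auto
    ultimately show False using not_hamiltonian by blast
  qed
qed

text \<open>There is no arc from \<open>e\<close> to \<open>h\<close>, so the degree condition gives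
  \<open>e\<close> out-degree at least \<open>g\<close>, but only \<open>w\<close>,
  \<open>h'\<close> and \<open>hd P\<close> can be its out-neighbours. For \<open>g\<close> at least
  2 this leaves digraphs with 5 or 7 vertices.\<close>

lemma complete_out:
  assumes c: complete_holes
    and b: "base (h # e # h' # P) w" and h: "hole w h"
  shows "g \<le> 3" "g = 3 \<Longrightarrow> E e (hd P)"
proof -
  note s = complete_step[OF c b h] and f = base_facts[OF b]
  have ne: "h \<noteq> h'" "h \<noteq> e" using f(1) by auto
  have eV: "e \<in> V" "h \<in> V" using mem_base[OF b, of e] mem_base[OF b, of h] by simp_all
  have "\<not> E e h" using s(5)[OF h] ne by simp
  then have "card V \<le> out V e + inn V h + 1" using degrees eV ne by auto
  moreover have "inn V h = g" using base_swap(2)[OF b h] degrees_w(1) by simp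
  ultimately have ge: "out V e \<ge> g" using base_facts(5)[OF base_w] degrees_w(5) by linarith
  have sub: "{c \<in> V. E e c} \<subseteq> {w, h', hd P}"
  proof
    fix c assume "c \<in> {c \<in> V. E e c}"
    then have c: "c \<in> V" "E e c" by auto
    then show "c \<in> {w, h', hd P}" by (cases rule: V_cases) (use s(5,7) c in auto)
  qed
  have "card {w, h', hd P} \<le> 3" by (simp add: card_insert_if)
  moreover have "out V e \<le> card {w, h', hd P}" unfolding nout_def by (rule card_mono[OF _ sub]) simp
  ultimately show "g \<le> 3" using ge by simp
  show "E e (hd P)" if "g = 3"
  proof (rule ccontr)
    assume "\<not> E e (hd P)"
    then have "{c \<in> V. E e c} \<subseteq> {w, h'}" using sub by auto
    then have "out V e \<le> card {w, h'}" unfolding nout_def by (intro card_mono) auto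
    also have "\<dots> \<le> 2" by (simp add: card_insert_if)
    finally show False using ge that by simp
  qed
qed

text \<open>Rotating the cycle by two steps keeps its form, so the rows of \<open>h\<close> and
  \<open>e\<close> determine those of all other vertices of the cycle.\<close>

lemma six_cycle_rows:
  assumes c: complete_holes and g: "g = 3" and b: "base [h, e, h', e', h'', e''] w" and h: "hole w h"
  shows "E w e" "hole w h'"
    "v \<in> V \<Longrightarrow> E h v \<longleftrightarrow> v \<in> {h', h'', e}" "v \<in> V \<Longrightarrow> E e v \<longleftrightarrow> v \<in> {w, h', e'}"
proof -
  have b2: "base [h', e', h'', e'', h, e] w" using base_rotate[of "[h, e]" "[h', e', h'', e'']" w] b by simp
  have b3: "base [h'', e'', h, e, h', e'] w" using base_rotate[of "[h', e']" "[h'', e'', h, e]" w] b2 by simp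
  note s1 = complete_step[OF c b h]
  show e: "E w e" and h': "hole w h'" by (rule s1)+
  note s2 = complete_step[OF c b2 h']
  note s3 = complete_step[OF c b3 s2(2)]
  have d: "distinct [w, h, e, h', e', h'', e'']" "V = {w, h, e, h', e', h'', e''}"
    using base_facts(1,2,3,4)[OF b] by auto
  have dr: "distinct [e'', h'', e', h', e, h, w]" using d(1) by auto
  have v: "v = w \<or> v = h \<or> v = e \<or> v = h' \<or> v = e' \<or> v = h'' \<or> v = e''" if "v \<in> V" using that d(2) by auto
  have hh: "E h h'" "E h h''" using complete_holesD[OF c h] h' s2(2) d(1) by auto
  have he: "E h e" "\<not> E h e'" "\<not> E h e''" unfolding s1(6)[OF h] s2(6)[OF h] s3(6)[OF h] using d(1) dr by simp_all
  show "E h v \<longleftrightarrow> v \<in> {h', h'', e}" if "v \<in> V"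
    using v[OF that] d(1) dr hh he hole_w[OF h] irrefl[of h] by (elim disjE) simp_all
  have eh: "E e h'" "\<not> E e h" "\<not> E e h''" unfolding s1(5)[OF h] s1(5)[OF h'] s1(5)[OF s2(2)] using d(1) dr by simp_all
  have ee: "E e e'" using complete_out(2)[OF c b h g] by simp
  have ne: "\<not> E e e''"
  proof
    assume "E e e''" from s1(7)[OF s3(1) this] show False using d(1) by simp
  qed
  have ew: "E e w" "\<not> E e e" using e symmetric_w[of e] irrefl by blast+
  show "E e v \<longleftrightarrow> v \<in> {w, h', e'}" if "v \<in> V"
    using v[OF that] d(1) dr ee ne eh ew by (elim disjE) simp_all
qed

lemma complete_shape:
  assumes c: complete_holes and g: "g \<ge> 2"
  shows "shape_D3 V E \<or> shape_D4 V E"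
proof -
  note com = complete_holesD[OF c]
  have "{h. hole w h} \<noteq> {}" using degrees_w(4) g by (metis card.empty not_numeral_le_zero)
  then obtain h where h: "hole w h" by blast
  have "h \<in> V" "h \<noteq> w" using hole_w[OF h] by auto
  then obtain ys where ys: "base (h # ys) w" by (rule base_starting_at)
  have l: "length ys + 1 = 2 * g" using base_facts(5)[OF ys] base_facts(5)[OF base_w] degrees_w(5) by simp
  then have "length ys \<ge> 3" using g by linarith
  then obtain e h' P where P: "ys = e # h' # P" by (metis length_Cons list.exhaust list.size(3) One_nat_def numeral_3_eq_3 Suc_le_length_iff)
  have b: "base (h # e # h' # P) w" using ys P by simp
  have lP: "length P + 3 = 2 * g" using l P by simp
  have "g = 2 \<or> g = 3" using g complete_out(1)[OF c b h] by linarith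
  then show ?thesis
  proof
    assume "g = 2"
    then have "length P = 1" using lP by simp
    then obtain e' where e': "P = [e']" by (auto simp: length_Suc_conv)
    have b1: "base (h # e # h' # [e']) w" using b e' by simp
    have b2: "base (h' # e' # h # [e]) w" using base_rotate[of "[h, e]" "[h', e']" w] b1 by simp
    note s1 = complete_step[OF c b1 h]
    note h' = s1(2)
    note s2 = complete_step[OF c b2 h']
    have d: "distinct [w, h, e, h', e']" "V = {w, h, e, h', e'}"
      using base_facts(1,2,3,4)[OF b1] by auto
    have hh: "E h h'" "E h' h" using com h h' d(1) by auto
    have "E u v \<longleftrightarrow> (u, v) \<in> {(e', h), (h, e), (e, h'), (h', e'), (h', h), (h, h')} \<or>
        u \<in> {w} \<and> v \<in> {w} \<and> u \<noteq> v \<or> u \<in> {e', e} \<and> v \<in> {w} \<or> u \<in> {w} \<and> v \<in> {e', e}"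
      if uv: "(u, v) \<notin> {(e', e), (e, e')}" for u v
    proof (cases "u \<in> V \<and> v \<in> V")
      case True
      then have u: "u = w \<or> u = h \<or> u = e \<or> u = h' \<or> u = e'" and v: "v = w \<or> v = h \<or> v = e \<or> v = h' \<or> v = e'"
        using d(2) by auto
      have ww: "E w e" "E e w" "E w e'" "E e' w" using s1(1) s2(1) symmetric_w[of e] symmetric_w[of e'] by auto
      have eh: "E e h'" "\<not> E e h" "E h e" "\<not> E h' e" "E e' h" "\<not> E e' h'" "E h' e'" "\<not> E h e'"
        using s1(5,6)[OF h] s1(5,6)[OF h'] s2(5,6)[OF h] s2(5,6)[OF h'] d(1) by auto
      note loops = irrefl[of w] irrefl[of h] irrefl[of e] irrefl[of h'] irrefl[of e']
      have "distinct [e', h', e, h, w]" using d(1) by auto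
      then show ?thesis
        using u v uv d(1) ww eh hh loops hole_w[OF h] hole_w[OF h'] by (elim disjE) simp_all
    next
      case False
      then show ?thesis using arc_V d(2) by blast
    qed
    \<comment> \<open>The neighbours \<open>e'\<close>, \<open>e\<close> play \<open>v0\<close>,
      \<open>v1\<close>, the holes \<open>h'\<close>, \<open>h\<close> play \<open>x\<close>,
      \<open>y\<close>, and \<open>w\<close> is the complete digraph on one vertex.\<close>
    then have "shape_D3 V E" by (intro shape_D3I[of e' e h' h "{w}"]) (use d in auto)
    then show ?thesis ..
  next
    assume g3: "g = 3"
    then have "length P = 3" using lP by simp
    then obtain e' h'' e'' where e': "P = [e', h'', e'']" by (auto simp: numeral_3_eq_3 length_Suc_conv)
    have b1: "base [h, e, h', e', h'', e''] w" using b e' by simp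
    have b2: "base [h', e', h'', e'', h, e] w" using base_rotate[of "[h, e]" "[h', e', h'', e'']" w] b1 by simp
    have b3: "base [h'', e'', h, e, h', e'] w" using base_rotate[of "[h', e']" "[h'', e'', h, e]" w] b2 by simp
    note r1 = six_cycle_rows[OF c g3 b1 h]
    note r2 = six_cycle_rows[OF c g3 b2 r1(2)]
    note r3 = six_cycle_rows[OF c g3 b3 r2(2)]
    have d: "distinct [w, h, e, h', e', h'', e'']" "V = {w, h, e, h', e', h'', e''}"
      using base_facts(1,2,3,4)[OF b1] by auto
    have dr: "distinct [e'', h'', e', h', e, h, w]" using d(1) by auto
    have row_w: "E w v \<longleftrightarrow> v \<in> {e, e', e''}" if "v \<in> V" for v
    proof -
      have v: "v = w \<or> v = h \<or> v = e \<or> v = h' \<or> v = e' \<or> v = h'' \<or> v = e''" using that d(2) by auto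
      show ?thesis
        using v d(1) dr r1(1) r2(1) r3(1) hole_w[OF h] hole_w[OF r1(2)] hole_w[OF r2(2)] irrefl[of w] by (elim disjE) simp_all
    qed
    \<comment> \<open>\<open>w\<close> becomes the hub, its neighbours the \<open>c\<close> vertices
      and its holes the \<open>t\<close> vertices.\<close>
    have "E u v \<longleftrightarrow> (u, v) \<in> D4_arcs w e e' e'' h h' h''"
      for u v
    proof (cases "u \<in> V \<and> v \<in> V")
      case True
      then have v: "v \<in> V" and u: "u = w \<or> u = h \<or> u = h' \<or> u = h'' \<or> u = e \<or> u = e' \<or> u = e''" using d(2) by auto
      show ?thesis
        using u row_w[OF v] r1(3,4)[OF v] r2(3,4)[OF v] r3(3,4)[OF v] d(1) dr
        unfolding D4_arcs_def by (elim disjE; simp) blast+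
    next
      case False
      then have "\<not> E u v" using arc_V[of u v] by blast
      moreover have "D4_arcs w e e' e'' h h' h'' \<subseteq> V \<times> V" unfolding d(2) D4_arcs_def by simp
      ultimately show ?thesis using False by (meson mem_Sigma_iff subsetD)
    qed
    moreover have "distinct [w, e, e', e'', h, h', h'']" "V = {w, e, e', e'', h, h', h''}" using d by auto
    ultimately have "shape_D4 V E" by (intro shape_D4I)
    then show ?thesis ..
  qed
qed

lemma alternating_shape: "shape_D2 V E \<or> shape_D3 V E \<or> shape_D4 V E"
proof (cases "\<forall>x y. hole w x \<longrightarrow> hole w y \<longrightarrow> \<not> E x y")
  case True
  then show ?thesis using independent_shape by blast
next
  case False
  then obtain a b where ab: "hole w a" "hole w b" "E a b" by blast
  then have "a \<noteq> b" using irrefl by auto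
  then have "card {a, b} \<le> card {h. hole w h}" using ab finite_holes by (intro card_mono) auto
  then have "g \<ge> 2" using degrees_w(4) \<open>a \<noteq> b\<close> by simp
  then show ?thesis using complete_shape holes_dichotomy False unfolding complete_holes_def by blast
qed

end

theorem (in ore) exceptional_shape: "shape_D1 V E \<or> shape_D2 V E \<or> shape_D3 V E \<or> shape_D4 V E"
proof (cases "\<exists>xs w. base xs w")
  case False
  then show ?thesis using ex_kite_or_base ore_kite.kite_shape by metis
next
  case True
  then obtain xs w where "base xs w" by blast
  then have p: "(\<lambda>(xs, w). base xs w) (xs, w)" by simp
  have "card (twoway v) < card V + 1" for v
    using card_mono[OF finite_V, of "twoway v"] by (auto simp: twoway_def)
  then have "\<forall>p. (\<lambda>(xs, w). base xs w) p \<longrightarrow> (\<lambda>(xs, w). card (twoway w)) p < card V + 1" by auto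
  from ex_has_greatest_nat[OF p this]
  obtain ys v where m: "base ys v" "\<And>zs u. base zs u \<Longrightarrow> card (twoway u) \<le> card (twoway v)" by auto
  have "ore_alternating V E ys v"
    by unfold_locales (rule m(1), rule max_base_symmetric[OF m(1)], rule m(2))
  from ore_alternating.alternating_shape[OF this] show ?thesis by blast
qed

section \<open>Transfer to digraphs\<close>

lemma (in wf_digraph) successively_awalk:
  assumes "xs \<noteq> []" "successively (\<lambda>u v. u \<rightarrow> v) xs" "set xs \<subseteq> verts G"
  shows "\<exists>p. awalk (hd xs) p (last xs) \<and> awalk_verts (hd xs) p = xs"
  using assms
proof (induction xs rule: list_nonempty_induct)
  case (single x)
  then show ?case by (intro exI[of _ "[]"]) (simp add: awalk_Nil_iff)
next
  case (cons x xs)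
  then obtain p where p: "awalk (hd xs) p (last xs)" "awalk_verts (hd xs) p = xs"
    by (auto simp: successively_Cons)
  have "x \<rightarrow> hd xs" using cons by (simp add: successively_Cons)
  then obtain e where "e \<in> arcs G" "tail G e = x" "head G e = hd xs" by auto
  then show ?case using p cons.hyps by (intro exI[of _ "e # p"]) (simp add: awalk_Cons_iff)
qed

text \<open>Two vertices exclude the one-vertex list that \<open>cyc\<close> admits, so that the
  closing arc exists.\<close>

lemma (in digraph) cyc_hamilton_cycle:
  assumes "cyc (\<lambda>u v. u \<rightarrow> v) xs" "set xs = verts G" "card (verts G) \<ge> 2"
  shows "\<exists>p. hamilton_cycle p"
proof -
  have xs: "xs \<noteq> []" "distinct xs" "successively (\<lambda>u v. u \<rightarrow> v) xs" "length xs \<noteq> 1"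
    using assms distinct_card[of xs] by (auto simp: cyc_def)
  then have "last xs \<rightarrow> hd xs" using assms(1) by (simp add: cyc_def)
  then obtain e where e: "e \<in> arcs G" "tail G e = last xs" "head G e = hd xs" by auto
  obtain p where p: "awalk (hd xs) p (last xs)" "awalk_verts (hd xs) p = xs"
    using successively_awalk[of xs] xs assms(2) by auto
  have "hd xs \<in> verts G" using xs(1) assms(2) hd_in_set by blast
  then have "awalk (last xs) [e] (hd xs)" using e by (simp add: awalk_Cons_iff awalk_Nil_iff)
  then have w: "awalk (hd xs) (p @ [e]) (hd xs)" using p(1) by auto
  have "xs = (if p = [] then [hd xs] else map (tail G) p @ [head G (last p)])"
    using p(2) awalk_verts_conv[of "hd xs" p] by simp
  then have "p \<noteq> []" using xs(4) by (metis length_Cons list.size(3) One_nat_def)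
  then have "map (tail G) p @ [head G (last p)] = xs" using p(2) awalk_verts_conv[of "hd xs" p] by simp
  then have t: "map (tail G) (p @ [e]) = xs" using e(2) xs(1) by (metis append_butlast_last_id butlast_snoc list.simps(8,9) map_append)
  have "awalk_verts (hd xs) (p @ [e]) = map (tail G) (p @ [e]) @ [head G e]"
    using awalk_verts_conv[of "hd xs" "p @ [e]"] by simp
  then have "awalk_verts (hd xs) (p @ [e]) = xs @ [hd xs]" unfolding t e(3) .
  then have "distinct (tl (awalk_verts (hd xs) (p @ [e])))" using xs(1,2) by (cases xs) auto
  then have "cycle (p @ [e])" using w unfolding cycle_def by blast
  moreover have "tail G ` set (p @ [e]) = verts G" using t assms(2) by (metis list.set_map)
  ultimately show ?thesis unfolding hamilton_cycle_def by blast
qed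

lemma (in digraph) out_degree_eq_nout: "out_degree G u = nout (\<lambda>u v. u \<rightarrow> v) (verts G) u"
proof -
  have "inj_on (head G) (out_arcs G u)"
    by (rule inj_onI) (auto simp: out_arcs_def arc_to_ends_def intro: no_multi_arcs)
  moreover have "head G ` out_arcs G u = {v \<in> verts G. u \<rightarrow> v}"
    by (auto simp: out_arcs_def arcs_ends_conv image_iff)
  ultimately show ?thesis unfolding out_degree_def nout_def by (metis card_image)
qed

lemma (in digraph) in_degree_eq_nin: "in_degree G v = nin (\<lambda>u v. u \<rightarrow> v) (verts G) v"
proof -
  have "inj_on (tail G) (in_arcs G v)"
    by (rule inj_onI) (auto simp: in_arcs_def arc_to_ends_def intro: no_multi_arcs)
  moreover have "tail G ` in_arcs G v = {u \<in> verts G. u \<rightarrow> v}"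
    by (auto simp: in_arcs_def arcs_ends_conv image_iff)
  ultimately show ?thesis unfolding in_degree_def nin_def by (metis card_image)
qed

text \<open>The arcs of \<open>D\<close> may have any type, whereas the families consist of pair
  digraphs; an injection of the vertices carries \<open>D\<close> to an isomorphic copy of that
  kind.\<close>

definition image_digraph :: "('a \<Rightarrow> 'c) \<Rightarrow> ('a, 'b) pre_digraph \<Rightarrow> 'c pair_pre_digraph" where
  "image_digraph f D = \<lparr>pverts = f ` verts D, parcs = map_prod f f ` arcs_ends D\<rparr>"

lemma (in digraph) iso_image_digraph:
  assumes "inj_on f (verts G)"
  shows "digraph_iso G (with_proj (image_digraph f G))"
proof -
  define hom where "hom = \<lparr>iso_verts = f, iso_arcs = \<lambda>a. (f (tail G a), f (head G a)), iso_head = snd, iso_tail = fst\<rparr>"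
  have "inj_on (\<lambda>a. (f (tail G a), f (head G a))) (arcs G)"
  proof (rule inj_onI)
    fix a b assume ab: "a \<in> arcs G" "b \<in> arcs G" "(f (tail G a), f (head G a)) = (f (tail G b), f (head G b))"
    then have "tail G a = tail G b" "head G a = head G b" using inj_onD[OF assms] by auto
    then show "a = b" using ab no_multi_arcs by (simp add: arc_to_ends_def)
  qed
  then have "digraph_isomorphism hom"
    using assms wf_digraph by (simp add: digraph_isomorphism_def hom_def)
  moreover have "with_proj (image_digraph f G) = app_iso hom G"
    by (simp add: with_proj_def image_digraph_def app_iso_def hom_def arcs_ends_conv image_image)
  ultimately show ?thesis unfolding digraph_iso_def by blast
qed

lemma family_D1I:
  "m \<ge> 1 \<Longrightarrow> n \<ge> 1 \<Longrightarrow> complete_digraph (n + 1) (with_proj K) \<Longrightarrow> complete_digraph (m + 1) (with_proj L)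
    \<Longrightarrow> pverts K \<inter> pverts L = {z} \<Longrightarrow> G = \<lparr>pverts = pverts K \<union> pverts L, parcs = parcs K \<union> parcs L\<rparr>
    \<Longrightarrow> G \<in> family_D1"
  unfolding family_D1_def by blast

lemma family_D2I:
  "n \<ge> 1 \<Longrightarrow> pair_digraph H \<Longrightarrow> card (pverts H) = n \<Longrightarrow> finite I \<Longrightarrow> card I = n + 1 \<Longrightarrow> I \<inter> pverts H = {}
    \<Longrightarrow> G = \<lparr>pverts = pverts H \<union> I, parcs = parcs H \<union> two_way I (pverts H)\<rparr> \<Longrightarrow> G \<in> family_D2"
  unfolding family_D2_def by blast

lemma family_D3I:
  "n \<ge> 1 \<Longrightarrow> distinct [v0, v1, x, y] \<Longrightarrow> complete_digraph n (with_proj K)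
    \<Longrightarrow> pverts (digraph_D3 v0 v1 x y) \<inter> pverts K = {} \<Longrightarrow> A \<subseteq> {(v0, v1), (v1, v0)}
    \<Longrightarrow> G = \<lparr>pverts = pverts (digraph_D3 v0 v1 x y) \<union> pverts K,
         parcs = parcs (digraph_D3 v0 v1 x y) \<union> parcs K \<union> two_way {v0, v1} (pverts K) \<union> A\<rparr>
    \<Longrightarrow> G \<in> family_D3"
  unfolding family_D3_def mem_Collect_eq
  by (rule exI[of _ v0], rule exI[of _ v1], rule exI[of _ x], rule exI[of _ y], rule exI[of _ K], rule exI[of _ A],
      rule exI[of _ n]) simp

lemma shape_D1_family:
  assumes "shape_D1 (verts D) (\<lambda>u v. u \<rightarrow>\<^bsub>D\<^esub> v)" "inj_on f (verts D)"
  shows "image_digraph f D \<in> family_D1"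
proof -
  obtain A B z where s: "A \<union> B = verts D" "A \<inter> B = {z}" "card A \<ge> 2" "card B \<ge> 2"
    "\<And>u v. u \<rightarrow>\<^bsub>D\<^esub> v \<longleftrightarrow> u \<noteq> v \<and> (u \<in> A \<and> v \<in> A \<or> u \<in> B \<and> v \<in> B)"
    using assms(1) unfolding shape_D1_def by blast
  define cl where "cl X = \<lparr>pverts = f ` X, parcs = {(u, v). (u, v) \<in> f ` X \<times> f ` X \<and> u \<noteq> v}\<rparr>" for X
  have inj: "inj_on f A" "inj_on f B" using assms(2) s(1) by (auto intro: inj_on_subset)
  have fin: "finite A" "finite B" using s(3,4) by (auto intro: card_ge_0_finite)
  have "complete_digraph (card A - 1 + 1) (with_proj (cl A))" "complete_digraph (card B - 1 + 1) (with_proj (cl B))"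
    using inj fin s(3,4) by (simp_all add: complete_digraph_pair_def cl_def card_image)
  moreover have "pverts (cl A) \<inter> pverts (cl B) = {f z}"
    using s(1,2) inj_on_image_Int[OF assms(2), of A B] by (auto simp: cl_def)
  moreover have "image_digraph f D = \<lparr>pverts = pverts (cl A) \<union> pverts (cl B), parcs = parcs (cl A) \<union> parcs (cl B)\<rparr>"
  proof -
    have "arcs_ends D = {(u, v). (u, v) \<in> A \<times> A \<and> u \<noteq> v} \<union> {(u, v). (u, v) \<in> B \<times> B \<and> u \<noteq> v}"
      using s(5) by auto
    moreover have "map_prod f f ` {(u, v). (u, v) \<in> X \<times> X \<and> u \<noteq> v} = parcs (cl X)" if "inj_on f X" for X
      using inj_onD[OF that] by (force simp: cl_def)
    ultimately have "map_prod f f ` arcs_ends D = parcs (cl A) \<union> parcs (cl B)"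
      using inj by (simp only: image_Un)
    then show ?thesis unfolding image_digraph_def s(1)[symmetric] by (simp add: cl_def image_Un)
  qed
  ultimately show ?thesis using s(3,4)
    by (intro family_D1I[of "card B - 1" "card A - 1" "cl A" "cl B" "f z"]) simp_all
qed

lemma shape_D2_family:
  assumes D: "digraph D" and s: "shape_D2 (verts D) (\<lambda>u v. u \<rightarrow>\<^bsub>D\<^esub> v)" and f: "inj_on f (verts D)"
  shows "image_digraph f D \<in> family_D2"
proof -
  interpret digraph D by (rule D)
  obtain I N where s: "I \<union> N = verts D" "I \<inter> N = {}" "N \<noteq> {}" "card I = card N + 1"
    "\<And>u v. u \<in> I \<Longrightarrow> (u \<rightarrow>\<^bsub>D\<^esub> v \<longleftrightarrow> v \<in> N) \<and> (v \<rightarrow>\<^bsub>D\<^esub> u \<longleftrightarrow> v \<in> N)"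
    using s unfolding shape_D2_def by blast
  have fin: "finite I" "finite N" using finite_verts s(1) by (metis finite_Un)+
  have inj: "inj_on f I" "inj_on f N" using f s(1) by (auto intro: inj_on_subset)
  define H where "H = \<lparr>pverts = f ` N, parcs = map_prod f f ` (arcs_ends D \<inter> N \<times> N)\<rparr>"
  have "pair_digraph H"
  proof
    show "finite (pverts H)" "finite (parcs H)" using fin by (auto simp: H_def)
    show "fst e \<in> pverts H" "snd e \<in> pverts H" if "e \<in> parcs H" for e using that by (auto simp: H_def)
    show "fst e \<noteq> snd e" if "e \<in> parcs H" for e
    proof -
      obtain u v where uv: "e = (f u, f v)" "u \<rightarrow>\<^bsub>D\<^esub> v" "u \<in> N" "v \<in> N" using \<open>e \<in> parcs H\<close> by (auto simp: H_def)
      then have "u \<noteq> v" using adj_not_same by blast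
      then show ?thesis using uv inj_onD[OF inj(2), of u v] by auto
    qed
  qed
  moreover have "I \<subseteq> verts D" "N \<subseteq> verts D" using s(1) by auto
  then have "f ` I \<inter> pverts H = {}" using s(2) inj_on_image_Int[OF f, of I N] by (simp add: H_def)
  moreover have "card (pverts H) = card N" "card (f ` I) = card N + 1" "card N \<ge> 1" "finite (f ` I)"
    using inj s(3,4) fin by (simp_all add: H_def card_image Suc_le_eq card_gt_0_iff)
  moreover have "image_digraph f D = \<lparr>pverts = pverts H \<union> f ` I, parcs = parcs H \<union> two_way (f ` I) (pverts H)\<rparr>"
  proof -
    have "arcs_ends D = (arcs_ends D \<inter> N \<times> N) \<union> (I \<times> N \<union> N \<times> I)"
    proof (rule set_eqI, clarify)
      fix u v
      have "u \<in> I \<or> u \<in> N" "v \<in> I \<or> v \<in> N" if "(u, v) \<in> arcs_ends D" using adj_in_verts[OF that] s(1) by auto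
      then show "(u, v) \<in> arcs_ends D \<longleftrightarrow> (u, v) \<in> (arcs_ends D \<inter> N \<times> N) \<union> (I \<times> N \<union> N \<times> I)"
        using s(5)[of u v] s(5)[of v u] s(2) by blast
    qed
    then have "map_prod f f ` arcs_ends D = parcs H \<union> (f ` I \<times> f ` N \<union> f ` N \<times> f ` I)"
      by (metis H_def image_Un map_prod_surj_on pair_pre_digraph.select_convs(2))
    moreover have "f ` verts D = f ` N \<union> f ` I" using s(1) by auto
    ultimately show ?thesis unfolding image_digraph_def two_way_def by (simp add: H_def)
  qed
  ultimately show ?thesis by (intro family_D2I[of "card N" H "f ` I"]) simp_all
qed

lemma shape_D3_family:
  assumes D: "digraph D" and s: "shape_D3 (verts D) (\<lambda>u v. u \<rightarrow>\<^bsub>D\<^esub> v)" and f: "inj_on f (verts D)"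
  shows "image_digraph f D \<in> family_D3"
proof -
  interpret digraph D by (rule D)
  obtain v0 v1 x y K where s: "distinct [v0, v1, x, y]" "{v0, v1, x, y} \<inter> K = {}" "K \<noteq> {}"
    "verts D = {v0, v1, x, y} \<union> K"
    "\<forall>u v. (u, v) \<notin> {(v0, v1), (v1, v0)} \<longrightarrow> (u \<rightarrow>\<^bsub>D\<^esub> v \<longleftrightarrow>
        (u, v) \<in> {(v0, y), (y, v1), (v1, x), (x, v0), (x, y), (y, x)} \<or>
        u \<in> K \<and> v \<in> K \<and> u \<noteq> v \<or> u \<in> {v0, v1} \<and> v \<in> K \<or> u \<in> K \<and> v \<in> {v0, v1})"
    using s unfolding shape_D3_def by (elim exE conjE) (rule that)
  have fin: "finite K" using finite_verts s(4) by (metis finite_Un)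
  have inj: "inj_on f K" "inj_on f {v0, v1, x, y}" using f s(4) by (auto intro: inj_on_subset)
  define L where "L = \<lparr>pverts = f ` K, parcs = {(u, v). (u, v) \<in> f ` K \<times> f ` K \<and> u \<noteq> v}\<rparr>"
  define A where "A = arcs_ends D \<inter> {(v0, v1), (v1, v0)}"
  have "complete_digraph (card K) (with_proj L)"
    using inj(1) fin by (simp add: complete_digraph_pair_def L_def card_image)
  moreover have "distinct [f v0, f v1, f x, f y]" using s(1) inj(2) by (auto simp: inj_on_def)
  moreover have "pverts (digraph_D3 (f v0) (f v1) (f x) (f y)) \<inter> pverts L = {}"
  proof -
    have "f ` {v0, v1, x, y} \<inter> f ` K = f ` ({v0, v1, x, y} \<inter> K)"
      using inj_on_image_Int[OF f, of "{v0, v1, x, y}" K] s(4) by blast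
    then show ?thesis unfolding s(2) by (simp add: L_def digraph_D3_def)
  qed
  moreover have "card K \<ge> 1" using s(3) fin by (simp add: Suc_le_eq card_gt_0_iff)
  moreover have "map_prod f f ` A \<subseteq> {(f v0, f v1), (f v1, f v0)}" by (auto simp: A_def)
  moreover have "image_digraph f D =
    \<lparr>pverts = pverts (digraph_D3 (f v0) (f v1) (f x) (f y)) \<union> pverts L,
     parcs = parcs (digraph_D3 (f v0) (f v1) (f x) (f y)) \<union> parcs L \<union> two_way {f v0, f v1} (pverts L) \<union> map_prod f f ` A\<rparr>"
  proof -
    let ?D3 = "{(v0, y), (y, v1), (v1, x), (x, v0), (x, y), (y, x)}"
    have eq: "arcs_ends D = ?D3 \<union> {(u, v). (u, v) \<in> K \<times> K \<and> u \<noteq> v} \<union> ({v0, v1} \<times> K \<union> K \<times> {v0, v1}) \<union> A"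
    proof (rule set_eqI, clarify)
      fix u v
      show "(u, v) \<in> arcs_ends D \<longleftrightarrow>
        (u, v) \<in> ?D3 \<union> {(u, v). (u, v) \<in> K \<times> K \<and> u \<noteq> v} \<union> ({v0, v1} \<times> K \<union> K \<times> {v0, v1}) \<union> A"
      proof (cases "(u, v) \<in> {(v0, v1), (v1, v0)}")
        case True
        then have "(u, v) \<notin> ?D3" "u \<notin> K" "v \<notin> K" using s(1,2) by auto
        then show ?thesis using True unfolding A_def by blast
      next
        case False
        then have "(u, v) \<notin> A" unfolding A_def by blast
        then show ?thesis unfolding s(5)[rule_format, OF False] by auto
      qed
    qed
    have "map_prod f f ` {(u, v). (u, v) \<in> K \<times> K \<and> u \<noteq> v} = parcs L"
      using inj_onD[OF inj(1)] by (force simp: L_def)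
    moreover have "map_prod f f ` ({v0, v1} \<times> K \<union> K \<times> {v0, v1}) = two_way {f v0, f v1} (pverts L)"
      unfolding two_way_def L_def image_Un by (simp add: map_prod_surj_on[OF refl refl, of f f] image_Un)
    moreover have "map_prod f f ` ?D3 = parcs (digraph_D3 (f v0) (f v1) (f x) (f y))" by (simp add: digraph_D3_def)
    ultimately have "map_prod f f ` arcs_ends D = parcs (digraph_D3 (f v0) (f v1) (f x) (f y)) \<union> parcs L
        \<union> two_way {f v0, f v1} (pverts L) \<union> map_prod f f ` A"
      unfolding eq image_Un[of "map_prod f f" _ A] by (simp only: image_Un)
    moreover have "f ` verts D = pverts (digraph_D3 (f v0) (f v1) (f x) (f y)) \<union> pverts L"
      unfolding s(4) by (simp add: digraph_D3_def L_def image_Un)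
    ultimately show ?thesis unfolding image_digraph_def by simp
  qed
  ultimately show ?thesis
    by (intro family_D3I[of "card K" "f v0" "f v1" "f x" "f y" L "map_prod f f ` A"]) simp_all
qed

lemma digraph_D4_explicit:
  "digraph_D4 = \<lparr>pverts = {Hub, C 0, C 1, C 2, T 0, T 1, T 2},
     parcs = {(Hub, C 0), (Hub, C 1), (Hub, C 2), (C 0, Hub), (C 1, Hub), (C 2, Hub),
       (C 0, C 1), (C 1, C 2), (C 2, C 0), (T 0, T 1), (T 0, T 2), (T 1, T 0), (T 1, T 2), (T 2, T 0), (T 2, T 1),
       (T 0, C 0), (T 1, C 1), (T 2, C 2), (C 0, T 1), (C 1, T 2), (C 2, T 0)}\<rparr>"
proof -
  have l: "i < 3 \<longleftrightarrow> i = 0 \<or> i = 1 \<or> i = 2" for i :: nat by auto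
  have "{..<3::nat} = {0, 1, 2}" by auto
  moreover have "{(C i, C ((i + 1) mod 3)) | i. i < 3} = {(C 0, C 1), (C 1, C 2), (C 2, C 0)}"
    "{(T i, C i) | i. i < 3} = {(T 0, C 0), (T 1, C 1), (T 2, C 2)}"
    "{(C i, T ((i + 1) mod 3)) | i. i < 3} = {(C 0, T 1), (C 1, T 2), (C 2, T 0)}"
    unfolding l by auto
  moreover have "{(T i, T j) | i j. i < 3 \<and> j < 3 \<and> i \<noteq> j} = {(T 0, T 1), (T 0, T 2), (T 1, T 0), (T 1, T 2), (T 2, T 0), (T 2, T 1)}"
    unfolding l by auto
  ultimately show ?thesis unfolding digraph_D4_def two_way_def by (simp add: insert_commute)
qed

lemma shape_D4_iso:
  assumes D: "digraph D" and s: "shape_D4 (verts D) (\<lambda>u v. u \<rightarrow>\<^bsub>D\<^esub> v)"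
  shows "digraph_iso D (with_proj digraph_D4)"
proof -
  interpret digraph D by (rule D)
  obtain h c0 c1 c2 t0 t1 t2 where s: "distinct [h, c0, c1, c2, t0, t1, t2]" "verts D = {h, c0, c1, c2, t0, t1, t2}"
    "\<forall>u v. u \<rightarrow>\<^bsub>D\<^esub> v \<longleftrightarrow> (u, v) \<in> D4_arcs h c0 c1 c2 t0 t1 t2"
    using s unfolding shape_D4_def by (elim exE conjE) (rule that)
  define f where "f v = (if v = h then Hub else if v = c0 then C 0 else if v = c1 then C 1 else if v = c2 then C 2
    else if v = t0 then T 0 else if v = t1 then T 1 else T 2)" for v
  have f: "f h = Hub" "f c0 = C 0" "f c1 = C 1" "f c2 = C 2" "f t0 = T 0" "f t1 = T 1" "f t2 = T 2"
    using s(1) by (auto simp: f_def)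
  have "inj_on f (verts D)" unfolding s(2) using s(1) by (simp add: f)
  moreover have "arcs_ends D = D4_arcs h c0 c1 c2 t0 t1 t2"
    using s(3) by (intro set_eqI) (simp only: split_paired_all)
  then have "image_digraph f D = digraph_D4"
    unfolding image_digraph_def digraph_D4_explicit s(2) D4_arcs_def by (simp add: f)
  ultimately show ?thesis using iso_image_digraph[of f] by simp
qed

theorem theorem3p1:
  fixes D :: "('a, 'b) pre_digraph"
  assumes "digraph D"
    and "card (verts D) \<ge> 2"
    and "\<And>u v. \<lbrakk>u \<in> verts D; v \<in> verts D; u \<noteq> v; \<not> u \<rightarrow>\<^bsub>D\<^esub> v\<rbrakk>
           \<Longrightarrow> out_degree D u + in_degree D v \<ge> card (verts D) - 1"
  shows "(\<exists>p. pre_digraph.hamilton_cycle D p)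
    \<or> (\<exists>E \<in> (family_D1 :: nat pair_pre_digraph set). digraph_iso D (with_proj E))
    \<or> (\<exists>E \<in> (family_D2 :: nat pair_pre_digraph set). digraph_iso D (with_proj E))
    \<or> (\<exists>E \<in> (family_D3 :: nat pair_pre_digraph set). digraph_iso D (with_proj E))
    \<or> digraph_iso D (with_proj digraph_D4)"
proof (cases "\<exists>p. pre_digraph.hamilton_cycle D p")
  case False
  interpret digraph D by (rule assms(1))
  have "ore (verts D) (\<lambda>u v. u \<rightarrow>\<^bsub>D\<^esub> v)"
  proof
    show "finite (verts D)" "card (verts D) \<ge> 2" using assms(2) by simp_all
    show "u \<in> verts D" "v \<in> verts D" if "u \<rightarrow>\<^bsub>D\<^esub> v" for u v using adj_in_verts[OF that] by blast+
    show "\<not> v \<rightarrow>\<^bsub>D\<^esub> v" for v using adj_not_same by blast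
    show "card (verts D) \<le> nout (\<lambda>u v. u \<rightarrow>\<^bsub>D\<^esub> v) (verts D) u + nin (\<lambda>u v. u \<rightarrow>\<^bsub>D\<^esub> v) (verts D) v + 1"
      if "u \<in> verts D" "v \<in> verts D" "u \<noteq> v" "\<not> u \<rightarrow>\<^bsub>D\<^esub> v" for u v
      using assms(3)[OF that] by (simp add: out_degree_eq_nout in_degree_eq_nin)
    show "\<not> cyc (\<lambda>u v. u \<rightarrow>\<^bsub>D\<^esub> v) xs" if "set xs = verts D" for xs
      using cyc_hamilton_cycle[OF _ that assms(2)] False by blast
  qed
  note shape = ore.exceptional_shape[OF this]
  \<comment> \<open>The vertex set is finite, so members of the families on \<open>nat\<close>
    suffice as representatives.\<close>
  obtain f :: "'a \<Rightarrow> nat" where f: "inj_on f (verts D)" using finite_imp_inj_to_nat_seg[OF finite_verts] by blast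
  show ?thesis
    using shape shape_D1_family[OF _ f] shape_D2_family[OF assms(1) _ f] shape_D3_family[OF assms(1) _ f]
      shape_D4_iso[OF assms(1)] iso_image_digraph[OF f] by blast
qed simp

end
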